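(* Let $n\ge1$, $s>0$, $\lambda>1$ and $1\le p\le\infty$. There exists a constant $C=C(n,s,p,\lambda)>0$ such that the following holds. Assume that $u,f\in L^p(\mathbb R^n)$ and that $$(-\Delta)^{s+\ln}u=f\qquad\text{in }\mathbb R^n$$ in the sense of (tempered) distributions, i.e. as an identity in $\mathcal S_\infty'(\mathbb R^n)$, where $(-\Delta)^{s+\ln}u$ is defined. Then $u\in\mathcal L^{p}_{s+\ln,\lambda}(\mathbb R^n)$ and $$\|u\|_{\mathcal L^{p}_{s+\ln,\lambda}(\mathbb R^n)}\le C\bigl(\|f\|_{L^p(\mathbb R^n)}+\|u\|_{L^p(\mathbb R^n)}\bigr).$$
   Context: The Fourier transform is $\mathcal F u(\xi)=\widehat u(\xi)=\int_{\mathbb{R}^n}u(x)e^{-2\pi i x\cdot\xi}\,dx$, extended to $\mathcal S'(\mathbb R^n)$. Let $\mathcal S_\infty(\mathbb R^n)=\{\varphi\in\mathcal S(\mathbb R^n):\int x^\gamma\varphi(x)\,dx=0\ \forall\gamma\in\mathbb N_0^n\}$ and $\mathcal S_0(\mathbb R^n)=\{\psi\in\mathcal S(\mathbb R^n):\partial^\gamma\psi(0)=0\ \forall\gamma\in\mathbb N_0^n\}$, with topologies induced from $\mathcal S(\mathbb R^n)$ and continuous duals $\mathcal S_\infty'$, $\mathcal S_0'$ (so $\mathcal S_\infty'\cong\mathcal S'/\{\text{polynomials}\}$). The Fourier transform is a homeomorphism $\mathcal S_\infty\to\mathcal S_0$, and $\mathcal F:\mathcal S_\infty'\to\mathcal S_0'$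 is defined by $\langle\widehat u,\psi\rangle=\langle u,\mathcal F^{-1}\psi\rangle$, $\psi\in\mathcal S_0$. Functions in $L^p(\mathbb R^n)$ are regarded as elements of $\mathcal S_\infty'$ by restriction. With $m_{s+\ln}(\xi)=(4\pi^2|\xi|^2)^s\ln(4\pi^2|\xi|^2)$ for $\xi\ne0$, $m_{s+\ln}(0)=0$ (multiplication by which maps $\mathcal S_0$ continuously into itself), the fractional-logarithmic Laplacian of $u\in\mathcal S_\infty'(\mathbb R^n)$ is the element $(-\Delta)^{s+\ln}u\in\mathcal S_\infty'(\mathbb R^n)$ with $\langle\mathcal F((-\Delta)^{s+\ln}u),\psi\rangle=\langle\widehat u,m_{s+\ln}\psi\rangle$ for all $\psi\in\mathcal S_0(\mathbb R^n)$. For $\lambda>1$, $(\lambda I-\Delta)^{s+\ln}$ is the Fourier multiplier on $\mathcal S'(\mathbb R^n)$ with symbol $(\lambda+4\pi^2|\xi|^2)^s\ln(\lambda+4\pi^2|\xi|^2)$, and $$\mathcal L^{p}_{s+\ln,\lambda}(\mathbb R^n)=\{u\in\mathcal S'(\mathbb R^n):(\lambda I-\Delta)^{s+\ln}u\in L^p(\mathbb R^n)\},\qquad \|u\|_{\mathcal L^{p}_{s+\ln,\lambda}(\mathbb R^n)}=\|(\lambda I-\Delta)^{s+\ln}u\|_{L^p(\mathbb R^n)}.$$ *)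

theory Defs
  imports "HOL-Analysis.Analysis" "HOL-Probability.Essential_Supremum"
begin

section \<open>Schwartz functions\<close>

definition partial_deriv :: "'n \<Rightarrow> (real ^ 'n \<Rightarrow> complex) \<Rightarrow> (real ^ 'n::finite \<Rightarrow> complex)" where
  "partial_deriv i \<phi> = (\<lambda>x. vector_derivative (\<lambda>t. \<phi> (x + t *\<^sub>R axis i 1)) (at 0))"

text \<open>Iterated partial derivatives are indexed by words of coordinate directions, since the index
  type carries no order in which a multi-index could be differentiated. On smooth functions
  derivatives commute, so these are exactly the multi-index derivatives.\<close>

definition partial_derivs :: "'n list \<Rightarrow> (real ^ 'n \<Rightarrow> complex) \<Rightarrow> (real ^ 'n::finite \<Rightarrow> complex)" where
  "partial_derivs \<beta> = foldr partial_deriv \<beta>"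

text \<open>Differentiability of all iterated partial derivatives also makes all of them continuous,
  so this is the class of infinitely often continuously differentiable functions.\<close>

definition smooth :: "(real ^ 'n::finite \<Rightarrow> complex) \<Rightarrow> bool" where
  "smooth \<phi> \<longleftrightarrow> (\<forall>\<beta> x. partial_derivs \<beta> \<phi> differentiable (at x))"

definition monomial :: "('n \<Rightarrow> nat) \<Rightarrow> real ^ 'n::finite \<Rightarrow> complex" where
  "monomial \<gamma> x = complex_of_real (\<Prod>i\<in>UNIV. (x $ i) ^ \<gamma> i)"

definition schwartz :: "(real ^ 'n::finite \<Rightarrow> complex) set" where
  "schwartz = {\<phi>. smooth \<phi> \<and>
     (\<forall>\<alpha> \<beta>. bounded (range (\<lambda>x. monomial \<alpha> x * partial_derivs \<beta> \<phi> x)))}"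

definition schwartz_seminorm ::
    "('n \<Rightarrow> nat) \<Rightarrow> 'n list \<Rightarrow> (real ^ 'n::finite \<Rightarrow> complex) \<Rightarrow> real" where
  "schwartz_seminorm \<alpha> \<beta> \<phi> = (SUP x. norm (monomial \<alpha> x * partial_derivs \<beta> \<phi> x))"

definition schwartz_topology :: "(real ^ 'n::finite \<Rightarrow> complex) topology" where
  "schwartz_topology = topology_generated_by
     {{\<psi> \<in> schwartz. schwartz_seminorm \<alpha> \<beta> (\<lambda>x. \<psi> x - \<phi> x) < \<epsilon>} | \<phi> \<alpha> \<beta> \<epsilon>.
        \<phi> \<in> schwartz \<and> \<epsilon> > 0}"

definition schwartz_inf :: "(real ^ 'n::finite \<Rightarrow> complex) set" where
  "schwartz_inf = {\<phi> \<in> schwartz. \<forall>\<gamma>. (LINT x|lebesgue. monomial \<gamma> x * \<phi> x) = 0}"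

definition schwartz_zero :: "(real ^ 'n::finite \<Rightarrow> complex) set" where
  "schwartz_zero = {\<psi> \<in> schwartz. \<forall>\<beta>. partial_derivs \<beta> \<psi> 0 = 0}"

section \<open>Continuous duals\<close>

text \<open>Functionals are extensional (undefined off the test function space), so that equality of
  functionals in HOL is equality on all test functions.\<close>

definition dual_of :: "(real ^ 'n::finite \<Rightarrow> complex) set \<Rightarrow> ((real ^ 'n \<Rightarrow> complex) \<Rightarrow> complex) set" where
  "dual_of V = {T \<in> extensional V.
     (\<forall>\<phi>\<in>V. \<forall>\<psi>\<in>V. T (\<lambda>x. \<phi> x + \<psi> x) = T \<phi> + T \<psi>) \<and>
     (\<forall>c. \<forall>\<phi>\<in>V. T (\<lambda>x. c * \<phi> x) = c * T \<phi>) \<and>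
     continuous_map (subtopology schwartz_topology V) euclidean T}"

abbreviation tempered_distributions :: "((real ^ 'n::finite \<Rightarrow> complex) \<Rightarrow> complex) set" where
  "tempered_distributions \<equiv> dual_of schwartz"

section \<open>Lebesgue spaces\<close>

definition Lp :: "ennreal \<Rightarrow> (real ^ 'n::finite \<Rightarrow> complex) set" where
  "Lp p = {f \<in> borel_measurable lebesgue.
     if p = \<infinity> then esssup lebesgue (\<lambda>x. ereal (norm (f x))) < \<infinity>
     else integrable lebesgue (\<lambda>x. norm (f x) powr enn2real p)}"

definition Lp_norm :: "ennreal \<Rightarrow> (real ^ 'n::finite \<Rightarrow> complex) \<Rightarrow> real" where
  "Lp_norm p f = (if p = \<infinity> then real_of_ereal (esssup lebesgue (\<lambda>x. ereal (norm (f x))))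
     else (LINT x|lebesgue. norm (f x) powr enn2real p) powr (1 / enn2real p))"

text \<open>A function regarded as a functional on the test function space \<^term>\<open>V\<close>.\<close>

definition functional_of ::
    "(real ^ 'n::finite \<Rightarrow> complex) set \<Rightarrow> (real ^ 'n \<Rightarrow> complex) \<Rightarrow> ((real ^ 'n \<Rightarrow> complex) \<Rightarrow> complex)" where
  "functional_of V u = (\<lambda>\<phi>\<in>V. LINT x|lebesgue. u x * \<phi> x)"

section \<open>Fourier transform\<close>

definition fourier :: "(real ^ 'n::finite \<Rightarrow> complex) \<Rightarrow> (real ^ 'n \<Rightarrow> complex)" where
  "fourier \<phi> = (\<lambda>\<xi>. LINT x|lebesgue. \<phi> x * exp (- 2 * complex_of_real pi * \<i> * complex_of_real (x \<bullet> \<xi>)))"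

definition inv_fourier :: "(real ^ 'n::finite \<Rightarrow> complex) \<Rightarrow> (real ^ 'n \<Rightarrow> complex)" where
  "inv_fourier \<psi> = (\<lambda>x. LINT \<xi>|lebesgue. \<psi> \<xi> * exp (2 * complex_of_real pi * \<i> * complex_of_real (x \<bullet> \<xi>)))"

definition fourier_dist ::
    "((real ^ 'n::finite \<Rightarrow> complex) \<Rightarrow> complex) \<Rightarrow> ((real ^ 'n \<Rightarrow> complex) \<Rightarrow> complex)" where
  "fourier_dist T = (\<lambda>\<phi>\<in>schwartz. T (fourier \<phi>))"

definition inv_fourier_dist ::
    "((real ^ 'n::finite \<Rightarrow> complex) \<Rightarrow> complex) \<Rightarrow> ((real ^ 'n \<Rightarrow> complex) \<Rightarrow> complex)" where
  "inv_fourier_dist T = (\<lambda>\<phi>\<in>schwartz. T (inv_fourier \<phi>))"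

text \<open>On functionals on \<^const>\<open>schwartz_inf\<close> the Fourier transform is defined by duality with the
  inverse transform. With the bilinear pairing of \<^const>\<open>functional_of\<close> it therefore differs from
  \<^const>\<open>fourier_dist\<close> by a reflection, which is immaterial for even multipliers.\<close>

definition fourier_inf ::
    "((real ^ 'n::finite \<Rightarrow> complex) \<Rightarrow> complex) \<Rightarrow> ((real ^ 'n \<Rightarrow> complex) \<Rightarrow> complex)" where
  "fourier_inf u = (\<lambda>\<psi>\<in>schwartz_zero. u (inv_fourier \<psi>))"

section \<open>The fractional-logarithmic Laplacian\<close>

definition frac_log_symbol :: "real \<Rightarrow> real ^ 'n::finite \<Rightarrow> complex" where
  "frac_log_symbol s \<xi> = (if \<xi> = 0 then 0 else
     complex_of_real ((4 * pi\<^sup>2 * (norm \<xi>)\<^sup>2) powr s * ln (4 * pi\<^sup>2 * (norm \<xi>)\<^sup>2)))"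

text \<open>\<^term>\<open>has_frac_log_laplacian s u v\<close> says that \<^term>\<open>v\<close> is the fractional-logarithmic
  Laplacian of order \<^term>\<open>s\<close> of \<^term>\<open>u\<close>.\<close>

definition has_frac_log_laplacian ::
    "real \<Rightarrow> ((real ^ 'n::finite \<Rightarrow> complex) \<Rightarrow> complex) \<Rightarrow> ((real ^ 'n \<Rightarrow> complex) \<Rightarrow> complex) \<Rightarrow> bool" where
  "has_frac_log_laplacian s u v \<longleftrightarrow> u \<in> dual_of schwartz_inf \<and> v \<in> dual_of schwartz_inf \<and>
     (\<forall>\<psi>\<in>schwartz_zero. fourier_inf v \<psi> = fourier_inf u (\<lambda>\<xi>. frac_log_symbol s \<xi> * \<psi> \<xi>))"

section \<open>The inhomogeneous operator and its potential space\<close>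

definition inhom_symbol :: "real \<Rightarrow> real \<Rightarrow> real ^ 'n::finite \<Rightarrow> complex" where
  "inhom_symbol s lam \<xi> =
     complex_of_real ((lam + 4 * pi\<^sup>2 * (norm \<xi>)\<^sup>2) powr s * ln (lam + 4 * pi\<^sup>2 * (norm \<xi>)\<^sup>2))"

definition mult_dist ::
    "(real ^ 'n::finite \<Rightarrow> complex) \<Rightarrow> ((real ^ 'n \<Rightarrow> complex) \<Rightarrow> complex) \<Rightarrow> ((real ^ 'n \<Rightarrow> complex) \<Rightarrow> complex)" where
  "mult_dist \<sigma> T = (\<lambda>\<phi>\<in>schwartz. T (\<lambda>\<xi>. \<sigma> \<xi> * \<phi> \<xi>))"

definition inhom_op ::
    "real \<Rightarrow> real \<Rightarrow> ((real ^ 'n::finite \<Rightarrow> complex) \<Rightarrow> complex) \<Rightarrow> ((real ^ 'n \<Rightarrow> complex) \<Rightarrow> complex)" where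
  "inhom_op s lam T = inv_fourier_dist (mult_dist (inhom_symbol s lam) (fourier_dist T))"

definition potential_space ::
    "real \<Rightarrow> real \<Rightarrow> ennreal \<Rightarrow> ((real ^ 'n::finite \<Rightarrow> complex) \<Rightarrow> complex) set" where
  "potential_space s lam p =
     {T \<in> tempered_distributions. \<exists>g\<in>Lp p. inhom_op s lam T = functional_of schwartz g}"

text \<open>The function representing an element of the potential space is determined only almost
  everywhere, but its norm does not depend on the choice.\<close>

definition potential_norm ::
    "real \<Rightarrow> real \<Rightarrow> ennreal \<Rightarrow> ((real ^ 'n::finite \<Rightarrow> complex) \<Rightarrow> complex) \<Rightarrow> real" where
  "potential_norm s lam p T =
     Lp_norm p (SOME g. g \<in> Lp p \<and> inhom_op s lam T = functional_of schwartz g)"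

end

theory Submission
  imports Defs "HOL-Probability.Probability"
begin

text \<open>Write \<open>r = 4 \<pi>\<^sup>2 |\<xi>|\<^sup>2\<close>, let \<open>m(r) = r\<^sup>s ln r\<close> be the symbol of the homogeneous operator and
\<open>m\<^sub>\<lambda>(r) = (\<lambda> + r)\<^sup>s ln (\<lambda> + r)\<close> that of the inhomogeneous one. The estimate is a statement about
multipliers: \<open>m\<^sub>\<lambda>\<close> has to be controlled by \<open>m\<close> and \<open>1\<close>. The quotient \<open>m\<^sub>\<lambda>/m\<close> tends to 1 at infinity, and it is
bad only at low frequencies, where \<open>m\<close> vanishes (at \<open>r = 1\<close>) and is not smooth (at \<open>r = 0\<close>). So
\<open>m\<^sub>\<lambda> = A m + B\<close>, where \<open>A\<close> vanishes for \<open>r \<le> 3\<close> and approaches \<open>m\<^sub>\<lambda>/m\<close> at infinity so fast that the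
remainder \<open>B\<close> decays (lemma \<open>symbol_decomposition\<close>). Both \<open>A - 1\<close> and \<open>B\<close> are symbols of order \<open>-1\<close>:
every derivative gains one power of \<open>r\<close>.

Multiplication of the Fourier transform by such a radial symbol is convolution with an integrable kernel
(theorem \<open>radial_multiplier_kernel\<close>). Taylor's formula with centre at infinity writes the symbol as
\<open>\<integral> w(t) (1 - r/t)\<^sub>+\<^sup>M dt\<close> with \<open>w\<close> integrable and any exponent \<open>M \<ge> 1\<close>. All the profiles
\<open>(1 - r/t)\<^sub>+\<^sup>M\<close> are dilates of one function, which is so smooth for a large exponent that
its Fourier transform is integrable; dilation preserves the integral of the transform, hence the superposition of
the kernels converges in \<open>L\<^sup>1\<close>.

Now test \<open>(\<lambda> - \<Delta>)\<^bsup>s+ln\<^esup> u\<close> with a Schwartz function \<open>\<phi>\<close>. The part of the symbol coming from \<open>B\<close> gives a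
convolution of \<open>u\<close>. In the part coming from \<open>A m\<close> the function \<open>A\<close> times the Fourier transform of \<open>\<phi>\<close> vanishes near
the origin, so it is an admissible test function for the equation, which therefore may be used to trade \<open>m\<close> acting
on \<open>u\<close> for \<open>f\<close>. What remains is \<open>A = 1 + (A - 1)\<close> acting on \<open>f\<close>, that is \<open>f\<close> plus a
convolution of \<open>f\<close>. Hence \<open>(\<lambda> - \<Delta>)\<^bsup>s+ln\<^esup> u\<close> is represented by
\<open>g = f + k\<^sub>A * f + k\<^sub>B * u\<close> with integrable kernels (theorem \<open>frac_log_estimate\<close>), and Young's inequality bounds
its norm for every exponent, the endpoints 1 and \<open>\<infinity>\<close> included. No ambiguity by polynomials is left, because the
equation is used only on test functions whose Fourier transform vanishes near the origin.

The norm of the potential space refers to an arbitrary representing function; that all of them agree almost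
everywhere (lemma \<open>functional_of_eq_imp_Lp_norm_eq\<close>) follows by approximating indicators of boxes by Schwartz
functions. Fourier inversion on Schwartz functions is proved with Gaussians (theorem \<open>ft_inversion\<close>).\<close>

section \<open>Symbols on a half-line\<close>

definition order_bounded :: "real \<Rightarrow> real \<Rightarrow> (real \<Rightarrow> real) \<Rightarrow> bool" where
  "order_bounded T d f \<longleftrightarrow> (\<exists>C. \<forall>t\<ge>T. \<bar>f t\<bar> \<le> C * (1 + t) powr d)"

text \<open>Symbols of order \<open>d\<close> on \<open>[T, \<infinity>)\<close>, controlled up to \<open>k\<close> derivatives: each derivative lowers the order
by one. The derivative at the end point is one-sided, so that functions of \<open>|\<xi>|\<^sup>2\<close>, which live on
\<open>[0, \<infinity>)\<close>, are covered without an extension to negative arguments. Recursion on \<open>k\<close> makes the product rule a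
plain induction.\<close>

fun symb :: "nat \<Rightarrow> real \<Rightarrow> real \<Rightarrow> (real \<Rightarrow> real) \<Rightarrow> bool" where
  "symb 0 T d f \<longleftrightarrow> order_bounded T d f"
| "symb (Suc k) T d f \<longleftrightarrow> order_bounded T d f \<and>
     (\<exists>f'. (\<forall>t\<ge>T. (f has_real_derivative f' t) (at t within {T..})) \<and> symb k T (d - 1) f')"

lemma order_bounded_nonneg:
  assumes "order_bounded T d f"
  obtains C where "C \<ge> 0" "\<And>t. t \<ge> T \<Longrightarrow> \<bar>f t\<bar> \<le> C * (1 + t) powr d"
proof -
  obtain C where C: "\<And>t. t \<ge> T \<Longrightarrow> \<bar>f t\<bar> \<le> C * (1 + t) powr d"
    using assms unfolding order_bounded_def by blast
  show ?thesis
  proof (rule that[of "\<bar>C\<bar>"])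
    fix t assume "t \<ge> T"
    then have "\<bar>f t\<bar> \<le> C * (1 + t) powr d" by (rule C)
    also have "\<dots> \<le> \<bar>C\<bar> * (1 + t) powr d" by (intro mult_right_mono) auto
    finally show "\<bar>f t\<bar> \<le> \<bar>C\<bar> * (1 + t) powr d" .
  qed auto
qed

lemma order_bounded_mono:
  assumes "order_bounded T d f" "d \<le> e" "T \<ge> 0"
  shows "order_bounded T e f"
proof -
  obtain C where C: "C \<ge> 0" "\<And>t. t \<ge> T \<Longrightarrow> \<bar>f t\<bar> \<le> C * (1 + t) powr d"
    using order_bounded_nonneg[OF assms(1)] by blast
  have "\<bar>f t\<bar> \<le> C * (1 + t) powr e" if "t \<ge> T" for t
    using C(2)[OF that] mult_left_mono[OF powr_mono[OF assms(2), of "1 + t"] C(1)] that assms(3)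
    by linarith
  then show ?thesis unfolding order_bounded_def by blast
qed

lemma order_bounded_add:
  assumes "order_bounded T d f" "order_bounded T d g"
  shows "order_bounded T d (\<lambda>t. f t + g t)"
proof -
  obtain C where C: "\<And>t. t \<ge> T \<Longrightarrow> \<bar>f t\<bar> \<le> C * (1 + t) powr d"
    using assms(1) unfolding order_bounded_def by blast
  obtain D where D: "\<And>t. t \<ge> T \<Longrightarrow> \<bar>g t\<bar> \<le> D * (1 + t) powr d"
    using assms(2) unfolding order_bounded_def by blast
  have "\<bar>f t + g t\<bar> \<le> (C + D) * (1 + t) powr d" if "t \<ge> T" for t
    using C[OF that] D[OF that] by (simp add: algebra_simps)
  then show ?thesis unfolding order_bounded_def by blast
qed

lemma order_bounded_mult:
  assumes "order_bounded T d f" "order_bounded T e g"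
  shows "order_bounded T (d + e) (\<lambda>t. f t * g t)"
proof -
  obtain C where C: "C \<ge> 0" "\<And>t. t \<ge> T \<Longrightarrow> \<bar>f t\<bar> \<le> C * (1 + t) powr d"
    using order_bounded_nonneg[OF assms(1)] by blast
  obtain D where D: "D \<ge> 0" "\<And>t. t \<ge> T \<Longrightarrow> \<bar>g t\<bar> \<le> D * (1 + t) powr e"
    using order_bounded_nonneg[OF assms(2)] by blast
  have "\<bar>f t * g t\<bar> \<le> (C * D) * (1 + t) powr (d + e)" if "t \<ge> T" for t
  proof -
    have "\<bar>f t\<bar> * \<bar>g t\<bar> \<le> (C * (1 + t) powr d) * (D * (1 + t) powr e)"
      using C(1) D(1) by (intro mult_mono C(2) D(2) that) auto
    then show ?thesis by (simp add: abs_mult powr_add ac_simps)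
  qed
  then show ?thesis unfolding order_bounded_def by blast
qed

lemma order_bounded_const: "order_bounded T 0 (\<lambda>_. c)" if "T \<ge> 0"
proof -
  have "\<bar>c\<bar> \<le> \<bar>c\<bar> * (1 + t) powr 0" if "t \<ge> T" for t
    using that \<open>T \<ge> 0\<close> by simp
  then show ?thesis unfolding order_bounded_def by blast
qed

lemma symb_SucI:
  assumes "order_bounded T d f" "\<And>t. t \<ge> T \<Longrightarrow> (f has_real_derivative f' t) (at t within {T..})"
    "symb k T (d - 1) f'"
  shows "symb (Suc k) T d f"
  using assms by auto

lemma symb_order_bounded: "symb k T d f \<Longrightarrow> order_bounded T d f"
  by (cases k) auto

lemma symb_cong:
  assumes "symb k T d f" "\<And>t. t \<ge> T \<Longrightarrow> f t = g t"
  shows "symb k T d g"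
proof -
  have ob: "order_bounded T d g"
    using symb_order_bounded[OF assms(1)] assms(2) by (simp add: order_bounded_def)
  show ?thesis
  proof (cases k)
    case 0 then show ?thesis using ob by simp
  next
    case (Suc k')
    then obtain f' where f': "\<And>t. t\<ge>T \<Longrightarrow> (f has_real_derivative f' t) (at t within {T..})" "symb k' T (d - 1) f'"
      using assms(1) by auto
    have "(g has_real_derivative f' t) (at t within {T..})" if "t \<ge> T" for t
      by (rule has_field_derivative_transform_within[OF f'(1)[OF that], of 1]) (use that assms(2) in auto)
    then show ?thesis using ob f'(2) Suc by auto
  qed
qed

lemma symb_mono_order: "symb k T d f \<Longrightarrow> d \<le> e \<Longrightarrow> T \<ge> 0 \<Longrightarrow> symb k T e f"
proof (induction k arbitrary: d e f)
  case 0 then show ?case using order_bounded_mono by auto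
next
  case (Suc k)
  from Suc.prems obtain f' where "\<forall>t\<ge>T. (f has_real_derivative f' t) (at t within {T..})" "symb k T (d - 1) f'"
    by auto
  moreover from this(2) have "symb k T (e - 1) f'" using Suc by auto
  ultimately show ?case using Suc.prems order_bounded_mono by auto
qed

lemma symb_Suc_imp: "symb (Suc k) T d f \<Longrightarrow> symb k T d f"
proof (induction k arbitrary: d f)
  case (Suc k)
  then obtain f' where "\<forall>t\<ge>T. (f has_real_derivative f' t) (at t within {T..})" "symb (Suc k) T (d - 1) f'"
    by auto
  moreover from Suc.IH[OF this(2)] have "symb k T (d - 1) f'" .
  ultimately show ?case using Suc.prems by auto
qed auto

lemma symb_SucE:
  assumes "symb (Suc k) T d f"
  obtains f' where "order_bounded T d f"
    "\<And>t. t \<ge> T \<Longrightarrow> (f has_real_derivative f' t) (at t within {T..})" "symb k T (d - 1) f'"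
  using assms by auto

lemma symb_add: "symb k T d f \<Longrightarrow> symb k T d g \<Longrightarrow> symb k T d (\<lambda>t. f t + g t)"
proof (induction k arbitrary: d f g)
  case 0 then show ?case using order_bounded_add by auto
next
  case (Suc k)
  from Suc.prems(1) obtain f' where f': "order_bounded T d f" "\<And>t. t\<ge>T \<Longrightarrow> (f has_real_derivative f' t) (at t within {T..})" "symb k T (d - 1) f'"
    by (rule symb_SucE) blast
  from Suc.prems(2) obtain g' where g': "order_bounded T d g" "\<And>t. t\<ge>T \<Longrightarrow> (g has_real_derivative g' t) (at t within {T..})" "symb k T (d - 1) g'"
    by (rule symb_SucE) blast
  show ?case
    by (rule symb_SucI[OF order_bounded_add[OF f'(1) g'(1)] DERIV_add[OF f'(2) g'(2)] Suc.IH[OF f'(3) g'(3)]])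
qed

lemma symb_mult: "symb k T d f \<Longrightarrow> symb k T e g \<Longrightarrow> symb k T (d + e) (\<lambda>t. f t * g t)"
proof (induction k arbitrary: d e f g)
  case 0 then show ?case using order_bounded_mult by auto
next
  case (Suc k)
  from Suc.prems(1) obtain f' where f': "order_bounded T d f" "\<And>t. t\<ge>T \<Longrightarrow> (f has_real_derivative f' t) (at t within {T..})" "symb k T (d - 1) f'"
    by (rule symb_SucE) blast
  from Suc.prems(2) obtain g' where g': "order_bounded T e g" "\<And>t. t\<ge>T \<Longrightarrow> (g has_real_derivative g' t) (at t within {T..})" "symb k T (e - 1) g'"
    by (rule symb_SucE) blast
  have 1: "symb k T (d + e - 1) (\<lambda>t. f' t * g t + g' t * f t)"
    using Suc.IH[OF f'(3) symb_Suc_imp[OF Suc.prems(2)]] Suc.IH[OF g'(3) symb_Suc_imp[OF Suc.prems(1)]]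
    by (intro symb_add) (simp_all add: algebra_simps)
  show ?case
    by (rule symb_SucI[OF order_bounded_mult[OF f'(1) g'(1)] DERIV_mult[OF f'(2) g'(2)] 1])
qed

lemma symb_zero: "symb k T d (\<lambda>_. 0)"
proof (induction k arbitrary: d)
  case 0 show ?case by (auto simp: order_bounded_def intro!: exI[of _ 0])
next
  case (Suc k)
  then show ?case by (auto simp: order_bounded_def intro!: exI[of _ 0] exI[of _ "\<lambda>_. 0"])
qed

lemma symb_const: "T \<ge> 0 \<Longrightarrow> symb k T 0 (\<lambda>_. c)"
  by (cases k) (auto intro!: exI[of _ "\<lambda>_. 0"] symb_zero order_bounded_const)

lemma symb_cmult: "symb k T d f \<Longrightarrow> T \<ge> 0 \<Longrightarrow> symb k T d (\<lambda>t. c * f t)"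
  using symb_mult[OF symb_const[of T k c], of d f] by simp

lemma symb_diff: "symb k T d f \<Longrightarrow> symb k T d g \<Longrightarrow> T \<ge> 0 \<Longrightarrow> symb k T d (\<lambda>t. f t - g t)"
  using symb_add[OF _ symb_cmult[of k T d g "-1"], of f] by simp

lemma symb_power: "symb k T d f \<Longrightarrow> T \<ge> 0 \<Longrightarrow> symb k T (real j * d) (\<lambda>t. f t ^ j)"
proof (induction j)
  case 0 then show ?case by (simp add: symb_const)
next
  case (Suc j)
  then show ?case using symb_mult[of k T d f "real j * d" "\<lambda>t. f t ^ j"] by (simp add: algebra_simps)
qed

lemma symb_sum: "T \<ge> 0 \<Longrightarrow> (\<And>i. i \<in> I \<Longrightarrow> symb k T d (f i)) \<Longrightarrow> symb k T d (\<lambda>t. \<Sum>i\<in>I. f i t)"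
  by (induction I rule: infinite_finite_induct) (auto intro: symb_zero symb_add)

section \<open>Powers and logarithms as symbols\<close>

text \<open>The comparison of \<open>a + t\<close> with \<open>1 + t\<close> from below, which is what negative powers of \<open>a + t\<close> need.\<close>

lemma shifted_lower: 
  fixes a T t :: real assumes "a \<ge> 0" "T \<ge> 0" "a + T > 0" "t \<ge> T"
  shows "(a + T) / (1 + a + T) * (1 + t) \<le> a + t"
proof -
  have "(a + T) * (1 + t) \<le> (a + t) * (1 + a + T)"
  proof -
    have "(a + t) * (1 + a + T) - (a + T) * (1 + t) = a * a + a * T + (t - T)"
      by (simp add: algebra_simps)
    moreover have "\<dots> \<ge> 0" using assms by simp
    ultimately show ?thesis by linarith
  qed
  moreover have "1 + a + T > 0" using assms by simp
  ultimately show ?thesis by (simp add: field_simps)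
qed

lemma order_bounded_shifted_powr:
  assumes "a \<ge> 0" "T \<ge> 0" "a + T > 0"
  shows "order_bounded T z (\<lambda>t. (a + t) powr z)"
proof (cases "z \<ge> 0")
  case True
  have "\<bar>(a + t) powr z\<bar> \<le> (1 + a) powr z * (1 + t) powr z" if "t \<ge> T" for t
  proof -
    have "(a + t) powr z \<le> ((1 + a) * (1 + t)) powr z"
      using assms that True by (intro powr_mono2) (auto simp: algebra_simps)
    then show ?thesis using assms that by (simp add: powr_mult)
  qed
  then show ?thesis unfolding order_bounded_def by blast
next
  case False
  define c where "c = (a + T) / (1 + a + T)"
  have "c > 0" using assms by (simp add: c_def)
  have "\<bar>(a + t) powr z\<bar> \<le> c powr z * (1 + t) powr z" if "t \<ge> T" for t
  proof -
    have "(a + t) powr z \<le> (c * (1 + t)) powr z"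
      using shifted_lower[OF assms that] False \<open>c > 0\<close> that assms
      by (intro powr_mono2') (auto simp: c_def)
    then show ?thesis using \<open>c > 0\<close> that assms by (simp add: powr_mult)
  qed
  then show ?thesis unfolding order_bounded_def by blast
qed

lemma symb_shifted_powr:
  assumes "a \<ge> 0" "T \<ge> 0" "a + T > 0"
  shows "symb k T z (\<lambda>t. (a + t) powr z)"
proof (induction k arbitrary: z)
  case 0 then show ?case using order_bounded_shifted_powr[OF assms] by simp
next
  case (Suc k)
  show ?case
  proof (rule symb_SucI[OF order_bounded_shifted_powr[OF assms] _ symb_cmult[OF Suc.IH]])
    fix t assume "t \<ge> T"
    then show "((\<lambda>t. (a + t) powr z) has_real_derivative z * (a + t) powr (z - 1)) (at t within {T..})"
      using assms by (auto intro!: derivative_eq_intros)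
  qed (use assms in auto)
qed

lemma symb_shifted_inverse:
  assumes "a \<ge> 0" "T \<ge> 0" "a + T > 0"
  shows "symb k T (-1) (\<lambda>t. 1 / (a + t))"
  by (rule symb_cong[OF symb_shifted_powr[OF assms, of k "-1"]])
    (use assms in \<open>auto simp: powr_minus_divide\<close>)

text \<open>The logarithm is counted as a symbol of order 1; the loss is harmless, since it only has to be absorbed by
the power of a cut-off.\<close>

lemma symb_shifted_ln:
  assumes "a \<ge> 1" "T \<ge> 0"
  shows "symb k T 1 (\<lambda>t. ln (a + t))"
proof -
  have ob: "order_bounded T 1 (\<lambda>t. ln (a + t))"
    unfolding order_bounded_def
  proof (intro exI[of _ a] allI impI)
    fix t assume t: "t \<ge> T"
    have "ln (a + t) \<le> a + t - 1" using assms t by (intro ln_le_minus_one) auto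
    also have "\<dots> \<le> a * (1 + t)" using assms t mult_right_mono[of 1 a t] by (simp add: algebra_simps)
    finally show "\<bar>ln (a + t)\<bar> \<le> a * (1 + t) powr 1"
      using assms t by simp
  qed
  show ?thesis
  proof (cases k)
    case 0 then show ?thesis using ob by simp
  next
    case (Suc k')
    show ?thesis unfolding Suc
      by (rule symb_SucI[OF ob, where f'="\<lambda>t. 1 / (a + t)"])
        (use assms in \<open>auto intro!: derivative_eq_intros symb_mono_order[OF symb_shifted_inverse]\<close>)
  qed
qed

text \<open>The derivative of \<open>1/ln t\<close> is \<open>- (1/t) (1/ln t)\<^sup>2\<close>, so that the induction on the number of derivatives reproduces
the function itself. From 3 on the logarithm is at least 1.\<close>

lemma symb_inverse_ln:
  assumes "T \<ge> 3"
  shows "symb k T 0 (\<lambda>t. 1 / ln t)"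
proof (induction k)
  have ln1: "ln t \<ge> 1" if "t \<ge> T" for t
  proof -
    have "exp 1 \<le> t" using exp_le that assms by linarith
    then show ?thesis using that assms by (subst ln_ge_iff) auto
  qed
  have ob: "order_bounded T 0 (\<lambda>t. 1 / ln t)"
    unfolding order_bounded_def
  proof (intro exI[of _ 1] allI impI)
    fix t assume "t \<ge> T" then show "\<bar>1 / ln t\<bar> \<le> 1 * (1 + t) powr 0"
      using ln1[of t] assms by simp
  qed
  {
    case 0 then show ?case using ob by simp
  next
    case (Suc k)
    have s: "symb k T (-1 + (0 + 0)) (\<lambda>t. 1 / (0 + t) * ((1 / ln t) * (1 / ln t)))"
      by (intro symb_mult Suc symb_shifted_inverse) (use assms in auto)
    show ?case
    proof (rule symb_SucI[OF ob, where f'="\<lambda>t. (-1) * (1 / t * ((1 / ln t) * (1 / ln t)))"])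
      fix t assume "t \<ge> T"
      then show "((\<lambda>t. 1 / ln t) has_real_derivative - 1 * (1 / t * (1 / ln t * (1 / ln t)))) (at t within {T..})"
        using ln1[of t] assms by (auto intro!: derivative_eq_intros simp: field_simps)
    qed (use symb_cmult[OF s, of "-1"] assms in simp)
  }
qed

lemma symb_ln_ratio:
  assumes "a > 0" "T > 0"
  shows "symb k T (-1) (\<lambda>t. ln (a + t) - ln t)"
proof -
  have ob: "order_bounded T (-1) (\<lambda>t. ln (a + t) - ln t)"
    unfolding order_bounded_def
  proof -
    obtain C where C: "\<And>t. t \<ge> T \<Longrightarrow> \<bar>a * (1 / (0 + t))\<bar> \<le> C * (1 + t) powr (-1)"
      using symb_order_bounded[OF symb_cmult[OF symb_shifted_inverse[of 0 T], of 0 a]] assms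
      unfolding order_bounded_def by auto
    have "\<bar>ln (a + t) - ln t\<bar> \<le> C * (1 + t) powr (-1)" if "t \<ge> T" for t
    proof -
      have "ln (a + t) - ln t \<le> (a + t - t) / t"
        using assms that by (intro ln_diff_le) auto
      moreover have "ln t \<le> ln (a + t)" using assms that by simp
      moreover have "a / t \<le> C * (1 + t) powr (-1)" using C[OF that] assms that by simp
      ultimately show ?thesis by simp
    qed
    then show "\<exists>C. \<forall>t\<ge>T. \<bar>ln (a + t) - ln t\<bar> \<le> C * (1 + t) powr (-1)" by blast
  qed
  show ?thesis
  proof (cases k)
    case 0 then show ?thesis using ob by simp
  next
    case (Suc k')
    have s: "symb k' T (-1 + -1) (\<lambda>t. (1 / (0 + t)) * (1 / (a + t)))"
      using assms by (intro symb_mult symb_shifted_inverse) auto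
    show ?thesis unfolding Suc
    proof (rule symb_SucI[OF ob, where f'="\<lambda>t. (-a) * ((1 / t) * (1 / (a + t)))"])
      fix t assume t: "t \<ge> T"
      then show "((\<lambda>t. ln (a + t) - ln t) has_real_derivative (-a) * ((1 / t) * (1 / (a + t)))) (at t within {T..})"
        using assms by (auto intro!: derivative_eq_intros simp: divide_simps)
    qed (use symb_cmult[OF s, of "-a"] assms in simp)
  qed
qed

text \<open>With \<open>l = ln (a + t) - ln t\<close> the quotient \<open>((a + t) / t)\<^sup>s\<close> is \<open>exp (s l)\<close>, and \<open>exp y - 1 \<le> y exp y\<close>
transfers the decay of \<open>l\<close> to the difference from 1.\<close>

lemma symb_powr_ratio:
  assumes "a > 0" "T > 0" "s > 0"
  shows "symb k T 0 (\<lambda>t. (a + t) powr s * t powr (-s))"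
    and "symb k T (-1) (\<lambda>t. (a + t) powr s * t powr (-s) - 1)"
proof -
  have P: "symb k T 0 (\<lambda>t. (a + t) powr s * t powr (-s))" for k
  proof -
    have "symb k T (s + -s) (\<lambda>t. (a + t) powr s * (0 + t) powr (-s))"
      using assms by (intro symb_mult symb_shifted_powr) auto
    then show ?thesis by simp
  qed
  show "symb k T 0 (\<lambda>t. (a + t) powr s * t powr (-s))" by (rule P)
  obtain C0 where C0: "C0 \<ge> 0" "\<And>t. t \<ge> T \<Longrightarrow> \<bar>(a + t) powr s * t powr (-s)\<bar> \<le> C0 * (1 + t) powr 0"
    using order_bounded_nonneg[OF symb_order_bounded[OF P]] by metis
  obtain C1 where C1: "\<And>t. t \<ge> T \<Longrightarrow> \<bar>ln (a + t) - ln t\<bar> \<le> C1 * (1 + t) powr (-1)"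
    using symb_order_bounded[OF symb_ln_ratio[OF assms(1,2), of 0]] unfolding order_bounded_def by auto
  have ob: "order_bounded T (-1) (\<lambda>t. (a + t) powr s * t powr (-s) - 1)"
    unfolding order_bounded_def
  proof (intro exI[of _ "C0 * s * C1"] allI impI)
    fix t assume t: "t \<ge> T"
    define l where "l = ln (a + t) - ln t"
    have l0: "l \<ge> 0" using t assms by (simp add: l_def)
    have e: "(a + t) powr s * t powr (-s) = exp (s * l)"
      using t assms by (simp add: powr_def l_def exp_add[symmetric] algebra_simps)
    \<comment> \<open>\<open>1 - exp (- y) \<le> y\<close> multiplied by \<open>exp y\<close>\<close>
    have "1 - exp (s * l) * (1 - exp (- (s * l))) \<ge> 1 - exp (s * l) * (s * l)"
      using exp_ge_add_one_self[of "-(s*l)"] by simp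
    then have "exp (s * l) - 1 \<le> exp (s * l) * (s * l)"
      by (simp add: algebra_simps exp_minus)
    also have "\<dots> \<le> C0 * (s * (C1 * (1 + t) powr (-1)))"
    proof (intro mult_mono)
      show "exp (s * l) \<le> C0" using C0(2)[OF t] t assms by (simp add: e)
      show "l \<le> C1 * (1 + t) powr (-1)" using C1[OF t] by (simp add: l_def)
    qed (use assms l0 C0 in auto)
    finally have "exp (s * l) - 1 \<le> C0 * s * C1 * (1 + t) powr (-1)" by (simp add: ac_simps)
    moreover have "exp (s * l) \<ge> 1" using l0 assms by simp
    ultimately show "\<bar>(a + t) powr s * t powr (-s) - 1\<bar> \<le> C0 * s * C1 * (1 + t) powr (-1)"
      unfolding e by simp
  qed
  show "symb k T (-1) (\<lambda>t. (a + t) powr s * t powr (-s) - 1)"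
  proof (cases k)
    case 0 then show ?thesis using ob by simp
  next
    case (Suc k')
    have s: "symb k' T (-1 + (-1 + 0)) (\<lambda>t. (1 / (0 + t)) * ((1 / (a + t)) * ((a + t) powr s * t powr (-s))))"
      using assms by (intro symb_mult symb_shifted_inverse P) auto
    show ?thesis unfolding Suc
    proof (rule symb_SucI[OF ob, where f'="\<lambda>t. (-a * s) * ((1 / t) * ((1 / (a + t)) * ((a + t) powr s * t powr (-s))))"])
      fix t assume t: "t \<ge> T"
      have *: "(a + t) powr (s - 1) = (a + t) powr s / (a + t)" "t powr (- s - 1) = t powr (-s) / t"
        using t assms by (simp_all add: powr_diff)
      show "((\<lambda>t. (a + t) powr s * t powr (-s) - 1) has_real_derivative
        (-a * s) * ((1 / t) * ((1 / (a + t)) * ((a + t) powr s * t powr (-s))))) (at t within {T..})"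
        using t assms
        apply (auto intro!: derivative_eq_intros simp: *)
        apply (simp add: divide_simps)
        apply (simp add: algebra_simps)
        done
    qed (use symb_cmult[OF s, of "-a * s"] assms in simp)
  qed
qed

section \<open>Cutting off low frequencies\<close>

text \<open>A function on \<open>[T, \<infinity>)\<close> is glued to zero by the factor \<open>exp (- 1/(t - T))\<close>, which is flat at \<open>T\<close>. The
powers of \<open>1/(t - T)\<close> are carried along because differentiation produces them.\<close>

definition flat :: "real \<Rightarrow> nat \<Rightarrow> (real \<Rightarrow> real) \<Rightarrow> real \<Rightarrow> real" where
  "flat T j h t = (if t \<le> T then 0 else (1 / (t - T)) ^ j * exp (- (1 / (t - T))) * h t)"

lemma flat_zero: "flat T j (\<lambda>_. 0) t = 0"
  by (simp add: flat_def)

text \<open>One term of the exponential series.\<close>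

lemma power_times_exp_minus_le: "x \<ge> 0 \<Longrightarrow> x ^ j * exp (- x) \<le> fact j" for x :: real
proof -
  assume x: "x \<ge> 0"
  have sm: "summable (\<lambda>n. x ^ n /\<^sub>R fact n)" by (rule summable_exp_generic)
  have "(\<Sum>n\<in>{j}. x ^ n /\<^sub>R fact n) \<le> (\<Sum>n. x ^ n /\<^sub>R fact n)"
    by (rule sum_le_suminf[OF sm]) (use x in auto)
  then have "x ^ j / fact j \<le> exp x" by (simp add: exp_def field_simps)
  then show ?thesis by (simp add: exp_minus field_simps)
qed

lemma order_bounded_flat:
  assumes "T \<ge> 0" "order_bounded T d h"
  shows "order_bounded 0 (d - real j) (flat T j h)"
proof -
  obtain C where C: "C \<ge> 0" "\<And>t. t \<ge> T \<Longrightarrow> \<bar>h t\<bar> \<le> C * (1 + t) powr d"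
    using order_bounded_nonneg[OF assms(2)] by blast
  define D where "D = (1 + T) ^ j * (fact j * exp 1)"
  have "\<bar>flat T j h t\<bar> \<le> (D * C) * (1 + t) powr (d - real j)" if t0: "t \<ge> 0" for t
  proof (cases "t \<le> T")
    case True then show ?thesis using C by (simp add: flat_def D_def assms)
  next
    case False
    define x where "x = 1 / (t - T)"
    have x: "x > 0" using False by (simp add: x_def)
    have e: "x * (1 + t) = 1 + (1 + T) * x" using False by (simp add: x_def field_simps)
    have "(x * (1 + t)) ^ j * exp (- x) \<le> ((1 + T) * (1 + x)) ^ j * exp (- x)"
      unfolding e using x assms by (intro mult_right_mono power_mono) (auto simp: algebra_simps)
    also have "\<dots> = (1 + T) ^ j * ((1 + x) ^ j * exp (- (1 + x)) * exp 1)"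
      by (simp add: power_mult_distrib exp_add[symmetric])
    also have "\<dots> \<le> D" unfolding D_def
      using x assms by (intro mult_left_mono mult_right_mono power_times_exp_minus_le) auto
    finally have 1: "x ^ j * exp (- x) * (1 + t) ^ j \<le> D" by (simp add: power_mult_distrib ac_simps)
    have 2: "x ^ j * exp (- x) \<le> D * (1 + t) powr (- real j)"
      using 1 t0 by (simp add: powr_minus powr_realpow field_simps)
    have "\<bar>flat T j h t\<bar> = x ^ j * exp (- x) * \<bar>h t\<bar>"
      using False x by (simp add: flat_def x_def abs_mult)
    also have "\<dots> \<le> (D * (1 + t) powr (- real j)) * (C * (1 + t) powr d)"
      using False x C by (intro mult_mono 2) (auto simp: D_def assms)
    also have "\<dots> = (D * C) * (1 + t) powr (d - real j)"
      by (simp add: powr_diff powr_minus field_simps)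
    finally show ?thesis .
  qed
  then show ?thesis unfolding order_bounded_def by blast
qed

lemma DERIV_zero_of_quadratic:
  fixes f :: "real \<Rightarrow> real"
  assumes "f a = 0" "\<And>t. \<bar>t - a\<bar> < 1 \<Longrightarrow> \<bar>f t\<bar> \<le> C * (t - a)\<^sup>2"
  shows "(f has_real_derivative 0) (at a)"
proof -
  have "((\<lambda>t. (f t - f a) / (t - a)) \<longlongrightarrow> 0) (at a)"
  proof (rule Lim_null_comparison)
    show "\<forall>\<^sub>F t in at a. norm ((f t - f a) / (t - a)) \<le> C * \<bar>t - a\<bar>"
      unfolding eventually_at
    proof (intro exI[of _ 1] conjI ballI impI)
      fix t assume "t \<noteq> a \<and> dist t a < 1"
      then have t: "t \<noteq> a" "\<bar>t - a\<bar> < 1" by (auto simp: dist_real_def)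
      have "(t - a)\<^sup>2 = \<bar>t - a\<bar> * \<bar>t - a\<bar>" by (simp add: power2_eq_square)
      then show "norm ((f t - f a) / (t - a)) \<le> C * \<bar>t - a\<bar>"
        using assms(2)[OF t(2)] t(1) by (simp add: assms(1) abs_divide divide_simps ac_simps)
    qed auto
    have "((\<lambda>t. C * \<bar>t - a\<bar>) \<longlongrightarrow> C * \<bar>a - a\<bar>) (at a)" by (intro tendsto_intros)
    then show "((\<lambda>t. C * \<bar>t - a\<bar>) \<longlongrightarrow> 0) (at a)" by simp
  qed
  then show ?thesis by (simp add: has_field_derivative_iff)
qed

text \<open>At \<open>T\<close> the derivative vanishes because the exponential beats all powers of \<open>1/(t - T)\<close>, so that the function is
\<open>O((t - T)\<^sup>2)\<close>; elsewhere this is the product rule.\<close>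

lemma DERIV_flat:
  assumes "T \<ge> 0" "order_bounded T d h"
    and h: "\<And>t. t \<ge> T \<Longrightarrow> (h has_real_derivative h' t) (at t within {T..})"
  shows "(flat T j h has_real_derivative
    flat T (j + 2) h t - real j * flat T (j + 1) h t + flat T j h' t) (at t)"
proof -
  consider "t < T" | "t = T" | "t > T" by linarith
  then show ?thesis
  proof cases
    case 1
    have "((\<lambda>_. 0) has_real_derivative 0) (at t)" by simp
    then have "(flat T j h has_real_derivative 0) (at t)"
      by (rule has_field_derivative_transform_within_open[of _ _ _ "{..<T}"]) (use 1 in \<open>auto simp: flat_def\<close>)
    then show ?thesis using 1 by (simp add: flat_def)
  next
    case 2
    obtain C where C: "C \<ge> 0" "\<And>t. t \<ge> T \<Longrightarrow> \<bar>h t\<bar> \<le> C * (1 + t) powr d"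
      using order_bounded_nonneg[OF assms(2)] by blast
    obtain D where D: "\<And>t. t \<in> {T..T+1} \<Longrightarrow> \<bar>(1 + t) powr d\<bar> \<le> D"
    proof -
      have "compact ((\<lambda>t. (1 + t) powr d) ` {T..T+1})"
        by (intro compact_continuous_image continuous_intros) (use assms(1) in auto)
      then obtain D where "\<forall>y\<in>(\<lambda>t. (1 + t) powr d) ` {T..T+1}. norm y \<le> D"
        using compact_imp_bounded bounded_iff by blast
      then show ?thesis by (intro that[of D]) simp
    qed
    have "(flat T j h has_real_derivative 0) (at T)"
    proof (rule DERIV_zero_of_quadratic[where C = "fact (j + 2) * (C * D)"])
      fix t assume t: "\<bar>t - T\<bar> < 1"
      have D0: "0 \<le> D" using order_trans[OF abs_ge_zero D[of T]] by auto
      show "\<bar>flat T j h t\<bar> \<le> fact (j + 2) * (C * D) * (t - T)\<^sup>2"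
      proof (cases "t \<le> T")
        case True then show ?thesis using C(1) D0 by (simp add: flat_def)
      next
        case False
        define x where "x = 1 / (t - T)"
        have x: "x > 0" using False by (simp add: x_def)
        have "x ^ (j + 2) * exp (- x) \<le> fact (j + 2)"
          using x by (intro power_times_exp_minus_le) auto
        then have "x ^ (j + 2) * exp (- x) * (t - T)\<^sup>2 \<le> fact (j + 2) * (t - T)\<^sup>2"
          by (intro mult_right_mono) auto
        also have "x ^ (j + 2) * exp (- x) * (t - T)\<^sup>2 = x ^ j * exp (- x)"
        proof -
          have "x * (t - T) = 1" using False by (simp add: x_def)
          then have "x ^ j * exp (- x) * (x * (t - T))\<^sup>2 = x ^ j * exp (- x)" by simp
          then show ?thesis by (simp only: power_add power_mult_distrib ac_simps)
        qed
        finally have 1: "x ^ j * exp (- x) \<le> fact (j + 2) * (t - T)\<^sup>2" .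
        have "\<bar>h t\<bar> \<le> C * (1 + t) powr d" using C(2) False by auto
        also have "\<dots> \<le> C * D" using D[of t] t False C(1) by (intro mult_left_mono) auto
        finally have 2: "\<bar>h t\<bar> \<le> C * D" .
        have "\<bar>flat T j h t\<bar> = (x ^ j * exp (- x)) * \<bar>h t\<bar>"
          using False x by (simp add: flat_def x_def abs_mult)
        also have "\<dots> \<le> (fact (j + 2) * (t - T)\<^sup>2) * (C * D)"
          using x by (intro mult_mono 1 2) auto
        finally show ?thesis by (simp add: ac_simps)
      qed
    qed (simp add: flat_def)
    then show ?thesis using 2 by (simp add: flat_def)
  next
    case 3
    have hd: "(h has_real_derivative h' t) (at t)"
      using h[of t] 3 at_within_interior[of t "{T..}"] by simp
    have "((\<lambda>t. (1 / (t - T)) ^ j * exp (- (1 / (t - T))) * h t) has_real_derivative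
       flat T (j + 2) h t - real j * flat T (j + 1) h t + flat T j h' t) (at t)"
    proof -
      have "((\<lambda>t. 1 / (t - T)) has_real_derivative - ((1 / (t - T)) ^ 2)) (at t)"
        using 3 by (auto intro!: derivative_eq_intros simp: power2_eq_square)
      note base = this
      define y where "y = 1 / (t - T)"
      have d1: "((\<lambda>t. (1 / (t - T)) ^ j) has_real_derivative - (real j * y ^ (j + 1))) (at t)"
        by (rule DERIV_cong[OF DERIV_power[OF base, of j]])
          (cases j; simp add: y_def[symmetric] power2_eq_square algebra_simps)
      have d2: "((\<lambda>t. exp (- (1 / (t - T)))) has_real_derivative exp (- y) * y ^ 2) (at t)"
        by (rule DERIV_cong[OF DERIV_chain2[OF DERIV_exp DERIV_minus[OF base]]]) (simp add: y_def)
      show ?thesis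
        by (rule DERIV_cong[OF DERIV_mult[OF DERIV_mult[OF d1 d2] hd]])
          (use 3 in \<open>simp add: flat_def y_def[symmetric] power_add power2_eq_square algebra_simps\<close>)
    qed
    then show ?thesis
      by (rule has_field_derivative_transform_within_open[of _ _ _ "{T<..}"]) (use 3 in \<open>auto simp: flat_def\<close>)
  qed
qed

lemma symb_flat:
  assumes "T \<ge> 0"
  shows "symb k T d h \<Longrightarrow> symb k 0 (d - real j) (flat T j h)"
proof (induction k arbitrary: d h j)
  case 0 then show ?case using order_bounded_flat[OF assms] by simp
next
  case (Suc k)
  from Suc.prems obtain h' where h': "order_bounded T d h"
    "\<And>t. t\<ge>T \<Longrightarrow> (h has_real_derivative h' t) (at t within {T..})" "symb k T (d - 1) h'"
    by (rule symb_SucE) blast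
  have hk: "symb k T d h" using symb_Suc_imp[OF Suc.prems] .
  show ?case
  proof (rule symb_SucI[OF order_bounded_flat[OF assms h'(1)]
        has_field_derivative_at_within[OF DERIV_flat[OF assms h'(1,2)]]])
    have "symb k 0 (d - real j - 1) (flat T (j + 2) h)"
      by (rule symb_mono_order[OF Suc.IH[OF hk]]) auto
    moreover have "symb k 0 (d - real j - 1) (flat T (j + 1) h)"
      by (rule symb_mono_order[OF Suc.IH[OF hk]]) auto
    moreover have "symb k 0 (d - real j - 1) (flat T j h')"
      by (rule symb_mono_order[OF Suc.IH[OF h'(3)]]) auto
    ultimately show "symb k 0 (d - real j - 1)
       (\<lambda>t. flat T (j + 2) h t - real j * flat T (j + 1) h t + flat T j h' t)"
      by (intro symb_add symb_diff symb_cmult) auto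
  qed auto
qed

text \<open>A low-frequency cut-off that equals 1 up to \<open>T\<close> and decays like \<open>1/t\<close>. It is not compactly supported, but its
\<open>K\<close>-th power decays like \<open>t\<^sup>-\<^sup>K\<close>, which is all that is needed, and \<open>1 - cutoff\<^sup>K\<close> is divisible
by the flat function, which makes the division by the symbol of the homogeneous operator smooth.\<close>

definition cutoff :: "real \<Rightarrow> real \<Rightarrow> real" where
  "cutoff T t = 1 - flat T 0 (\<lambda>_. 1) t"

lemma symb_cutoff:
  assumes "T \<ge> 0"
  shows "symb k 0 (-1) (cutoff T)"
proof -
  have ob: "order_bounded 0 (-1) (cutoff T)"
    unfolding order_bounded_def
  proof (intro exI[of _ "T + 2"] allI impI)
    fix t :: real assume t: "t \<ge> 0"
    have "\<bar>cutoff T t\<bar> * (1 + t) \<le> T + 2"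
    proof (cases "t \<le> T")
      case True then show ?thesis using t by (simp add: cutoff_def flat_def)
    next
      case False
      define x where "x = 1 / (t - T)"
      have x: "x > 0" "1 + t = 1 + T + 1 / x" using False by (simp_all add: x_def)
      have e: "\<bar>cutoff T t\<bar> = 1 - exp (- x)" using False x by (simp add: cutoff_def flat_def x_def)
      have "1 - exp (- x) \<le> x" using exp_ge_add_one_self[of "-x"] by simp
      then have "(1 - exp (- x)) * (1 / x) \<le> 1" using x by (simp add: field_simps)
      moreover have "(1 - exp (- x)) * (1 + T) \<le> 1 * (1 + T)" using assms by (intro mult_right_mono) auto
      ultimately show ?thesis unfolding e x(2) by (simp add: algebra_simps)
    qed
    then show "\<bar>cutoff T t\<bar> \<le> (T + 2) * (1 + t) powr (-1)"
      using t by (simp add: powr_minus field_simps)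
  qed
  show ?thesis
  proof (cases k)
    case 0 then show ?thesis using ob by simp
  next
    case (Suc k')
    have "symb k' 0 (-1 - 1) (\<lambda>t. (-1) * flat T 2 (\<lambda>_. 1) t)"
      using symb_flat[OF assms symb_const[OF assms, of k' 1], of 2] by (intro symb_cmult) auto
    moreover have "(cutoff T has_real_derivative (-1) * flat T 2 (\<lambda>_. 1) t) (at t)" for t
      unfolding cutoff_def
      using DERIV_diff[OF DERIV_const[of 1] DERIV_flat[OF assms order_bounded_const[OF assms, of 1], of "\<lambda>_. 0" 0 t]]
      by (simp add: flat_zero numeral_2_eq_2)
    ultimately show ?thesis unfolding Suc
      by (intro symb_SucI[OF ob]) (auto intro: has_field_derivative_at_within)
  qed
qed

text \<open>The division of the inhomogeneous symbol by the homogeneous one away from low frequencies. With the cut-off \<open>\<eta>\<close>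
and \<open>h\<close> the quotient of the two symbols, \<open>A = (1 - \<eta>\<^sup>K) h\<close> and \<open>B = \<eta>\<^sup>K (\<lambda> + t)\<^sup>s ln (\<lambda> + t)\<close>. The order
of \<open>B\<close> is \<open>s + 1 - K\<close>, and \<open>A - 1\<close> is of order \<open>-1\<close> because \<open>h - 1\<close> and \<open>\<eta>\<close> are.\<close>

lemma symbol_decomposition:
  assumes "s > 0" "lam > 1"
  obtains A B :: "real \<Rightarrow> real" and T where "T > 0" "\<And>t. t \<le> T \<Longrightarrow> A t = 0"
    "\<And>t. t \<ge> 0 \<Longrightarrow> (lam + t) powr s * ln (lam + t) = A t * (t powr s * ln t) + B t"
    "\<And>k. symb k 0 (-1) (\<lambda>t. A t - 1)" "\<And>k. symb k 0 (-1) B"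
proof -
  \<comment> \<open>beyond 3 the logarithm exceeds 1, so the zero of the homogeneous symbol lies below the cut-off\<close>
  define T :: real where "T = 3"
  \<comment> \<open>\<open>\<eta>\<^sup>K\<close> compensates the order \<open>s + 1\<close> of the inhomogeneous symbol and leaves order \<open>-1\<close>\<close>
  define K where "K = nat \<lceil>s + 2\<rceil>"
  have K: "real K \<ge> s + 2" unfolding K_def by linarith
  define P where "P t = (lam + t) powr s * t powr (-s)" for t
  define g where "g t = (P t - 1) + P t * (1 / ln t * (ln (lam + t) - ln t))" for t
  define S where "S t = (\<Sum>i<K. cutoff T t ^ i)" for t
  define A where "A t = S t * flat T 0 (\<lambda>t. 1 + g t) t" for t
  define B where "B t = cutoff T t ^ K * ((lam + t) powr s * ln (lam + t))" for t
  have T: "T \<ge> 0" "T > 0" "T \<ge> 3" by (auto simp: T_def)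
  have ln_pos: "ln t > 0" if "t > T" for t using that by (simp add: T_def)
  have geo: "S t * flat T 0 (\<lambda>_. 1) t = 1 - cutoff T t ^ K" for t
    using one_diff_power_eq[of "cutoff T t" K] by (simp add: S_def cutoff_def ac_simps)
  have g: "symb k T (-1) g" for k
  proof -
    have "symb k T (0 + (0 + -1)) (\<lambda>t. P t * (1 / ln t * (ln (lam + t) - ln t)))"
      unfolding P_def using assms T by (intro symb_mult symb_powr_ratio symb_inverse_ln symb_ln_ratio) auto
    moreover have "symb k T (-1) (\<lambda>t. P t - 1)"
      unfolding P_def using assms T by (intro symb_powr_ratio) auto
    ultimately show ?thesis unfolding g_def by (intro symb_add) auto
  qed
  have eta0: "symb k 0 0 (\<lambda>t. cutoff T t ^ i)" for i k
    by (rule symb_mono_order[OF symb_power[OF symb_cutoff[OF T(1)]]]) auto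
  have S0: "symb k 0 0 S" for k unfolding S_def by (intro symb_sum eta0) auto
  show ?thesis
  proof (rule that[of T A B])
    show "T > 0" by (rule T)
    show "A t = 0" if "t \<le> T" for t using that by (simp add: A_def flat_def)
    show "(lam + t) powr s * ln (lam + t) = A t * (t powr s * ln t) + B t" if "t \<ge> 0" for t
    proof (cases "t \<le> T")
      case True then show ?thesis by (simp add: A_def B_def flat_def cutoff_def)
    next
      case False
      have "flat T 0 (\<lambda>t. 1 + g t) t = flat T 0 (\<lambda>_. 1) t * (1 + g t)"
        using False by (simp add: flat_def)
      then have A: "A t = (1 - cutoff T t ^ K) * (1 + g t)"
        unfolding A_def using geo[of t] by (simp add: mult.assoc[symmetric])
      have "(1 + g t) * (t powr s * ln t) = (lam + t) powr s * ln (lam + t)"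
      proof -
        have "P t * t powr s = (lam + t) powr s"
          using False T by (simp add: P_def mult.assoc powr_add[symmetric])
        moreover have "(1 + g t) * ln t = P t * ln (lam + t)"
          using ln_pos[of t] False by (simp add: g_def field_simps)
        ultimately show ?thesis by (metis (no_types, lifting) mult.assoc mult.commute)
      qed
      then have "A t * (t powr s * ln t) = (1 - cutoff T t ^ K) * ((lam + t) powr s * ln (lam + t))"
        unfolding A by (simp add: mult.assoc)
      then show ?thesis by (simp add: B_def algebra_simps)
    qed
    show "symb k 0 (-1) (\<lambda>t. A t - 1)" for k
    proof -
      have "symb k 0 (0 + (-1 - real 0)) (\<lambda>t. S t * flat T 0 g t)"
        by (intro symb_mult S0 symb_flat g T)
      moreover have "symb k 0 (-1) (\<lambda>t. cutoff T t ^ K)"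
        by (rule symb_mono_order[OF symb_power[OF symb_cutoff[OF T(1)]]]) (use K assms in auto)
      ultimately have "symb k 0 (-1) (\<lambda>t. S t * flat T 0 g t - cutoff T t ^ K)"
        by (intro symb_diff) auto
      moreover have "S t * flat T 0 g t - cutoff T t ^ K = A t - 1" for t
      proof -
        have "flat T 0 (\<lambda>t. 1 + g t) t = flat T 0 (\<lambda>_. 1) t + flat T 0 g t"
          by (simp add: flat_def algebra_simps)
        then show ?thesis using geo[of t] by (simp add: A_def algebra_simps)
      qed
      ultimately show ?thesis by simp
    qed
    show "symb k 0 (-1) B" for k
    proof -
      have "symb k 0 (real K * -1 + (s + 1)) B"
        unfolding B_def using assms T
        by (intro symb_mult symb_power symb_cutoff symb_shifted_powr symb_shifted_ln) auto
      then show ?thesis by (rule symb_mono_order) (use K in auto)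
    qed
  qed
qed

section \<open>Symbols of negative order as superpositions of Bochner--Riesz profiles\<close>

lemma symb_derivative_sequence:
  assumes "symb N T d f"
  obtains D :: "nat \<Rightarrow> real \<Rightarrow> real" where "D 0 = f"
    "\<And>j t. j < N \<Longrightarrow> t \<ge> T \<Longrightarrow> (D j has_real_derivative D (Suc j) t) (at t within {T..})"
    "\<And>j. j \<le> N \<Longrightarrow> order_bounded T (d - real j) (D j)"
proof -
  have "\<exists>D. D 0 = f \<and> (\<forall>j<N. \<forall>t\<ge>T. (D j has_real_derivative D (Suc j) t) (at t within {T..}))
     \<and> (\<forall>j\<le>N. order_bounded T (d - real j) (D j))"
    using assms
  proof (induction N arbitrary: d f)
    case 0 then show ?case by (intro exI[of _ "\<lambda>_. f"]) auto
  next
    case (Suc N)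
    from Suc.prems obtain f' where f': "order_bounded T d f"
      "\<And>t. t\<ge>T \<Longrightarrow> (f has_real_derivative f' t) (at t within {T..})" "symb N T (d - 1) f'"
      by (rule symb_SucE) blast
    from Suc.IH[OF f'(3)] obtain D where D: "D 0 = f'"
      "\<forall>j<N. \<forall>t\<ge>T. (D j has_real_derivative D (Suc j) t) (at t within {T..})"
      "\<forall>j\<le>N. order_bounded T (d - 1 - real j) (D j)" by blast
    show ?case
    proof (intro exI[of _ "case_nat f D"] conjI allI impI)
      fix j t assume "j < Suc N" "T \<le> t"
      then show "((case j of 0 \<Rightarrow> f | Suc x \<Rightarrow> D x) has_real_derivative (case Suc j of 0 \<Rightarrow> f | Suc x \<Rightarrow> D x) t) (at t within {T..})"
        using D(1,2) f'(2)[OF \<open>T \<le> t\<close>] by (cases j) simp_all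
    next
      fix j assume "j \<le> Suc N"
      then show "order_bounded T (d - real j) (case j of 0 \<Rightarrow> f | Suc x \<Rightarrow> D x)"
        using D(3) f'(1) by (cases j) (simp_all add: diff_diff_eq)
    qed auto
  qed
  then show ?thesis using that by blast
qed

text \<open>The Taylor polynomial of a function at a fixed point \<open>r\<close> as a function of its centre \<open>t\<close>: when it is
differentiated the sum telescopes and leaves the integrand of the integral remainder.\<close>

lemma DERIV_taylor_in_centre:
  fixes D :: "nat \<Rightarrow> real \<Rightarrow> real"
  assumes "\<And>j. j \<le> n \<Longrightarrow> (D j has_real_derivative D (Suc j) t) (at t)"
  shows "((\<lambda>t. \<Sum>j\<le>n. (-1) ^ j * (t - r) ^ j / fact j * D j t) has_real_derivative
     (-1) ^ n * (t - r) ^ n / fact n * D (Suc n) t) (at t)"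
  using assms
proof (induction n)
  case 0 then show ?case by simp
next
  case (Suc n)
  have p: "((\<lambda>t. (t - r) ^ Suc n) has_real_derivative real (Suc n) * (t - r) ^ n) (at t)"
    using DERIV_power[of "\<lambda>t. t - r" 1 t UNIV "Suc n"] by (simp add: DERIV_diff[OF DERIV_ident DERIV_const, simplified])
  have f: "real (Suc n) / fact (Suc n) = 1 / (fact n :: real)"
    by (simp add: divide_simps)
  have "((\<lambda>t. (-1) ^ Suc n / fact (Suc n) * ((t - r) ^ Suc n * D (Suc n) t)) has_real_derivative
     (-1) ^ Suc n / fact (Suc n) * (real (Suc n) * (t - r) ^ n * D (Suc n) t + D (Suc (Suc n)) t * (t - r) ^ Suc n)) (at t)"
    by (intro DERIV_cmult DERIV_mult p Suc.prems) auto
  also have "(-1) ^ Suc n / fact (Suc n) * (real (Suc n) * (t - r) ^ n * D (Suc n) t + D (Suc (Suc n)) t * (t - r) ^ Suc n)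
     = - ((-1) ^ n * (t - r) ^ n / fact n * D (Suc n) t) + (-1) ^ Suc n * (t - r) ^ Suc n / fact (Suc n) * D (Suc (Suc n)) t"
  proof -
    have "(-1) ^ Suc n / fact (Suc n) * (real (Suc n) * (t - r) ^ n * D (Suc n) t)
       = - ((-1) ^ n * (t - r) ^ n * D (Suc n) t * (real (Suc n) / fact (Suc n)))"
      by (simp del: fact_Suc)
    also have "\<dots> = - ((-1) ^ n * (t - r) ^ n / fact n * D (Suc n) t)"
      unfolding f by simp
    finally show ?thesis by (simp only: ring_distribs) (simp del: fact_Suc add: ac_simps)
  qed
  finally have *: "((\<lambda>t. (-1) ^ Suc n / fact (Suc n) * ((t - r) ^ Suc n * D (Suc n) t)) has_real_derivative
      - ((-1) ^ n * (t - r) ^ n / fact n * D (Suc n) t) + (-1) ^ Suc n * (t - r) ^ Suc n / fact (Suc n) * D (Suc (Suc n)) t) (at t)" .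
  have "((\<lambda>t. (\<Sum>j\<le>n. (-1) ^ j * (t - r) ^ j / fact j * D j t) + (-1) ^ Suc n / fact (Suc n) * ((t - r) ^ Suc n * D (Suc n) t))
    has_real_derivative (-1) ^ n * (t - r) ^ n / fact n * D (Suc n) t + (- ((-1) ^ n * (t - r) ^ n / fact n * D (Suc n) t) + (-1) ^ Suc n * (t - r) ^ Suc n / fact (Suc n) * D (Suc (Suc n)) t)) (at t)"
    by (rule DERIV_add[OF Suc.IH *]) (use Suc.prems in auto)
  then show ?case by (simp del: fact_Suc power_Suc add: ac_simps)
qed

lemma integrable_inverse_square: "integrable lborel (\<lambda>x::real. 1 / (1 + x\<^sup>2))"
proof -
  have "einterval (-\<infinity>) \<infinity> = UNIV" by (auto simp: einterval_def)
  then show ?thesis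
    using integrable_inverse_1_plus_square
    unfolding set_integrable_def by (simp only: indicator_UNIV scaleR_one inverse_eq_divide)
qed

text \<open>Taylor's formula with the centre moved from \<open>r\<close> to infinity, where the polynomial vanishes by the decay of the
symbol: \<open>f(r) = - \<integral>\<^sub>r\<^sup>\<infinity> (-1)\<^sup>M (t - r)\<^sup>M / M! f\<^bsup>(M+1)\<^esup>(t) dt\<close>. Pulling out \<open>t\<^sup>M\<close> exhibits the truncated power
\<open>(1 - r/t)\<^sub>+\<^sup>M\<close> and an integrable weight. For \<open>M = 0\<close> the power of the vanishing positive part
would be 1.\<close>

lemma symb_bochner_riesz_superposition:
  assumes f: "symb (Suc (Suc M)) 0 (-1) f" and M: "M \<ge> 1"
  obtains w :: "real \<Rightarrow> real" where "integrable lborel w" "\<And>t. t \<le> 0 \<Longrightarrow> w t = 0"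
    "\<And>r. r \<ge> 0 \<Longrightarrow> f r = (\<integral>t. w t * (max 0 (1 - r / t)) ^ M \<partial>lborel)"
proof -
  obtain D where D: "D 0 = f"
    "\<And>j t. j < Suc (Suc M) \<Longrightarrow> t \<ge> 0 \<Longrightarrow> (D j has_real_derivative D (Suc j) t) (at t within {0..})"
    "\<And>j. j \<le> Suc (Suc M) \<Longrightarrow> order_bounded 0 (-1 - real j) (D j)"
    using symb_derivative_sequence[OF f] by blast
  have Dat: "(D j has_real_derivative D (Suc j) t) (at t)" if "j < Suc (Suc M)" "t > 0" for j t
    using D(2)[OF that(1), of t] that(2) at_within_interior[of t "{0..}"] by simp
  \<comment> \<open>the remainder integrand after \<open>(t - r)\<^sup>M = t\<^sup>M (1 - r/t)\<^sup>M\<close>\<close>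
  define w where "w t = (if t > 0 then (-1) ^ Suc M * t ^ M / fact M * D (Suc M) t else 0)" for t
  obtain C where C: "C \<ge> 0" "\<And>t. t \<ge> 0 \<Longrightarrow> \<bar>D (Suc M) t\<bar> \<le> C * (1 + t) powr (-1 - real (Suc M))"
    using order_bounded_nonneg[OF D(3)[of "Suc M"]] by auto
  have w_bound: "\<bar>w t\<bar> \<le> C * (1 / (1 + t\<^sup>2))" for t
  proof (cases "t > 0")
    case True
    have "\<bar>w t\<bar> = t ^ M / fact M * \<bar>D (Suc M) t\<bar>" using True by (simp add: w_def abs_mult)
    also have "\<dots> \<le> t ^ M * \<bar>D (Suc M) t\<bar>"
    proof (rule mult_right_mono)
      have "t ^ M / fact M \<le> t ^ M / 1"
        using True fact_ge_1[of M, where 'a=real] by (intro divide_left_mono) auto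
      then show "t ^ M / fact M \<le> t ^ M" by simp
    qed auto
    also have "\<dots> \<le> (1 + t) ^ M * (C * (1 + t) powr (-1 - real (Suc M)))"
      using True C by (intro mult_mono power_mono) auto
    also have "\<dots> = C * ((1 + t) powr (real M) * (1 + t) powr (-1 - real (Suc M)))"
      using True by (simp add: powr_realpow)
    also have "(1 + t) powr (real M) * (1 + t) powr (-1 - real (Suc M)) = (1 + t) powr (-2)"
      by (simp add: powr_add[symmetric])
    also have "\<dots> = 1 / (1 + t)\<^sup>2" using True by (simp add: powr_minus_divide powr_numeral)
    also have "C * \<dots> \<le> C * (1 / (1 + t\<^sup>2))"
    proof (intro mult_left_mono divide_left_mono)
      show "1 + t\<^sup>2 \<le> (1 + t)\<^sup>2" using True by (simp add: power2_sum)
      show "0 < (1 + t)\<^sup>2 * (1 + t\<^sup>2)" using True by (intro mult_pos_pos) (auto simp: add_pos_nonneg)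
    qed (use C in auto)
    finally show ?thesis .
  qed (use C in \<open>auto simp: w_def\<close>)
  have cont: "continuous_on {0<..} (D (Suc M))"
  proof (rule DERIV_continuous_on)
    fix t :: real assume "t \<in> {0<..}"
    then show "(D (Suc M) has_real_derivative D (Suc (Suc M)) t) (at t within {0<..})"
      by (intro has_field_derivative_at_within[OF Dat]) auto
  qed
  have wm: "w \<in> borel_measurable borel"
  proof -
    have "(\<lambda>t. indicator {0<..} t *\<^sub>R ((-1) ^ Suc M * t ^ M / fact M * D (Suc M) t)) \<in> borel_measurable borel"
      by (rule borel_measurable_continuous_on_indicator) (auto intro!: continuous_intros cont)
    also have "(\<lambda>t. indicator {0<..} t *\<^sub>R ((-1) ^ Suc M * t ^ M / fact M * D (Suc M) t)) = w"
      by (auto simp: w_def fun_eq_iff)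
    finally show ?thesis .
  qed
  have wi: "integrable lborel w"
  proof (rule Bochner_Integration.integrable_bound)
    show "integrable lborel (\<lambda>t. C * (1 / (1 + t\<^sup>2)))"
      by (intro integrable_mult_right integrable_inverse_square)
    show "AE t in lborel. norm (w t) \<le> norm (C * (1 / (1 + t\<^sup>2)))"
      using w_bound C(1) by (intro AE_I2) (simp add: abs_mult)
  qed (use wm in simp)
  show ?thesis
  proof (rule that[OF wi])
    show "w t = 0" if "t \<le> 0" for t using that by (simp add: w_def)
    fix r :: real assume r: "r \<ge> 0"
    define G where "G t = (\<Sum>j\<le>M. (-1) ^ j * (t - r) ^ j / fact j * D j t)" for t
    define g where "g t = (-1) ^ M * (t - r) ^ M / fact M * D (Suc M) t" for t
    have g_w: "indicator {r<..} t *\<^sub>R g t = - (w t * (max 0 (1 - r / t)) ^ M)" for t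
    proof (cases "t > r")
      case True
      then have t: "t > 0" using r by simp
      have "r / t \<le> 1" using True t by simp
      then have "max 0 (1 - r / t) = 1 - r / t" by simp
      also have "\<dots> = (t - r) / t" using t by (simp add: diff_divide_distrib)
      finally have mx: "max 0 (1 - r / t) = (t - r) / t" .
      have "t ^ M * ((t - r) / t) ^ M = (t - r) ^ M" using t by (simp add: power_divide)
      then have "(-1) ^ Suc M * t ^ M / fact M * D (Suc M) t * ((t - r) / t) ^ M = - g t"
        unfolding g_def by (metis (no_types, lifting) minus_mult_left mult.assoc mult.commute mult_minus1 power_Suc times_divide_eq_left)
      then show ?thesis unfolding mx using True t by (simp add: w_def)
    next
      case False
      have "max 0 (1 - r / t) = 0" if "t > 0"
        using False that by (intro max_absorb1) simp
      then have "t \<le> 0 \<or> max 0 (1 - r / t) = 0" by linarith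
      then show ?thesis using False M by (auto simp: w_def)
    qed
    have gi: "set_integrable lborel (einterval (ereal r) \<infinity>) g"
      unfolding set_integrable_def einterval_eq g_w
    proof (rule integrable_minus, rule Bochner_Integration.integrable_bound[OF wi])
      show "(\<lambda>t. w t * max 0 (1 - r / t) ^ M) \<in> borel_measurable lborel" using wm by measurable
      show "AE t in lborel. norm (w t * max 0 (1 - r / t) ^ M) \<le> norm (w t)"
      proof (rule AE_I2)
        fix t
        have "max 0 (1 - r / t) ^ M \<le> 1" if "t > 0"
          using that r by (intro power_le_one) auto
        then have "\<bar>w t\<bar> * max 0 (1 - r / t) ^ M \<le> \<bar>w t\<bar>"
          by (cases "t > 0") (simp_all only: mult_left_le abs_ge_zero, simp add: w_def)
        then show "norm (w t * max 0 (1 - r / t) ^ M) \<le> norm (w t)"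
          by (simp add: abs_mult)
      qed
    qed
    have ftc: "(LBINT t=ereal r..\<infinity>. g t) = 0 - G r"
    proof (rule interval_integral_FTC_integrable[OF _ _ _ gi])
      fix t assume "ereal r < ereal t"
      then have t: "t > 0" using r by simp
      show "(G has_vector_derivative g t) (at t)"
        unfolding G_def g_def has_real_derivative_iff_has_vector_derivative[symmetric]
        by (rule DERIV_taylor_in_centre) (auto intro!: Dat t)
      show "isCont g t"
      proof -
        have "isCont (D (Suc M)) t" using DERIV_isCont[OF Dat[of "Suc M" t]] t by simp
        then show ?thesis
          unfolding isCont_def g_def
          by (intro tendsto_mult tendsto_divide tendsto_power tendsto_diff tendsto_const tendsto_ident_at) auto
      qed
    next
      have Gw: "(G \<longlongrightarrow> G r) (at r within {0..})"
        unfolding G_def[abs_def]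
      proof (rule tendsto_sum)
        fix j assume "j \<in> {..M}"
        then have Dj: "(D j \<longlongrightarrow> D j r) (at r within {0..})"
          using DERIV_continuous[OF D(2)[of j r]] r unfolding continuous_within by auto
        show "((\<lambda>t. (-1) ^ j * (t - r) ^ j / fact j * D j t) \<longlongrightarrow> (-1) ^ j * (r - r) ^ j / fact j * D j r) (at r within {0..})"
          by (intro tendsto_mult tendsto_divide tendsto_power tendsto_diff tendsto_const tendsto_ident_at Dj) simp
      qed
      have "(G \<longlongrightarrow> G r) (at_right r)"
        by (rule tendsto_within_subset[OF Gw]) (use r in auto)
      then show "((G \<circ> real_of_ereal) \<longlongrightarrow> G r) (at_right (ereal r))"
        by (simp add: ereal_tendsto_simps)
    next
      have "(G \<longlongrightarrow> (\<Sum>j\<le>M. 0)) at_top" unfolding G_def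
      proof (intro tendsto_sum)
        fix j assume j: "j \<in> {..M}"
        obtain B where B: "B \<ge> 0" "\<And>t. t \<ge> 0 \<Longrightarrow> \<bar>D j t\<bar> \<le> B * (1 + t) powr (-1 - real j)"
          using order_bounded_nonneg[OF D(3)[of j]] j by auto
        show "((\<lambda>t. (-1) ^ j * (t - r) ^ j / fact j * D j t) \<longlongrightarrow> 0) at_top"
        proof (rule Lim_null_comparison)
          show "\<forall>\<^sub>F t in at_top. norm ((-1) ^ j * (t - r) ^ j / fact j * D j t) \<le> B * (1 / (1 + t))"
            using eventually_ge_at_top[of r]
          proof eventually_elim
            case (elim t)
            have t: "t \<ge> 0" using elim r by simp
            have "norm ((-1) ^ j * (t - r) ^ j / fact j * D j t) = (t - r) ^ j / fact j * \<bar>D j t\<bar>"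
              using elim by (simp add: abs_mult)
            also have "\<dots> \<le> (t - r) ^ j * \<bar>D j t\<bar>"
            proof (rule mult_right_mono)
              have "(t - r) ^ j / fact j \<le> (t - r) ^ j / 1"
                using elim fact_ge_1[of j, where 'a=real] by (intro divide_left_mono) auto
              then show "(t - r) ^ j / fact j \<le> (t - r) ^ j" by simp
            qed auto
            also have "\<dots> \<le> (1 + t) ^ j * (B * (1 + t) powr (-1 - real j))"
              using elim r t B by (intro mult_mono power_mono) auto
            also have "\<dots> = B * ((1 + t) powr (real j) * (1 + t) powr (-1 - real j))"
              using t by (simp add: powr_realpow)
            also have "(1 + t) powr (real j) * (1 + t) powr (-1 - real j) = 1 / (1 + t)"
              using t by (simp add: powr_add[symmetric] powr_minus_divide)
            finally show ?case .
          qed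
          show "((\<lambda>t. B * (1 / (1 + t))) \<longlongrightarrow> 0) at_top"
            by (intro tendsto_mult_right_zero tendsto_divide_0[OF tendsto_const] filterlim_at_top_imp_at_infinity
                filterlim_tendsto_add_at_top[OF tendsto_const filterlim_ident])
        qed
      qed
      then show "((G \<circ> real_of_ereal) \<longlongrightarrow> 0) (at_left \<infinity>)"
        by (simp add: ereal_tendsto_simps)
    qed simp
    have Gr: "G r = f r"
    proof -
      have "G r = (\<Sum>j\<in>{0}. (-1) ^ j * (r - r) ^ j / fact j * D j r)"
        unfolding G_def by (rule sum.mono_neutral_right) auto
      then show ?thesis by (simp add: D)
    qed
    have "(LBINT t=ereal r..\<infinity>. g t) = - (\<integral>t. w t * (max 0 (1 - r / t)) ^ M \<partial>lborel)"
      unfolding interval_integral_to_infinity_eq set_lebesgue_integral_def g_w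
      by (rule Bochner_Integration.integral_minus)
    with ftc Gr show "f r = (\<integral>t. w t * (max 0 (1 - r / t)) ^ M \<partial>lborel)" by linarith
  qed
qed

section \<open>Partial derivatives\<close>

text \<open>Partial derivatives are defined along lines, so they are values of the Frechet derivative where it exists.\<close>

lemma has_vector_derivative_along_axis:
  assumes "(f has_derivative f') (at (x + t *\<^sub>R axis i 1))"
  shows "((\<lambda>t. f (x + t *\<^sub>R axis i 1)) has_vector_derivative f' (axis i 1)) (at t)"
proof -
  have "((\<lambda>t. x + t *\<^sub>R axis i 1) has_derivative (\<lambda>t. t *\<^sub>R axis i 1)) (at t)"
    by (auto intro!: derivative_eq_intros)
  from has_derivative_compose[OF this assms]
  have "((\<lambda>t. f (x + t *\<^sub>R axis i 1)) has_derivative (\<lambda>t. f' (t *\<^sub>R axis i 1))) (at t)" .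
  then show ?thesis
    unfolding has_vector_derivative_def
    by (simp add: linear_cmul[OF has_derivative_linear[OF assms]])
qed

lemma partial_deriv_eqI:
  assumes "(f has_derivative f') (at x)"
  shows "partial_deriv i f x = f' (axis i 1)"
  unfolding partial_deriv_def
  using has_vector_derivative_along_axis[of f f' x 0 i] assms by (intro vector_derivative_at) simp

lemma has_vector_derivative_partial_deriv:
  assumes "f differentiable (at (x + t *\<^sub>R axis i 1))"
  shows "((\<lambda>t. f (x + t *\<^sub>R axis i 1)) has_vector_derivative partial_deriv i f (x + t *\<^sub>R axis i 1)) (at t)"
  using assms has_vector_derivative_along_axis[of f _ x t i] partial_deriv_eqI[of f _ "x + t *\<^sub>R axis i 1" i]
  unfolding differentiable_def by metis

lemma partial_deriv_add:
  assumes "f differentiable (at x)" "g differentiable (at x)"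
  shows "partial_deriv i (\<lambda>x. f x + g x) x = partial_deriv i f x + partial_deriv i g x"
proof -
  obtain f' g' where d: "(f has_derivative f') (at x)" "(g has_derivative g') (at x)"
    using assms unfolding differentiable_def by blast
  show ?thesis
    using partial_deriv_eqI[OF d(1), of i] partial_deriv_eqI[OF d(2), of i]
      partial_deriv_eqI[OF has_derivative_add[OF d], of i] by simp
qed

lemma partial_deriv_mult:
  assumes "f differentiable (at x)" "g differentiable (at x)"
  shows "partial_deriv i (\<lambda>x. f x * g x) x = partial_deriv i f x * g x + f x * partial_deriv i g x"
proof -
  obtain f' g' where d: "(f has_derivative f') (at x)" "(g has_derivative g') (at x)"
    using assms unfolding differentiable_def by blast
  show ?thesis
    using partial_deriv_eqI[OF d(1), of i] partial_deriv_eqI[OF d(2), of i]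
      partial_deriv_eqI[OF has_derivative_mult[OF d], of i] by simp
qed

lemma partial_deriv_const: "partial_deriv i (\<lambda>_. c) x = 0"
  using partial_deriv_eqI[OF has_derivative_const[of c "at x"], of i] by simp

lemma has_derivative_coordinate:
  "((\<lambda>x. complex_of_real (x $ j)) has_derivative (\<lambda>h. complex_of_real (h $ j))) (at x)"
  by (intro has_derivative_of_real bounded_linear_imp_has_derivative bounded_linear_vec_nth)

lemma partial_deriv_coordinate:
  "partial_deriv i (\<lambda>x. complex_of_real (x $ j)) x = (if i = j then 1 else 0)"
  using partial_deriv_eqI[OF has_derivative_coordinate, of i j x] by (simp add: axis_def)

section \<open>Rapid decay and polynomial growth\<close>

definition rapid :: "(real ^ 'n::finite \<Rightarrow> complex) \<Rightarrow> bool" where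
  "rapid g \<longleftrightarrow> (\<forall>N. \<exists>C. \<forall>x. (1 + norm x) ^ N * norm (g x) \<le> C)"

definition poly_bounded :: "(real ^ 'n::finite \<Rightarrow> complex) \<Rightarrow> bool" where
  "poly_bounded g \<longleftrightarrow> (\<exists>N C. \<forall>x. norm (g x) \<le> C * (1 + norm x) ^ N)"

lemma power_add_le_two_power: "(a + b) ^ N \<le> 2 ^ N * (a ^ N + b ^ N)" if "a \<ge> 0" "b \<ge> 0" for a b :: real
proof -
  have "(a + b) ^ N \<le> (2 * max a b) ^ N" using that by (intro power_mono) auto
  also have "\<dots> = 2 ^ N * max a b ^ N" by (simp add: power_mult_distrib)
  also have "\<dots> \<le> 2 ^ N * (a ^ N + b ^ N)"
    using that by (intro mult_left_mono) (auto simp: max_def)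
  finally show ?thesis .
qed

lemma norm_power_le_sum_coordinates:
  fixes x :: "real ^ 'n::finite"
  shows "norm x ^ N \<le> real CARD('n) ^ N * (\<Sum>i\<in>UNIV. \<bar>x $ i\<bar> ^ N)"
proof -
  define m where "m = Max (range (\<lambda>i. \<bar>x $ i\<bar>))"
  have m: "\<bar>x $ i\<bar> \<le> m" for i unfolding m_def by (rule Max_ge) auto
  have "m \<in> range (\<lambda>i. \<bar>x $ i\<bar>)" unfolding m_def by (rule Max_in) auto
  then obtain k where k: "m = \<bar>x $ k\<bar>" by blast
  have "norm x \<le> (\<Sum>i\<in>UNIV. \<bar>x $ i\<bar>)" by (rule norm_le_l1_cart)
  also have "\<dots> \<le> (\<Sum>i\<in>(UNIV::'n set). m)" by (rule sum_mono) (rule m)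
  finally have "norm x \<le> real CARD('n) * m" by simp
  then have "norm x ^ N \<le> (real CARD('n) * m) ^ N" by (intro power_mono) auto
  also have "\<dots> = real CARD('n) ^ N * \<bar>x $ k\<bar> ^ N" by (simp add: power_mult_distrib k)
  also have "\<dots> \<le> real CARD('n) ^ N * (\<Sum>i\<in>UNIV. \<bar>x $ i\<bar> ^ N)"
    by (intro mult_left_mono member_le_sum) auto
  finally show ?thesis .
qed

text \<open>It suffices to control the powers of the single coordinates.\<close>

lemma rapidI:
  fixes g :: "real ^ 'n::finite \<Rightarrow> complex"
  assumes "\<And>N i. \<exists>C. \<forall>x. \<bar>x $ i\<bar> ^ N * norm (g x) \<le> C"
  shows "rapid g"
  unfolding rapid_def
proof
  fix N
  define C where "C N i = (SOME C. \<forall>x. \<bar>x $ i\<bar> ^ N * norm (g x) \<le> C)" for N i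
  have C: "\<bar>x $ i\<bar> ^ N * norm (g x) \<le> C N i" for N i x
    unfolding C_def using someI_ex[OF assms[of i N]] by blast
  show "\<exists>C. \<forall>x. (1 + norm x) ^ N * norm (g x) \<le> C"
  proof (intro exI allI)
    fix x :: "real ^ 'n"
    have "(1 + norm x) ^ N * norm (g x) \<le> (2 ^ N * (1 ^ N + norm x ^ N)) * norm (g x)"
      by (intro mult_right_mono power_add_le_two_power) auto
    also have "\<dots> \<le> (2 ^ N * (1 + real CARD('n) ^ N * (\<Sum>i\<in>UNIV. \<bar>x $ i\<bar> ^ N))) * norm (g x)"
      by (intro mult_right_mono mult_left_mono add_mono norm_power_le_sum_coordinates) auto
    also have "\<dots> = 2 ^ N * (norm (g x) + real CARD('n) ^ N * (\<Sum>i\<in>UNIV. \<bar>x $ i\<bar> ^ N * norm (g x)))"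
      by (simp add: algebra_simps sum_distrib_left sum_distrib_right)
    also have "\<dots> \<le> 2 ^ N * (C 0 undefined + real CARD('n) ^ N * (\<Sum>i\<in>UNIV. C N i))"
      using C[of x undefined 0] by (intro mult_left_mono add_mono sum_mono C) auto
    finally show "(1 + norm x) ^ N * norm (g x) \<le> 2 ^ N * (C 0 undefined + real CARD('n) ^ N * (\<Sum>i\<in>UNIV. C N i))" .
  qed
qed

lemma norm_monomial_le: "norm (monomial \<alpha> (x :: real ^ 'a::finite)) \<le> (1 + norm x) ^ (\<Sum>i\<in>UNIV. \<alpha> i)"
proof -
  have "norm (monomial \<alpha> x) = (\<Prod>i\<in>UNIV. \<bar>x $ i\<bar> ^ \<alpha> i)"
    by (simp add: monomial_def norm_power prod_norm[symmetric])
  also have "\<dots> \<le> (\<Prod>i\<in>UNIV. (1 + norm x) ^ \<alpha> i)"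
  proof (rule prod_mono)
    fix i :: 'a assume "i \<in> UNIV"
    show "0 \<le> \<bar>x $ i\<bar> ^ \<alpha> i \<and> \<bar>x $ i\<bar> ^ \<alpha> i \<le> (1 + norm x) ^ \<alpha> i"
      using component_le_norm_cart[of x i] by (intro conjI power_mono) auto
  qed
  finally show ?thesis by (simp add: power_sum)
qed

lemma rapid_iff_monomial:
  fixes g :: "real ^ 'n::finite \<Rightarrow> complex"
  shows "rapid g \<longleftrightarrow> (\<forall>\<alpha>. bounded (range (\<lambda>x. monomial \<alpha> x * g x)))"
proof safe
  fix \<alpha> :: "'n \<Rightarrow> nat" assume "rapid g"
  then obtain C where C: "\<And>x. (1 + norm x) ^ (\<Sum>i\<in>UNIV. \<alpha> i) * norm (g x) \<le> C"
    unfolding rapid_def by blast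
  show "bounded (range (\<lambda>x. monomial \<alpha> x * g x))"
    unfolding bounded_iff
    using order_trans[OF mult_right_mono[OF norm_monomial_le[of \<alpha>] norm_ge_zero] C]
    by (intro exI[of _ C]) (auto simp: norm_mult)
next
  assume *: "\<forall>\<alpha>. bounded (range (\<lambda>x. monomial \<alpha> x * g x))"
  show "rapid g"
  proof (rule rapidI)
    fix N and i :: 'n
    have "norm (monomial ((\<lambda>_. 0)(i := N)) x) = \<bar>x $ i\<bar> ^ N" for x :: "real ^ 'n"
    proof -
      have "(\<Prod>j\<in>UNIV. (x $ j) ^ ((\<lambda>_. 0)(i := N)) j) = (\<Prod>j\<in>{i}. (x $ j) ^ ((\<lambda>_. 0)(i := N)) j)"
        by (rule prod.mono_neutral_right) auto
      then show ?thesis by (simp add: monomial_def norm_power power_abs)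
    qed
    then show "\<exists>C. \<forall>x. \<bar>x $ i\<bar> ^ N * norm (g x) \<le> C"
      using *[rule_format, of "(\<lambda>_. 0)(i := N)"] unfolding bounded_iff by (auto simp: norm_mult)
  qed
qed

lemma rapid_nonneg:
  assumes "rapid g"
  obtains C where "C \<ge> 0" "\<And>x. (1 + norm x) ^ N * norm (g x) \<le> C"
proof -
  obtain C where C: "\<And>x. (1 + norm x) ^ N * norm (g x) \<le> C" using assms unfolding rapid_def by blast
  have "0 \<le> (1 + norm 0) ^ N * norm (g 0)" by simp
  then have "C \<ge> 0" using C[of 0] by (rule order_trans)
  with C show ?thesis using that by blast
qed

lemma rapid_add: assumes "rapid f" "rapid g" shows "rapid (\<lambda>x. f x + g x)"
  unfolding rapid_def
proof
  fix N
  obtain C D where C: "\<And>x. (1 + norm x) ^ N * norm (f x) \<le> C" and D: "\<And>x. (1 + norm x) ^ N * norm (g x) \<le> D"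
    using assms unfolding rapid_def by metis
  show "\<exists>C. \<forall>x. (1 + norm x) ^ N * norm (f x + g x) \<le> C"
  proof (intro exI allI)
    fix x
    have "(1 + norm x) ^ N * norm (f x + g x) \<le> (1 + norm x) ^ N * (norm (f x) + norm (g x))"
      by (intro mult_left_mono norm_triangle_ineq) auto
    then show "(1 + norm x) ^ N * norm (f x + g x) \<le> C + D" using C[of x] D[of x] by (simp add: algebra_simps)
  qed
qed

lemma rapid_mult: assumes "poly_bounded f" "rapid g" shows "rapid (\<lambda>x. f x * g x)"
  unfolding rapid_def
proof
  fix N
  obtain M C where C: "\<And>x. norm (f x) \<le> C * (1 + norm x) ^ M"
    using assms unfolding poly_bounded_def by metis
  obtain D where D: "D \<ge> 0" "\<And>x. (1 + norm x) ^ (N + M) * norm (g x) \<le> D"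
    using rapid_nonneg[OF assms(2)] by metis
  show "\<exists>C. \<forall>x. (1 + norm x) ^ N * norm (f x * g x) \<le> C"
  proof (intro exI allI)
    fix x
    have "(1 + norm x) ^ N * norm (f x * g x) \<le> (1 + norm x) ^ N * ((\<bar>C\<bar> * (1 + norm x) ^ M) * norm (g x))"
      unfolding norm_mult using C[of x]
      by (intro mult_left_mono mult_right_mono) (auto intro: order_trans[OF _ mult_right_mono[OF abs_ge_self]])
    also have "\<dots> = \<bar>C\<bar> * ((1 + norm x) ^ (N + M) * norm (g x))" by (simp add: power_add ac_simps)
    also have "\<dots> \<le> \<bar>C\<bar> * D" by (intro mult_left_mono D) auto
    finally show "(1 + norm x) ^ N * norm (f x * g x) \<le> \<bar>C\<bar> * D" .
  qed
qed

section \<open>Schwartz functions\<close>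

lemma partial_derivs_Nil [simp]: "partial_derivs [] f = f"
  and partial_derivs_Cons [simp]: "partial_derivs (i # \<beta>) f = partial_deriv i (partial_derivs \<beta> f)"
  by (simp_all add: partial_derivs_def)

lemma partial_derivs_partial_deriv: "partial_derivs \<beta> (partial_deriv i f) = partial_derivs (\<beta> @ [i]) f"
  by (simp add: partial_derivs_def)

lemma schwartzD:
  assumes "\<phi> \<in> schwartz"
  shows "partial_derivs \<beta> \<phi> differentiable (at x)"
    and "bounded (range (\<lambda>x. monomial \<alpha> x * partial_derivs \<beta> \<phi> x))"
  using assms by (simp_all only: schwartz_def smooth_def mem_Collect_eq)

lemma schwartzI:
  assumes "\<And>\<beta> x. partial_derivs \<beta> \<phi> differentiable (at x)"
    and "\<And>\<alpha> \<beta>. bounded (range (\<lambda>x. monomial \<alpha> x * partial_derivs \<beta> \<phi> x))"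
  shows "\<phi> \<in> schwartz"
  using assms by (simp only: schwartz_def smooth_def mem_Collect_eq) blast

text \<open>Coinduction: a set of differentiable, rapidly decreasing functions that is closed under partial derivatives consists
of Schwartz functions. Each closure property of the Schwartz space is proved by exhibiting such a set.\<close>

lemma schwartz_coinduct:
  assumes "f \<in> X"
    and "\<And>g x. g \<in> X \<Longrightarrow> g differentiable (at x)"
    and "\<And>g. g \<in> X \<Longrightarrow> rapid g"
    and "\<And>g i. g \<in> X \<Longrightarrow> partial_deriv i g \<in> X"
  shows "f \<in> schwartz"
proof -
  have "partial_derivs \<beta> f \<in> X" for \<beta>
    by (induction \<beta>) (auto intro: assms)
  then have "partial_derivs \<beta> f differentiable (at x)" "rapid (partial_derivs \<beta> f)" for \<beta> x
    using assms(2,3) by blast+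
  then show ?thesis
    by (intro schwartzI) (simp_all add: rapid_iff_monomial)
qed

lemma schwartz_differentiable: "\<phi> \<in> schwartz \<Longrightarrow> \<phi> differentiable (at x)"
  using schwartzD(1)[of \<phi> "[]"] by simp

lemma schwartz_rapid: "\<phi> \<in> schwartz \<Longrightarrow> rapid \<phi>"
  using schwartzD(2)[of \<phi> _ "[]"] by (simp add: rapid_iff_monomial)

lemma schwartz_partial_deriv: "\<phi> \<in> schwartz \<Longrightarrow> partial_deriv i \<phi> \<in> schwartz"
  by (rule schwartzI; simp only: partial_derivs_partial_deriv; rule schwartzD)

lemma schwartz_partial_derivs: "\<phi> \<in> schwartz \<Longrightarrow> partial_derivs \<beta> \<phi> \<in> schwartz"
  by (induction \<beta>) (simp_all add: schwartz_partial_deriv)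

lemma schwartz_continuous_on: "\<phi> \<in> schwartz \<Longrightarrow> continuous_on S \<phi>"
  by (intro continuous_at_imp_continuous_on ballI differentiable_imp_continuous_within schwartz_differentiable)

lemma schwartz_add:
  assumes "\<phi> \<in> schwartz" "\<psi> \<in> schwartz"
  shows "(\<lambda>x. \<phi> x + \<psi> x) \<in> schwartz"
proof (rule schwartz_coinduct[of _ "{\<lambda>x. \<phi> x + \<psi> x |\<phi> \<psi>. \<phi> \<in> schwartz \<and> \<psi> \<in> schwartz}"])
  fix g i assume "g \<in> {\<lambda>x. \<phi> x + \<psi> x |\<phi> \<psi>. \<phi> \<in> schwartz \<and> \<psi> \<in> schwartz}"
  then obtain \<phi> \<psi> where g: "g = (\<lambda>x. \<phi> x + \<psi> x)" "\<phi> \<in> schwartz" "\<psi> \<in> schwartz" by blast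
  have "partial_deriv i g = (\<lambda>x. partial_deriv i \<phi> x + partial_deriv i \<psi> x)"
    unfolding g(1) by (intro ext partial_deriv_add schwartz_differentiable g(2,3))
  then show "partial_deriv i g \<in> {\<lambda>x. \<phi> x + \<psi> x |\<phi> \<psi>. \<phi> \<in> schwartz \<and> \<psi> \<in> schwartz}"
    using schwartz_partial_deriv[OF g(2), of i] schwartz_partial_deriv[OF g(3), of i] by blast
  show "g differentiable (at x)" for x
    unfolding g(1) by (intro differentiable_add schwartz_differentiable g(2,3))
  show "rapid g" unfolding g(1) by (intro rapid_add schwartz_rapid g(2,3))
qed (use assms in blast)

section \<open>Smooth multipliers\<close>

text \<open>An algebra of smooth functions of polynomial growth, closed under partial derivatives, that contains every
multiplier of the proof: polynomials, radial symbols and the cut-offs in a single coordinate. Composition of a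
symbol with a nonnegative member covers the latter two.\<close>

inductive_set multiplier :: "(real ^ 'n::finite \<Rightarrow> complex) set" where
  const: "(\<lambda>_. c) \<in> multiplier"
| coordinate: "(\<lambda>x. complex_of_real (x $ i)) \<in> multiplier"
| add: "f \<in> multiplier \<Longrightarrow> g \<in> multiplier \<Longrightarrow> (\<lambda>x. f x + g x) \<in> multiplier"
| mult: "f \<in> multiplier \<Longrightarrow> g \<in> multiplier \<Longrightarrow> (\<lambda>x. f x * g x) \<in> multiplier"
| symbol: "(\<lambda>x. complex_of_real (\<sigma> x)) \<in> multiplier \<Longrightarrow> (\<And>x. \<sigma> x \<ge> 0) \<Longrightarrow> (\<And>k. symb k 0 d f) \<Longrightarrow>
    (\<lambda>x. complex_of_real (f (\<sigma> x))) \<in> multiplier"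

text \<open>One-sided derivatives are unique, so that the derivatives provided for different numbers of controlled
derivatives coincide.\<close>

lemma DERIV_unique_within_Ici:
  fixes f :: "real \<Rightarrow> real"
  assumes "(f has_real_derivative D) (at t within {T..})" "(f has_real_derivative E) (at t within {T..})" "t \<ge> T"
  shows "D = E"
proof (rule vector_derivative_unique_within)
  have "at_right t \<le> at t within {T..}" using assms(3) by (intro at_le) auto
  then show "at t within {T..} \<noteq> bot" using trivial_limit_at_right_real[of t] bot.extremum_unique by metis
qed (use assms in \<open>auto simp: has_real_derivative_iff_has_vector_derivative\<close>)

lemma symb_derivative:
  assumes "\<And>k. symb k T d f"
  obtains f' where "\<And>t. t \<ge> T \<Longrightarrow> (f has_real_derivative f' t) (at t within {T..})" "\<And>k. symb k T (d - 1) f'"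
proof -
  obtain f' where f': "\<And>t. t \<ge> T \<Longrightarrow> (f has_real_derivative f' t) (at t within {T..})"
    using assms[of "Suc 0"] by (rule symb_SucE) blast
  have "symb k T (d - 1) f'" for k
  proof -
    obtain g where g: "\<And>t. t \<ge> T \<Longrightarrow> (f has_real_derivative g t) (at t within {T..})" "symb k T (d - 1) g"
      using assms[of "Suc k"] by (rule symb_SucE) blast
    show ?thesis
      by (rule symb_cong[OF g(2)]) (use DERIV_unique_within_Ici[OF g(1) f'] in auto)
  qed
  with f' show ?thesis using that by blast
qed

lemma has_derivative_symbol:
  fixes \<sigma> :: "real ^ 'n::finite \<Rightarrow> real"
  assumes \<sigma>: "((\<lambda>x. complex_of_real (\<sigma> x)) has_derivative g') (at x)" and pos: "\<And>x. \<sigma> x \<ge> 0"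
    and f: "\<And>t. t \<ge> 0 \<Longrightarrow> (f has_real_derivative f' t) (at t within {0..})"
  shows "((\<lambda>x. complex_of_real (f (\<sigma> x))) has_derivative (\<lambda>h. complex_of_real (f' (\<sigma> x)) * g' h)) (at x)"
proof -
  have re: "(\<sigma> has_derivative (\<lambda>h. Re (g' h))) (at x)"
    using has_derivative_Re[OF \<sigma>] by simp
  then have "((\<lambda>x. complex_of_real (\<sigma> x)) has_derivative (\<lambda>h. complex_of_real (Re (g' h)))) (at x)"
    by (intro derivative_intros)
  from has_derivative_unique[OF this \<sigma>] have g': "g' = (\<lambda>h. complex_of_real (Re (g' h)))" by simp
  have "(f has_derivative (*) (f' (\<sigma> x))) (at (\<sigma> x) within range \<sigma>)"
    using f[OF pos[of x]] unfolding has_field_derivative_def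
    by (rule has_derivative_subset) (use pos in auto)
  from has_derivative_in_compose[OF re this]
  have "((\<lambda>x. f (\<sigma> x)) has_derivative (\<lambda>h. f' (\<sigma> x) * Re (g' h))) (at x)" .
  then have "((\<lambda>x. complex_of_real (f (\<sigma> x))) has_derivative (\<lambda>h. complex_of_real (f' (\<sigma> x) * Re (g' h)))) (at x)"
    by (intro derivative_intros)
  then show ?thesis by (subst g') simp
qed

lemma order_bounded_imp_poly_bounded:
  assumes "order_bounded 0 d f" "poly_bounded (\<lambda>x. complex_of_real (\<sigma> x))" "\<And>x. \<sigma> x \<ge> 0"
  shows "poly_bounded (\<lambda>x. complex_of_real (f (\<sigma> x)))"
proof -
  obtain M where M: "d \<le> real M" using real_arch_simple by blast
  obtain C where C: "C \<ge> 0" "\<And>t. t \<ge> 0 \<Longrightarrow> \<bar>f t\<bar> \<le> C * (1 + t) powr real M"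
    using order_bounded_nonneg[OF order_bounded_mono[OF assms(1) M]] by auto
  obtain N D where D: "\<And>x. norm (complex_of_real (\<sigma> x)) \<le> D * (1 + norm x) ^ N"
    using assms(2) unfolding poly_bounded_def by blast
  have "norm (complex_of_real (f (\<sigma> x))) \<le> (C * (1 + \<bar>D\<bar>) ^ M) * (1 + norm x) ^ (N * M)" for x
  proof -
    have 1: "1 \<le> (1 + norm x) ^ N" by (rule one_le_power) simp
    have "\<sigma> x \<le> D * (1 + norm x) ^ N" using D[of x] assms(3)[of x] by simp
    also have "\<dots> \<le> \<bar>D\<bar> * (1 + norm x) ^ N" by (intro mult_right_mono) auto
    finally have 2: "1 + \<sigma> x \<le> (1 + \<bar>D\<bar>) * (1 + norm x) ^ N"
      using 1 by (simp only: distrib_right mult_1)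
    have "norm (complex_of_real (f (\<sigma> x))) \<le> C * (1 + \<sigma> x) ^ M"
      using C(2)[OF assms(3)[of x]] assms(3)[of x] by (simp add: powr_realpow)
    also have "\<dots> \<le> C * ((1 + \<bar>D\<bar>) * (1 + norm x) ^ N) ^ M"
      using 2 C(1) assms(3)[of x] by (intro mult_left_mono power_mono) auto
    finally show ?thesis by (simp add: power_mult_distrib power_mult)
  qed
  then show ?thesis unfolding poly_bounded_def by blast
qed

lemma poly_bounded_nonneg:
  assumes "poly_bounded g"
  obtains C N where "C \<ge> 0" "\<And>x. norm (g x) \<le> C * (1 + norm x) ^ N"
proof -
  obtain C N where C: "\<And>x. norm (g x) \<le> C * (1 + norm x) ^ N" using assms unfolding poly_bounded_def by blast
  have "norm (g 0) \<le> C" using C[of 0] by simp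
  then have "C \<ge> 0" using norm_ge_zero[of "g 0"] by linarith
  with C show ?thesis using that by blast
qed

lemma poly_bounded_mult:
  assumes "poly_bounded f" "poly_bounded g" shows "poly_bounded (\<lambda>x. f x * g x)"
proof -
  obtain C N where C: "C \<ge> 0" "\<And>x. norm (f x) \<le> C * (1 + norm x) ^ N" using poly_bounded_nonneg[OF assms(1)] by blast
  obtain D M where D: "D \<ge> 0" "\<And>x. norm (g x) \<le> D * (1 + norm x) ^ M" using poly_bounded_nonneg[OF assms(2)] by blast
  have "norm (f x * g x) \<le> (C * D) * (1 + norm x) ^ (N + M)" for x
    using mult_mono[OF C(2)[of x] D(2)[of x]] C(1) by (simp add: norm_mult power_add ac_simps)
  then show ?thesis unfolding poly_bounded_def by blast
qed

lemma poly_bounded_add: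
  assumes "poly_bounded f" "poly_bounded g" shows "poly_bounded (\<lambda>x. f x + g x)"
proof -
  obtain C N where C: "C \<ge> 0" "\<And>x. norm (f x) \<le> C * (1 + norm x) ^ N" using poly_bounded_nonneg[OF assms(1)] by blast
  obtain D M where D: "D \<ge> 0" "\<And>x. norm (g x) \<le> D * (1 + norm x) ^ M" using poly_bounded_nonneg[OF assms(2)] by blast
  have "norm (f x + g x) \<le> (C + D) * (1 + norm x) ^ (N + M)" for x
  proof -
    have "norm (f x + g x) \<le> C * (1 + norm x) ^ N + D * (1 + norm x) ^ M"
      by (rule order_trans[OF norm_triangle_ineq add_mono[OF C(2) D(2)]])
    also have "\<dots> \<le> C * (1 + norm x) ^ (N + M) + D * (1 + norm x) ^ (N + M)"
      using C(1) D(1) by (intro add_mono mult_left_mono power_increasing) auto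
    finally show ?thesis by (simp add: algebra_simps)
  qed
  then show ?thesis unfolding poly_bounded_def by blast
qed

lemma multiplier_properties:
  assumes "g \<in> multiplier"
  shows "(\<forall>x. g differentiable (at x)) \<and> poly_bounded g \<and> (\<forall>i. partial_deriv i g \<in> multiplier)"
  using assms
proof induction
  case (const c)
  have "norm c \<le> norm c * (1 + norm x) ^ 0" for x :: "real ^ 'a" by simp
  then have "poly_bounded (\<lambda>_::real^'a. c)" unfolding poly_bounded_def by blast
  then show ?case
    by (auto simp: partial_deriv_const[abs_def] intro: multiplier.const)
next
  case (coordinate j)
  have "norm (complex_of_real (x $ j)) \<le> 1 * (1 + norm x) ^ 1" for x :: "real ^ 'a"
    using component_le_norm_cart[of x j] by simp
  then have "poly_bounded (\<lambda>x::real^'a. complex_of_real (x $ j))" unfolding poly_bounded_def by blast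
  moreover have "partial_deriv i (\<lambda>x. complex_of_real (x $ j)) = (\<lambda>_. if i = j then 1 else 0)" for i
    by (rule ext) (rule partial_deriv_coordinate)
  ultimately show ?case
    using has_derivative_coordinate multiplier.const unfolding differentiable_def by (metis (no_types))
next
  case (add f g)
  then have "partial_deriv i (\<lambda>x. f x + g x) = (\<lambda>x. partial_deriv i f x + partial_deriv i g x)" for i
    by (auto simp: fun_eq_iff intro!: partial_deriv_add)
  then show ?case using add by (auto intro: multiplier.add poly_bounded_add)
next
  case (mult f g)
  then have "partial_deriv i (\<lambda>x. f x * g x) = (\<lambda>x. partial_deriv i f x * g x + f x * partial_deriv i g x)" for i
    by (auto simp: fun_eq_iff intro!: partial_deriv_mult)
  moreover have "(\<lambda>x. partial_deriv i f x * g x + f x * partial_deriv i g x) \<in> multiplier" for i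
    using mult by (intro multiplier.add multiplier.mult) auto
  ultimately show ?case using mult by (auto intro: poly_bounded_mult)
next
  case (symbol \<sigma> d f)
  obtain f' where f': "\<And>t. t \<ge> 0 \<Longrightarrow> (f has_real_derivative f' t) (at t within {0..})" "\<And>k. symb k 0 (d - 1) f'"
    using symb_derivative[OF symbol.hyps(3)] by blast
  have d: "\<exists>g'. ((\<lambda>x. complex_of_real (\<sigma> x)) has_derivative g') (at x)" for x
    using symbol.IH unfolding differentiable_def by blast
  have "(\<lambda>x. complex_of_real (f (\<sigma> x))) differentiable (at x)" for x
    using d[of x] has_derivative_symbol[where \<sigma>=\<sigma>, OF _ symbol.hyps(2) f'(1)] unfolding differentiable_def by blast
  moreover have "partial_deriv i (\<lambda>x. complex_of_real (f (\<sigma> x))) =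
      (\<lambda>x. complex_of_real (f' (\<sigma> x)) * partial_deriv i (\<lambda>x. complex_of_real (\<sigma> x)) x)" for i
  proof
    fix x
    obtain g' where g': "((\<lambda>x. complex_of_real (\<sigma> x)) has_derivative g') (at x)" using d by blast
    show "partial_deriv i (\<lambda>x. complex_of_real (f (\<sigma> x))) x =
      complex_of_real (f' (\<sigma> x)) * partial_deriv i (\<lambda>x. complex_of_real (\<sigma> x)) x"
      using partial_deriv_eqI[OF g', of i] partial_deriv_eqI[OF has_derivative_symbol[where \<sigma>=\<sigma>, OF g' symbol.hyps(2) f'(1)], of i]
      by simp
  qed
  moreover have "(\<lambda>x. complex_of_real (f' (\<sigma> x)) * partial_deriv i (\<lambda>x. complex_of_real (\<sigma> x)) x) \<in> multiplier" for i
    using symbol.IH multiplier.symbol[OF symbol.hyps(1,2) f'(2)] by (intro multiplier.mult) auto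
  moreover have "poly_bounded (\<lambda>x. complex_of_real (f (\<sigma> x)))"
    using order_bounded_imp_poly_bounded[where \<sigma>=\<sigma>, OF symb_order_bounded[OF symbol.hyps(3)] _ symbol.hyps(2)] symbol.IH by blast
  ultimately show ?case by simp
qed

text \<open>Sums of products, which is the closure of the products under partial derivatives by the product rule.\<close>

inductive_set multiplied :: "(real ^ 'n::finite \<Rightarrow> complex) set \<Rightarrow> (real ^ 'n \<Rightarrow> complex) set" for V where
  base: "\<sigma> \<in> multiplier \<Longrightarrow> \<phi> \<in> V \<Longrightarrow> (\<lambda>x. \<sigma> x * \<phi> x) \<in> multiplied V"
| add: "f \<in> multiplied V \<Longrightarrow> g \<in> multiplied V \<Longrightarrow> (\<lambda>x. f x + g x) \<in> multiplied V"

text \<open>The set of finite sums of products \<open>\<sigma> \<phi>\<close> is closed under partial derivatives.\<close>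

lemma schwartz_multiplier:
  assumes "\<sigma> \<in> multiplier" "\<phi> \<in> schwartz"
  shows "(\<lambda>x. \<sigma> x * \<phi> x) \<in> schwartz"
proof -
  have *: "(\<forall>x. g differentiable (at x)) \<and> rapid g \<and> (\<forall>i. partial_deriv i g \<in> multiplied schwartz)"
    if "g \<in> multiplied schwartz" for g :: "real ^ 'a \<Rightarrow> complex"
    using that
  proof induction
    case (base \<sigma> \<phi>)
    note m = multiplier_properties[OF base(1)]
    have "partial_deriv i (\<lambda>x. \<sigma> x * \<phi> x) = (\<lambda>x. partial_deriv i \<sigma> x * \<phi> x + \<sigma> x * partial_deriv i \<phi> x)" for i
      using m schwartz_differentiable[OF base(2)] by (auto simp: fun_eq_iff intro!: partial_deriv_mult)
    then show ?case
      using m base schwartz_differentiable[OF base(2)] schwartz_rapid[OF base(2)]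
      by (auto intro!: differentiable_mult rapid_mult multiplied.intros schwartz_partial_deriv)
  next
    case (add f g)
    then have "partial_deriv i (\<lambda>x. f x + g x) = (\<lambda>x. partial_deriv i f x + partial_deriv i g x)" for i
      by (auto simp: fun_eq_iff intro!: partial_deriv_add)
    then show ?case using add by (auto intro: multiplied.add rapid_add)
  qed
  show ?thesis
    by (rule schwartz_coinduct[of _ "multiplied schwartz"]) (use * assms in \<open>auto intro: multiplied.base\<close>)
qed

lemma multiplier_sum: "(\<And>i. i \<in> I \<Longrightarrow> f i \<in> multiplier) \<Longrightarrow> (\<lambda>x. \<Sum>i\<in>I. f i x) \<in> multiplier"
  by (induction I rule: infinite_finite_induct) (auto intro: multiplier.intros)

lemma multiplier_prod: "(\<And>i. i \<in> I \<Longrightarrow> f i \<in> multiplier) \<Longrightarrow> (\<lambda>x. \<Prod>i\<in>I. f i x) \<in> multiplier"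
  by (induction I rule: infinite_finite_induct) (auto intro: multiplier.intros)

lemma multiplier_norm_square:
  "(\<lambda>x::real^'n::finite. complex_of_real (c * (norm x)\<^sup>2)) \<in> multiplier"
proof -
  have "(\<lambda>x::real^'n. complex_of_real c * (\<Sum>i\<in>UNIV. complex_of_real (x $ i) * complex_of_real (x $ i))) \<in> multiplier"
    by (intro multiplier.intros multiplier_sum)
  moreover have "complex_of_real c * (\<Sum>i\<in>UNIV. complex_of_real (x $ i) * complex_of_real (x $ i)) = complex_of_real (c * (norm x)\<^sup>2)" for x :: "real ^ 'n"
    by (simp add: norm_eq_sqrt_inner inner_vec_def real_sqrt_pow2 sum_nonneg power2_norm_eq_inner flip: power2_eq_square)
  ultimately show ?thesis by simp
qed

lemma multiplier_radial:
  assumes "\<And>k. symb k 0 d f" "c \<ge> 0"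
  shows "(\<lambda>x::real^'n::finite. complex_of_real (f (c * (norm x)\<^sup>2))) \<in> multiplier"
  by (rule multiplier.symbol[OF multiplier_norm_square _ assms(1)]) (use assms(2) in auto)

section \<open>The Gaussian\<close>

lemma symb_exp_minus: "symb k 0 (- real j) (\<lambda>t. exp (- t))"
proof (induction k arbitrary: j)
  have ob: "order_bounded 0 (- real j) (\<lambda>t. exp (- t))" for j
    unfolding order_bounded_def
  proof (intro exI[of _ "fact j * exp 1"] allI impI)
    fix t :: real assume t: "t \<ge> 0"
    have "(1 + t) ^ j * exp (- (1 + t)) \<le> fact j" using t by (intro power_times_exp_minus_le) auto
    then have "(1 + t) ^ j * exp (- (1 + t)) * exp 1 \<le> fact j * exp 1" by (intro mult_right_mono) auto
    then have "(1 + t) ^ j * exp (- t) \<le> fact j * exp 1"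
      by (simp add: mult.assoc exp_add[symmetric])
    then show "\<bar>exp (- t)\<bar> \<le> fact j * exp 1 * (1 + t) powr (- real j)"
      using t by (simp add: powr_minus powr_realpow field_simps)
  qed
  {
    case 0 then show ?case using ob by simp
  next
    case (Suc k)
    have "symb k 0 (- real j - 1) (\<lambda>t. (-1) * exp (- t))"
    proof -
      have e: "- real j - 1 = - real (Suc j)" by simp
      show ?thesis unfolding e by (rule symb_cmult[OF Suc]) simp
    qed
    then show ?case
      by (rule symb_SucI[OF ob, rotated]) (auto intro!: derivative_eq_intros)
  }
qed

definition gauss :: "real ^ 'n::finite \<Rightarrow> complex" where
  "gauss x = complex_of_real (exp (- (pi * (norm x)\<^sup>2)))"

lemma rapid_gauss: "rapid gauss"
  unfolding rapid_def
proof
  fix N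
  have "(1 + norm x) ^ N * norm (gauss x) \<le> fact N * exp 2" for x :: "real ^ 'a"
  proof -
    define y where "y = norm x"
    have y: "y \<ge> 0" by (simp add: y_def)
    have "0 \<le> (y - 1)\<^sup>2 + y\<^sup>2 + 1" by simp
    then have "y - 1 \<le> 1 * y\<^sup>2" by (simp add: power2_eq_square algebra_simps)
    also have "\<dots> \<le> pi * y\<^sup>2" using pi_gt3 by (intro mult_right_mono) auto
    finally have "- (pi * y\<^sup>2) \<le> 2 + (- (1 + y))" by simp
    then have "exp (- (pi * y\<^sup>2)) \<le> exp 2 * exp (- (1 + y))" by (simp add: exp_add[symmetric])
    then have "(1 + y) ^ N * exp (- (pi * y\<^sup>2)) \<le> (1 + y) ^ N * (exp 2 * exp (- (1 + y)))"
      using y by (intro mult_left_mono) auto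
    also have "\<dots> = ((1 + y) ^ N * exp (- (1 + y))) * exp 2" by simp
    also have "\<dots> \<le> fact N * exp 2" using y by (intro mult_right_mono power_times_exp_minus_le) auto
    finally show ?thesis by (simp add: gauss_def y_def)
  qed
  then show "\<exists>C. \<forall>x::real^'a. (1 + norm x) ^ N * norm (gauss x) \<le> C" by blast
qed

lemma gauss_multiplier: "gauss \<in> multiplier"
  unfolding gauss_def[abs_def]
  using multiplier_radial[OF symb_exp_minus[of _ 0], of pi] by simp

lemma has_derivative_gauss:
  "(gauss has_derivative (\<lambda>h. complex_of_real (- 2 * pi * (x \<bullet> h)) * gauss x)) (at x)"
  unfolding gauss_def[abs_def] power2_norm_eq_inner
  by (auto intro!: derivative_eq_intros simp: inner_commute algebra_simps)

lemma partial_deriv_gauss: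
  "partial_deriv i gauss x = - 2 * complex_of_real pi * complex_of_real (x $ i) * gauss x"
  using partial_deriv_eqI[OF has_derivative_gauss, of i x] by (simp add: inner_axis)

text \<open>Each derivative of the Gaussian is a multiplier times the Gaussian.\<close>

lemma gauss_schwartz: "gauss \<in> schwartz"
proof (rule schwartz_coinduct[of _ "{\<lambda>x. q x * gauss x |q. q \<in> multiplier}"])
  show "gauss \<in> {\<lambda>x. q x * gauss x |q. q \<in> multiplier}"
    by (rule CollectI, rule exI[of _ "\<lambda>_. 1"]) (auto intro: multiplier.const)
  fix g :: "real ^ 'a \<Rightarrow> complex" and i assume "g \<in> {\<lambda>x. q x * gauss x |q. q \<in> multiplier}"
  then obtain q where q: "q \<in> multiplier" "g = (\<lambda>x. q x * gauss x)" by blast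
  note m = multiplier_properties[OF q(1)] and mg = multiplier_properties[OF gauss_multiplier]
  show "g differentiable (at x)" for x using m mg q by (auto intro: differentiable_mult)
  show "rapid g" using m q rapid_gauss by (auto intro: rapid_mult)
  have "partial_deriv i g = (\<lambda>x. (partial_deriv i q x + q x * (- 2 * complex_of_real pi * complex_of_real (x $ i))) * gauss x)"
  proof
    fix x
    have "partial_deriv i g x = partial_deriv i q x * gauss x + q x * partial_deriv i gauss x"
      unfolding q(2) using m mg by (intro partial_deriv_mult) auto
    then show "partial_deriv i g x = (partial_deriv i q x + q x * (- 2 * complex_of_real pi * complex_of_real (x $ i))) * gauss x"
      by (simp add: partial_deriv_gauss algebra_simps)
  qed
  moreover have "(\<lambda>x. partial_deriv i q x + q x * (- 2 * complex_of_real pi * complex_of_real (x $ i))) \<in> multiplier"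
    using m q by (intro multiplier.intros) auto
  ultimately show "partial_deriv i g \<in> {\<lambda>x. q x * gauss x |q. q \<in> multiplier}"
    by (intro CollectI exI[of _ "\<lambda>x. partial_deriv i q x + q x * (- 2 * complex_of_real pi * complex_of_real (x $ i))"]) simp
qed

lemma partial_derivs_vanish_on_open:
  assumes "open U" "\<And>x. x \<in> U \<Longrightarrow> g x = 0" "x \<in> U"
  shows "partial_derivs \<beta> g x = 0"
  using assms(3)
proof (induction \<beta> arbitrary: x)
  case Nil then show ?case using assms by simp
next
  case (Cons i \<beta>)
  have "((\<lambda>_. 0) has_derivative (\<lambda>_. 0)) (at x)" by simp
  then have "(partial_derivs \<beta> g has_derivative (\<lambda>_. 0)) (at x)"
    by (rule has_derivative_transform_within_open[OF _ assms(1) Cons.prems]) (simp add: Cons.IH)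
  from partial_deriv_eqI[OF this] show ?case by simp
qed

section \<open>Integration on Euclidean space\<close>

lemma measurable_cis [measurable]: "cis \<in> borel_measurable borel"
  by (intro borel_measurable_continuous_onI continuous_on_cis continuous_on_id)

lemma integral_lborel_affine:
  fixes f :: "'a::euclidean_space \<Rightarrow> 'b::{banach, second_countable_topology}"
  assumes [measurable]: "f \<in> borel_measurable borel" and c: "c \<noteq> 0"
  shows "(LINT x|lborel. f x) = \<bar>c\<bar> ^ DIM('a) *\<^sub>R (LINT x|lborel. f (t + c *\<^sub>R x))"
  by (subst lborel_affine[OF c, of t]) (simp add: integral_density integral_distr ennreal_power)

lemma nn_integral_lborel_affine:
  fixes f :: "'a::euclidean_space \<Rightarrow> ennreal"
  assumes [measurable]: "f \<in> borel_measurable borel" and c: "c \<noteq> 0"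
  shows "(\<integral>\<^sup>+x. f x \<partial>lborel) = ennreal (\<bar>c\<bar> ^ DIM('a)) * (\<integral>\<^sup>+x. f (t + c *\<^sub>R x) \<partial>lborel)"
  by (subst lborel_affine[OF c, of t]) (simp add: nn_integral_density nn_integral_distr nn_integral_cmult)

lemma integrable_lborel_affine:
  fixes f :: "'a::euclidean_space \<Rightarrow> 'b::{banach, second_countable_topology}"
  assumes f: "integrable lborel f" and c: "c \<noteq> 0"
  shows "integrable lborel (\<lambda>x. f (t + c *\<^sub>R x))"
proof (rule integrableI_bounded)
  have m[measurable]: "f \<in> borel_measurable borel" using f by auto
  show "(\<lambda>x. f (t + c *\<^sub>R x)) \<in> borel_measurable lborel" by measurable
  have "(\<integral>\<^sup>+x. norm (f x) \<partial>lborel) < \<infinity>" using f by (simp add: integrable_iff_bounded)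
  moreover have "(\<integral>\<^sup>+x. norm (f x) \<partial>lborel) = ennreal (\<bar>c\<bar> ^ DIM('a)) * (\<integral>\<^sup>+x. norm (f (t + c *\<^sub>R x)) \<partial>lborel)"
    by (rule nn_integral_lborel_affine) (use c in auto)
  ultimately show "(\<integral>\<^sup>+x. norm (f (t + c *\<^sub>R x)) \<partial>lborel) < \<infinity>"
    using c by (auto simp: ennreal_mult_less_top)
qed

lemma integral_lborel_translate:
  fixes f :: "'a::euclidean_space \<Rightarrow> 'b::{banach, second_countable_topology}"
  assumes "f \<in> borel_measurable borel"
  shows "(LINT x|lborel. f (t + x)) = (LINT x|lborel. f x)"
  using integral_lborel_affine[OF assms, of 1 t] by simp

lemma integral_lborel_reflect:
  fixes f :: "'a::euclidean_space \<Rightarrow> 'b::{banach, second_countable_topology}"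
  assumes "f \<in> borel_measurable borel"
  shows "(LINT x|lborel. f (t - x)) = (LINT x|lborel. f x)"
  using integral_lborel_affine[OF assms, of "-1" t] by simp

lemma integrable_lborel_reflect:
  fixes f :: "'a::euclidean_space \<Rightarrow> 'b::{banach, second_countable_topology}"
  assumes "integrable lborel f"
  shows "integrable lborel (\<lambda>x. f (t - x))"
  using integrable_lborel_affine[OF assms, of "-1" t] by simp

lemma integrable_pair_product:
  fixes f :: "'a::euclidean_space \<Rightarrow> 'c::{banach, second_countable_topology, real_normed_algebra}"
    and g :: "'b::euclidean_space \<Rightarrow> 'c"
  assumes f: "integrable lborel f" and g: "integrable lborel g"
  shows "integrable (lborel \<Otimes>\<^sub>M lborel) (\<lambda>(x, y). norm (f x) * norm (g y))"
proof (rule lborel_pair.Fubini_integrable)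
  have [measurable]: "f \<in> borel_measurable borel" "g \<in> borel_measurable borel" using f g by auto
  show "(\<lambda>(x, y). norm (f x) * norm (g y)) \<in> borel_measurable (lborel \<Otimes>\<^sub>M lborel)" by measurable
  show "integrable lborel (\<lambda>x. \<integral>y. norm (case (x, y) of (x, y) \<Rightarrow> norm (f x) * norm (g y)) \<partial>lborel)"
    using f g by (simp add: abs_mult)
  show "AE x in lborel. integrable lborel (\<lambda>y. case (x, y) of (x, y) \<Rightarrow> norm (f x) * norm (g y))"
    using g by simp
qed

text \<open>Fubini's theorem in the form used for the Fourier transform: oscillating factors are dominated by a product of
integrable functions of one variable each.\<close>

lemma Fubini_dominated:
  fixes F :: "'a::euclidean_space \<Rightarrow> 'b::euclidean_space \<Rightarrow> complex"
  assumes F: "case_prod F \<in> borel_measurable (borel \<Otimes>\<^sub>M borel)"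
    and f: "integrable lborel f" and g: "integrable lborel g"
    and le: "\<And>x y. norm (F x y) \<le> norm (f x :: complex) * norm (g y :: complex)"
  shows "integrable (lborel \<Otimes>\<^sub>M lborel) (case_prod F)"
    and "(LINT y|lborel. LINT x|lborel. F x y) = (LINT x|lborel. LINT y|lborel. F x y)"
proof -
  show i: "integrable (lborel \<Otimes>\<^sub>M lborel) (case_prod F)"
  proof (rule Bochner_Integration.integrable_bound[OF integrable_pair_product[OF f g]])
    show "case_prod F \<in> borel_measurable (lborel \<Otimes>\<^sub>M lborel)"
      using F by (simp cong: measurable_cong_sets add: sets_pair_measure_cong[OF sets_lborel sets_lborel])
  qed (use le in \<open>auto simp: abs_mult\<close>)
  show "(LINT y|lborel. LINT x|lborel. F x y) = (LINT x|lborel. LINT y|lborel. F x y)"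
    by (rule lborel_pair.Fubini_integral[OF i])
qed

section \<open>An integrable weight\<close>

text \<open>The weight \<open>\<Prod> 1/(1 + x\<^sub>i\<^sup>2)\<close> is integrable, bounded by 1, and comparable to its translates by bounded vectors. A
bound by it serves as the quantitative form of decay in all integrations.\<close>

definition weight :: "real ^ 'n::finite \<Rightarrow> real" where
  "weight x = (\<Prod>i\<in>UNIV. 1 / (1 + (x $ i)\<^sup>2))"

lemma prod_coordinates_Basis:
  fixes x :: "real ^ 'n::finite"
  shows "(\<Prod>i\<in>UNIV. g (x $ i)) = (\<Prod>b\<in>Basis. g (x \<bullet> b))"
proof -
  have B: "(Basis :: (real ^ 'n) set) = range (\<lambda>i. axis i 1)"
    by (auto simp: Basis_vec_def)
  have "inj (\<lambda>i::'n. axis i (1::real))" by (auto simp: inj_def axis_eq_axis)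
  then show ?thesis unfolding B by (subst prod.reindex) (auto simp: inner_axis)
qed

lemma nn_integral_coordinate_product:
  assumes [measurable]: "g \<in> borel_measurable borel"
  shows "(\<integral>\<^sup>+x. (\<Prod>i\<in>UNIV. g ((x :: real ^ 'n::finite) $ i)) \<partial>lborel) = (\<integral>\<^sup>+t. g t \<partial>lborel) ^ CARD('n)"
proof -
  have "(\<integral>\<^sup>+x. (\<Prod>i\<in>UNIV. g ((x :: real ^ 'n) $ i)) \<partial>lborel) = (\<Prod>b\<in>(Basis :: (real ^ 'n) set). \<integral>\<^sup>+t. g t \<partial>lborel)"
    unfolding prod_coordinates_Basis by (rule nn_integral_lborel_prod) auto
  then show ?thesis by (simp add: DIM_cart)
qed

lemma weight_pos: "0 < weight x"
  unfolding weight_def by (intro prod_pos) (auto simp: add_pos_nonneg)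

lemma weight_le_1: "weight x \<le> 1"
  unfolding weight_def by (rule prod_le_1) (auto simp: add_pos_nonneg)

lemma measurable_weight [measurable]: "weight \<in> borel_measurable borel"
  unfolding weight_def[abs_def] by measurable

lemma integrable_weight: "integrable lborel (weight :: real ^ 'n::finite \<Rightarrow> real)"
proof (rule integrableI_bounded)
  have "(\<integral>\<^sup>+x. ennreal (norm (weight (x :: real ^ 'n))) \<partial>lborel)
      = (\<integral>\<^sup>+x. (\<Prod>i\<in>UNIV. ennreal (1 / (1 + ((x :: real ^ 'n) $ i)\<^sup>2))) \<partial>lborel)"
    using weight_pos by (intro nn_integral_cong) (simp add: weight_def prod_ennreal abs_prod)
  also have "\<dots> = (\<integral>\<^sup>+t. ennreal (1 / (1 + t\<^sup>2)) \<partial>lborel) ^ CARD('n)"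
    by (rule nn_integral_coordinate_product) measurable
  also have "\<dots> < \<infinity>"
    using integrable_inverse_square by (simp add: integrable_iff_bounded power_less_top_ennreal)
  finally show "(\<integral>\<^sup>+x. ennreal (norm (weight (x :: real ^ 'n))) \<partial>lborel) < \<infinity>" .
qed simp

definition weighted :: "(real ^ 'n::finite \<Rightarrow> complex) \<Rightarrow> bool" where
  "weighted g \<longleftrightarrow> g \<in> borel_measurable borel \<and> (\<exists>C. \<forall>x. norm (g x) \<le> C * weight x)"

lemma weightedE:
  fixes g :: "real ^ 'n::finite \<Rightarrow> complex"
  assumes "weighted g"
  obtains C where "C \<ge> 0" "\<And>x. norm (g x) \<le> C * weight x"
proof -
  obtain C where C: "\<And>x. norm (g x) \<le> C * weight x" using assms unfolding weighted_def by blast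
  have "0 \<le> C * weight (0 :: real ^ 'n)" using order_trans[OF norm_ge_zero C[of 0]] .
  then have "C \<ge> 0" using weight_pos[of "0 :: real ^ 'n"] by (simp add: zero_le_mult_iff)
  with C show ?thesis using that by blast
qed

lemma weighted_measurable [measurable_dest]: "weighted g \<Longrightarrow> g \<in> borel_measurable borel"
  by (simp add: weighted_def)

lemma weighted_integrable: "weighted g \<Longrightarrow> integrable lborel g"
proof -
  assume g: "weighted g"
  then obtain C where C: "C \<ge> 0" "\<And>x. norm (g x) \<le> C * weight x" by (rule weightedE) blast
  show ?thesis
  proof (rule Bochner_Integration.integrable_bound)
    show "integrable lborel (\<lambda>x::real^'a. C * weight x)" by (intro integrable_mult_right integrable_weight)
    show "AE x in lborel. norm (g x) \<le> norm (C * weight x)"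
      using C by (intro AE_I2) (auto intro: order_trans[OF _ abs_ge_self])
  qed (use weighted_measurable[OF g] in simp)
qed

text \<open>This bound turns rapid decay into domination by the weight.\<close>

lemma weight_lower: "1 \<le> (1 + norm x) ^ (2 * CARD('n)) * weight (x :: real ^ 'n::finite)"
proof -
  have "(\<Prod>i\<in>(UNIV::'n set). 1 / (1 + norm x)\<^sup>2) \<le> weight x"
    unfolding weight_def
  proof (rule prod_mono)
    fix i :: 'n assume "i \<in> UNIV"
    have "(x $ i)\<^sup>2 \<le> (norm x)\<^sup>2" using component_le_norm_cart[of x i] by (rule abs_le_square_iff[THEN iffD1, OF order_trans]) simp
    then have "1 + (x $ i)\<^sup>2 \<le> (1 + norm x)\<^sup>2" by (simp add: power2_sum add_increasing2)
    moreover have "1 + (x $ i)\<^sup>2 > 0" "1 + norm x > 0" by (simp_all add: add_pos_nonneg)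
    ultimately show "0 \<le> 1 / (1 + norm x)\<^sup>2 \<and> 1 / (1 + norm x)\<^sup>2 \<le> 1 / (1 + (x $ i)\<^sup>2)"
      by (intro conjI divide_left_mono) auto
  qed
  then have w: "1 / (1 + norm x) ^ (2 * CARD('n)) \<le> weight x"
    by (simp add: power_mult power_divide)
  have "(1 + norm x) ^ (2 * CARD('n)) > 0" by (intro zero_less_power add_pos_nonneg) auto
  then show ?thesis using w by (simp add: field_simps)
qed

lemma rapid_weighted:
  assumes "rapid g" "g \<in> borel_measurable borel"
  shows "weighted g"
proof -
  obtain C where C: "C \<ge> 0" "\<And>x. (1 + norm x) ^ (2 * CARD('a)) * norm (g x) \<le> C"
    using rapid_nonneg[OF assms(1)] by metis
  have "norm (g x) \<le> C * weight x" for x :: "real ^ 'a"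
  proof -
    have "norm (g x) * 1 \<le> norm (g x) * ((1 + norm x) ^ (2 * CARD('a)) * weight x)"
      by (intro mult_left_mono weight_lower) auto
    also have "\<dots> = ((1 + norm x) ^ (2 * CARD('a)) * norm (g x)) * weight x" by simp
    also have "\<dots> \<le> C * weight x" using weight_pos[of x] by (intro mult_right_mono C) auto
    finally show ?thesis by simp
  qed
  then show ?thesis unfolding weighted_def using assms(2) by blast
qed

lemma schwartz_measurable: "\<phi> \<in> schwartz \<Longrightarrow> \<phi> \<in> borel_measurable borel"
  by (intro borel_measurable_continuous_onI schwartz_continuous_on)

lemma schwartz_weighted: "\<phi> \<in> schwartz \<Longrightarrow> weighted \<phi>"
  by (intro rapid_weighted schwartz_rapid schwartz_measurable)

lemma schwartz_integrable: "\<phi> \<in> schwartz \<Longrightarrow> integrable lborel \<phi>"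
  by (intro weighted_integrable schwartz_weighted)

lemma weight_shift:
  assumes "\<bar>t\<bar> \<le> 1"
  shows "weight (x + t *\<^sub>R axis i 1) \<le> 3 * weight x"
proof -
  define R where "R = (\<Prod>j\<in>UNIV - {i}. 1 / (1 + (x $ j)\<^sup>2))"
  have R: "R \<ge> 0" unfolding R_def by (intro prod_nonneg) auto
  have 1: "weight x = 1 / (1 + (x $ i)\<^sup>2) * R"
    unfolding weight_def R_def by (subst prod.remove[of _ i]) auto
  have 2: "weight (x + t *\<^sub>R axis i 1) = 1 / (1 + (x $ i + t)\<^sup>2) * R"
    unfolding weight_def R_def by (subst prod.remove[of _ i]) (auto simp: axis_def intro!: prod.cong)
  have "t\<^sup>2 \<le> 1" using assms by (simp add: abs_square_le_1)
  moreover have "0 \<le> (x $ i + 2 * t)\<^sup>2" by simp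
  ultimately have "(x $ i)\<^sup>2 \<le> 2 * (x $ i + t)\<^sup>2 + 2" by (simp add: power2_eq_square algebra_simps)
  then have "1 + (x $ i)\<^sup>2 \<le> 3 * (1 + (x $ i + t)\<^sup>2)"
    using zero_le_power2[of "x $ i + t"] by (simp only: distrib_left mult_1_right)
  then have "1 / (1 + (x $ i + t)\<^sup>2) \<le> 3 * (1 / (1 + (x $ i)\<^sup>2))"
    by (simp add: field_simps add_pos_nonneg)
  then have "1 / (1 + (x $ i + t)\<^sup>2) * R \<le> 3 * (1 / (1 + (x $ i)\<^sup>2)) * R"
    by (intro mult_right_mono R)
  then show ?thesis unfolding 1 2 by simp
qed

section \<open>The Fourier transform\<close>

text \<open>The Fourier transform for \<open>c = - 2 \<pi>\<close> and its inverse for \<open>c = 2 \<pi>\<close>, treated simultaneously.\<close>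

definition ft :: "real \<Rightarrow> (real ^ 'n::finite \<Rightarrow> complex) \<Rightarrow> (real ^ 'n \<Rightarrow> complex)" where
  "ft c \<phi> \<xi> = (LINT x|lborel. \<phi> x * cis (c * (x \<bullet> \<xi>)))"

lemma fourier_eq_ft:
  assumes [measurable]: "\<phi> \<in> borel_measurable borel"
  shows "fourier \<phi> = ft (- 2 * pi) \<phi>" "inv_fourier \<phi> = ft (2 * pi) \<phi>"
proof -
  have 1: "exp (- 2 * complex_of_real pi * \<i> * complex_of_real (x \<bullet> \<xi>)) = cis (- 2 * pi * (x \<bullet> \<xi>))"
    and 2: "exp (2 * complex_of_real pi * \<i> * complex_of_real (x \<bullet> \<xi>)) = cis (2 * pi * (\<xi> \<bullet> x))" for x \<xi> :: "real ^ 'n"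
    by (simp_all add: cis_conv_exp mult_ac inner_commute)
  show "fourier \<phi> = ft (- 2 * pi) \<phi>" "inv_fourier \<phi> = ft (2 * pi) \<phi>"
    unfolding fourier_def inv_fourier_def ft_def 1 2
    by (rule ext, rule integral_completion, measurable)+
qed

lemma integrable_times_cis:
  assumes "integrable lborel (f :: real ^ 'n::finite \<Rightarrow> complex)"
  shows "integrable lborel (\<lambda>x. f x * cis (c * (x \<bullet> \<xi>)))"
proof (rule Bochner_Integration.integrable_bound[OF assms])
  have [measurable]: "f \<in> borel_measurable borel" using assms by auto
  show "(\<lambda>x. f x * cis (c * (x \<bullet> \<xi>))) \<in> borel_measurable lborel" by measurable
qed (auto simp: norm_mult)

lemma norm_ft_le:
  assumes "integrable lborel f"
  shows "norm (ft c f \<xi>) \<le> (LINT x|lborel. norm (f x))"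
proof -
  have "norm (ft c f \<xi>) \<le> (LINT x|lborel. norm (f x * cis (c * (x \<bullet> \<xi>))))"
    unfolding ft_def by (rule integral_norm_bound)
  then show ?thesis by (simp add: norm_mult)
qed

lemma measurable_ft [measurable]:
  assumes [measurable]: "f \<in> borel_measurable borel"
  shows "ft c f \<in> borel_measurable borel"
proof -
  have "(\<lambda>\<xi>. LINT x|lborel. f x * cis (c * (x \<bullet> \<xi>))) \<in> borel_measurable borel"
    by measurable
  then show ?thesis unfolding ft_def[abs_def] .
qed

lemma ft_cmult: "ft c (\<lambda>x. a * f x) \<xi> = a * ft c f \<xi>"
  by (simp add: ft_def mult.assoc)

lemma ft_add:
  assumes "integrable lborel f" "integrable lborel g"
  shows "ft c (\<lambda>x. f x + g x) \<xi> = ft c f \<xi> + ft c g \<xi>"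
  unfolding ft_def ring_distribs
  by (rule Bochner_Integration.integral_add) (intro integrable_times_cis assms)+

lemma ft_translate:
  assumes [measurable]: "f \<in> borel_measurable borel"
  shows "ft c (\<lambda>x. f (a + x)) \<xi> = cis (- c * (a \<bullet> \<xi>)) * ft c f \<xi>"
proof -
  have "ft c f \<xi> = (LINT x|lborel. f (a + x) * cis (c * ((a + x) \<bullet> \<xi>)))"
    unfolding ft_def by (rule integral_lborel_translate[symmetric]) measurable
  also have "\<dots> = (LINT x|lborel. cis (c * (a \<bullet> \<xi>)) * (f (a + x) * cis (c * (x \<bullet> \<xi>))))"
    by (simp add: inner_add_left distrib_left cis_mult[symmetric] ac_simps)
  also have "\<dots> = cis (c * (a \<bullet> \<xi>)) * ft c (\<lambda>x. f (a + x)) \<xi>"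
    unfolding ft_def by simp
  finally show ?thesis by (simp add: mult.assoc[symmetric] cis_mult)
qed

lemma cis_difference_quotient:
  "((\<lambda>h. (cis (a * h) - 1) / complex_of_real h) \<longlongrightarrow> \<i> * complex_of_real a) (at 0)"
proof -
  have "((\<lambda>z. exp (\<i> * complex_of_real a * z)) has_field_derivative \<i> * complex_of_real a) (at 0)"
    by (auto intro!: derivative_eq_intros)
  then have 1: "((\<lambda>z. (exp (\<i> * complex_of_real a * z) - 1) / z) \<longlongrightarrow> \<i> * complex_of_real a) (at 0)"
    by (simp add: has_field_derivative_iff)
  have 2: "filterlim complex_of_real (at 0) (at 0)"
  proof -
    have "(complex_of_real \<longlongrightarrow> complex_of_real 0) (at 0)" by (intro tendsto_intros)
    then show ?thesis by (simp add: filterlim_at eventually_at_filter)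
  qed
  show ?thesis using filterlim_compose[OF 1 2] by (simp add: cis_conv_exp mult_ac)
qed

lemma norm_difference_along_axis:
  fixes g :: "real ^ 'n::finite \<Rightarrow> complex"
  assumes "\<And>x. g differentiable (at x)" "0 < h" "\<And>s. 0 < s \<Longrightarrow> s < h \<Longrightarrow> norm (partial_deriv i g (x + s *\<^sub>R axis i 1)) \<le> B"
  shows "norm (g (x + h *\<^sub>R axis i 1) - g x) \<le> h * B"
proof -
  have d: "((\<lambda>s. g (x + s *\<^sub>R axis i 1)) has_derivative (\<lambda>k. k *\<^sub>R partial_deriv i g (x + s *\<^sub>R axis i 1))) (at s)" for s
    using has_vector_derivative_partial_deriv[OF assms(1), of x i s] by (simp add: has_vector_derivative_def)
  have "\<exists>s\<in>{0<..<h}. norm (g (x + h *\<^sub>R axis i 1) - g (x + 0 *\<^sub>R axis i 1)) \<le> norm ((h - 0) *\<^sub>R partial_deriv i g (x + s *\<^sub>R axis i 1))"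
  proof (rule mvt_general[OF assms(2)])
    show "continuous_on {0..h} (\<lambda>s. g (x + s *\<^sub>R axis i 1))"
      using d by (intro continuous_at_imp_continuous_on ballI has_derivative_continuous)
  qed (rule d)
  then obtain s where s: "0 < s" "s < h" "norm (g (x + h *\<^sub>R axis i 1) - g x) \<le> h * norm (partial_deriv i g (x + s *\<^sub>R axis i 1))"
    using assms(2) by auto
  have "h * norm (partial_deriv i g (x + s *\<^sub>R axis i 1)) \<le> h * B"
    using assms(2) s by (intro mult_left_mono assms(3)) auto
  then show ?thesis using s(3) by simp
qed

text \<open>Integration by parts without boundary terms: difference quotients of \<open>g\<close> turn into multiplication by
\<open>(cis (- c h \<xi>\<^sub>i) - 1)/h\<close> by translation invariance of the integral, and they converge dominatedly because the
weight controls its translates.\<close>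

lemma ft_partial_deriv:
  fixes g :: "real ^ 'n::finite \<Rightarrow> complex"
  assumes g: "weighted g" and dg: "weighted (partial_deriv i g)" and diff: "\<And>x. g differentiable (at x)"
  shows "ft c (partial_deriv i g) \<xi> = - \<i> * complex_of_real (c * \<xi> $ i) * ft c g \<xi>"
proof -
  obtain C where C: "C \<ge> 0" "\<And>x. norm (partial_deriv i g x) \<le> C * weight x" using weightedE[OF dg] by blast
  have [measurable]: "g \<in> borel_measurable borel" "partial_deriv i g \<in> borel_measurable borel"
    using g dg by (auto simp: weighted_def)
  define h :: "nat \<Rightarrow> real" where "h k = 1 / real (Suc k)" for k
  have h: "0 < h k" "h k \<le> 1" for k by (auto simp: h_def)
  have h0: "filterlim h (at 0) sequentially"
    unfolding filterlim_at using h(1) LIMSEQ_inverse_real_of_nat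
    by (auto simp: h_def[abs_def] inverse_eq_divide intro!: always_eventually)
  define D where "D k x = (g (h k *\<^sub>R axis i 1 + x) - g x) / complex_of_real (h k)" for k x
  have "(\<lambda>k. ft c (D k) \<xi>) \<longlonglongrightarrow> ft c (partial_deriv i g) \<xi>"
    unfolding ft_def
  proof (rule integral_dominated_convergence[where w = "\<lambda>x. (3 * C) * weight x"])
    show "integrable lborel (\<lambda>x. 3 * C * weight x :: real)" by (intro integrable_mult_right integrable_weight)
    show "AE x in lborel. (\<lambda>k. D k x * cis (c * (x \<bullet> \<xi>))) \<longlonglongrightarrow> partial_deriv i g x * cis (c * (x \<bullet> \<xi>))"
    proof (intro AE_I2 tendsto_mult tendsto_const)
      fix x
      have "((\<lambda>s. g (x + s *\<^sub>R axis i 1)) has_vector_derivative partial_deriv i g x) (at 0)"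
        using has_vector_derivative_partial_deriv[OF diff, of x i 0] by simp
      then have "((\<lambda>s. g (x + s *\<^sub>R axis i 1)) has_derivative (\<lambda>s. s *\<^sub>R partial_deriv i g x)) (at 0)"
        by (simp add: has_vector_derivative_def)
      then have "((\<lambda>s. norm (g (x + s *\<^sub>R axis i 1) - g x - s *\<^sub>R partial_deriv i g x) / \<bar>s\<bar>) \<longlongrightarrow> 0) (at 0)"
        by (simp add: has_derivative_at)
      then have "((\<lambda>s. norm ((g (x + s *\<^sub>R axis i 1) - g x) / complex_of_real s - partial_deriv i g x)) \<longlongrightarrow> 0) (at 0)"
      proof (rule Lim_transform_eventually)
        show "\<forall>\<^sub>F s in at 0. norm (g (x + s *\<^sub>R axis i 1) - g x - s *\<^sub>R partial_deriv i g x) / \<bar>s\<bar> =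
           norm ((g (x + s *\<^sub>R axis i 1) - g x) / complex_of_real s - partial_deriv i g x)"
          unfolding eventually_at_filter
        proof (intro always_eventually allI impI)
          fix s :: real assume s: "s \<noteq> 0"
          then have "(g (x + s *\<^sub>R axis i 1) - g x) / complex_of_real s - partial_deriv i g x
             = (g (x + s *\<^sub>R axis i 1) - g x - s *\<^sub>R partial_deriv i g x) / complex_of_real s"
            by (simp add: scaleR_conv_of_real field_simps)
          then show "norm (g (x + s *\<^sub>R axis i 1) - g x - s *\<^sub>R partial_deriv i g x) / \<bar>s\<bar> =
           norm ((g (x + s *\<^sub>R axis i 1) - g x) / complex_of_real s - partial_deriv i g x)"
            by (simp add: norm_divide)
        qed
      qed
      then have "((\<lambda>s. (g (x + s *\<^sub>R axis i 1) - g x) / complex_of_real s) \<longlongrightarrow> partial_deriv i g x) (at 0)"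
        by (simp add: tendsto_norm_zero_iff LIM_zero_iff)
      from filterlim_compose[OF this h0] show "(\<lambda>k. D k x) \<longlonglongrightarrow> partial_deriv i g x"
        unfolding D_def by (simp add: add.commute)
    qed
    show "AE x in lborel. norm (D k x * cis (c * (x \<bullet> \<xi>))) \<le> 3 * C * weight x" for k
    proof (rule AE_I2)
      fix x
      have "norm (g (x + h k *\<^sub>R axis i 1) - g x) \<le> h k * (C * (3 * weight x))"
      proof (rule norm_difference_along_axis[OF diff h(1)])
        fix s assume "0 < s" "s < h k"
        then have "\<bar>s\<bar> \<le> 1" using h(2)[of k] by simp
        then have "C * weight (x + s *\<^sub>R axis i 1) \<le> C * (3 * weight x)"
          by (intro mult_left_mono weight_shift C)
        then show "norm (partial_deriv i g (x + s *\<^sub>R axis i 1)) \<le> C * (3 * weight x)"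
          using C(2) order_trans by blast
      qed
      then show "norm (D k x * cis (c * (x \<bullet> \<xi>))) \<le> 3 * C * weight x"
        using h(1)[of k] unfolding D_def norm_mult norm_divide norm_cis
        by (simp add: add.commute divide_le_eq ac_simps)
    qed
  qed (unfold D_def, measurable)
  moreover have "(\<lambda>k. ft c (D k) \<xi>) \<longlonglongrightarrow> \<i> * complex_of_real (- c * \<xi> $ i) * ft c g \<xi>"
  proof -
    have gi: "integrable lborel g" by (rule weighted_integrable[OF g])
    have "ft c (D k) \<xi> = (cis (- c * \<xi> $ i * h k) - 1) / complex_of_real (h k) * ft c g \<xi>" for k
    proof -
      have gi': "integrable lborel (\<lambda>x. g (h k *\<^sub>R axis i 1 + x))"
        using integrable_lborel_affine[OF gi, of 1 "h k *\<^sub>R axis i 1"] by simp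
      have "ft c (D k) \<xi> = ft c (\<lambda>x. (1 / complex_of_real (h k)) * (g (h k *\<^sub>R axis i 1 + x) + (- 1) * g x)) \<xi>"
        by (simp add: D_def[abs_def] divide_inverse ac_simps)
      also have "\<dots> = (1 / complex_of_real (h k)) * (ft c (\<lambda>x. g (h k *\<^sub>R axis i 1 + x)) \<xi> + (- 1) * ft c g \<xi>)"
        unfolding ft_cmult by (subst ft_add) (use gi gi' in \<open>auto simp: ft_cmult[of c "-1", simplified]\<close>)
      also have "ft c (\<lambda>x. g (h k *\<^sub>R axis i 1 + x)) \<xi> = cis (- c * \<xi> $ i * h k) * ft c g \<xi>"
        by (subst ft_translate) (auto simp: inner_axis' ac_simps)
      finally show ?thesis by (simp add: field_simps)
    qed
    then show ?thesis
      using tendsto_mult_right[OF filterlim_compose[OF cis_difference_quotient[of "- c * \<xi> $ i"] h0], of "ft c g \<xi>"]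
      by simp
  qed
  ultimately show ?thesis using LIMSEQ_unique by fastforce
qed

lemma norm_cis_second_order: "norm (cis (a + b) - cis a - \<i> * complex_of_real b * cis a) \<le> b\<^sup>2"
proof -
  have "norm (cis b - (1 + \<i> * complex_of_real b)) \<le> b\<^sup>2 / 2"
    using iexp_approx1[of b 1] by (simp add: cis_conv_exp power2_eq_square)
  then have "norm (cis a * (cis b - (1 + \<i> * complex_of_real b))) \<le> b\<^sup>2"
    by (simp add: norm_mult) (smt (verit) field_sum_of_halves zero_le_power2)
  moreover have "cis a * (cis b - (1 + \<i> * complex_of_real b)) = cis (a + b) - cis a - \<i> * complex_of_real b * cis a"
    by (simp add: cis_mult[symmetric] algebra_simps)
  ultimately show ?thesis by simp
qed

text \<open>The second-order remainder of the character is bounded by \<open>c\<^sup>2 |x|\<^sup>2 |k|\<^sup>2\<close>, uniformly in the frequency, and the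
second moment of \<open>g\<close> is finite; so the remainder of the transform is quadratic in the increment.\<close>

lemma has_derivative_ft:
  fixes g :: "real ^ 'n::finite \<Rightarrow> complex"
  assumes g: "\<And>p. p \<in> multiplier \<Longrightarrow> weighted (\<lambda>x. p x * g x)"
  shows "(ft c g has_derivative (\<lambda>k. \<Sum>i\<in>UNIV. complex_of_real (k $ i) * ft c (\<lambda>x. \<i> * complex_of_real (c * x $ i) * g x) \<xi>)) (at \<xi>)"
proof -
  have gi: "integrable lborel (\<lambda>x. p x * g x)" if "p \<in> multiplier" for p
    by (rule weighted_integrable[OF g[OF that]])
  have g0: "integrable lborel g" using gi[OF multiplier.const[of 1]] by simp
  have g1: "integrable lborel (\<lambda>x. \<i> * complex_of_real (c * x $ i) * g x)" for i
  proof -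
    have "(\<lambda>x. (\<i> * complex_of_real c) * complex_of_real (x $ i)) \<in> multiplier"
      by (intro multiplier.intros)
    from gi[OF this] show ?thesis by (simp add: mult.assoc)
  qed
  have g2: "integrable lborel (\<lambda>x. (norm x)\<^sup>2 * norm (g x))"
    using integrable_norm[OF gi[OF multiplier_norm_square[of 1]]] by (simp add: norm_mult norm_power)
  define K where "K = c\<^sup>2 * (LINT x|lborel. (norm x)\<^sup>2 * norm (g x))"
  define L where "L k = (\<Sum>i\<in>UNIV. complex_of_real (k $ i) * ft c (\<lambda>x. \<i> * complex_of_real (c * x $ i) * g x) \<xi>)" for k :: "real ^ 'n"
  have L: "L k = (LINT x|lborel. \<i> * complex_of_real (c * (x \<bullet> k)) * g x * cis (c * (x \<bullet> \<xi>)))" for k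
  proof -
    have "L k = (LINT x|lborel. (\<Sum>i\<in>UNIV. complex_of_real (k $ i) * (\<i> * complex_of_real (c * x $ i) * g x * cis (c * (x \<bullet> \<xi>)))))"
      unfolding L_def ft_def
      by (subst Bochner_Integration.integral_sum)
        (rule integrable_mult_right, rule integrable_times_cis, rule g1, simp)
    also have "(\<lambda>x. \<Sum>i\<in>UNIV. complex_of_real (k $ i) * (\<i> * complex_of_real (c * x $ i) * g x * cis (c * (x \<bullet> \<xi>))))
       = (\<lambda>x. \<i> * complex_of_real (c * (x \<bullet> k)) * g x * cis (c * (x \<bullet> \<xi>)))"
      by (auto simp: inner_vec_def sum_distrib_left sum_distrib_right ac_simps intro!: sum.cong)
    finally show ?thesis .
  qed
  have Li: "integrable lborel (\<lambda>x. \<i> * complex_of_real (c * (x \<bullet> k)) * g x)" for k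
  proof -
    have "integrable lborel (\<lambda>x. \<Sum>i\<in>UNIV. complex_of_real (k $ i) * (\<i> * complex_of_real (c * x $ i) * g x))"
      by (intro Bochner_Integration.integrable_sum integrable_mult_right g1)
    also have "(\<lambda>x. \<Sum>i\<in>UNIV. complex_of_real (k $ i) * (\<i> * complex_of_real (c * x $ i) * g x))
       = (\<lambda>x. \<i> * complex_of_real (c * (x \<bullet> k)) * g x)"
      by (auto simp: inner_vec_def sum_distrib_left sum_distrib_right ac_simps intro!: sum.cong)
    finally show ?thesis .
  qed
  have R: "norm (ft c g (\<xi> + k) - ft c g \<xi> - L k) \<le> K * (norm k)\<^sup>2" for k
  proof -
    have "ft c g (\<xi> + k) - ft c g \<xi> - L k = (LINT x|lborel. g x * cis (c * (x \<bullet> (\<xi> + k))) - g x * cis (c * (x \<bullet> \<xi>))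
        - \<i> * complex_of_real (c * (x \<bullet> k)) * g x * cis (c * (x \<bullet> \<xi>)))"
      unfolding L ft_def using integrable_times_cis[OF g0] integrable_times_cis[OF Li]
      by simp
    also have "norm \<dots> \<le> (LINT x|lborel. c\<^sup>2 * (norm k)\<^sup>2 * ((norm x)\<^sup>2 * norm (g x)))"
    proof (rule order_trans[OF integral_norm_bound integral_mono])
      show "integrable lborel (\<lambda>x. norm (g x * cis (c * (x \<bullet> (\<xi> + k))) - g x * cis (c * (x \<bullet> \<xi>))
        - \<i> * complex_of_real (c * (x \<bullet> k)) * g x * cis (c * (x \<bullet> \<xi>))))"
        by (intro integrable_norm Bochner_Integration.integrable_diff integrable_times_cis g0 Li)
      show "integrable lborel (\<lambda>x. c\<^sup>2 * (norm k)\<^sup>2 * ((norm x)\<^sup>2 * norm (g x)))" by (intro integrable_mult_right g2)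
      fix x
      have e: "g x * cis (c * (x \<bullet> (\<xi> + k))) - g x * cis (c * (x \<bullet> \<xi>)) - \<i> * complex_of_real (c * (x \<bullet> k)) * g x * cis (c * (x \<bullet> \<xi>))
        = g x * (cis (c * (x \<bullet> \<xi>) + c * (x \<bullet> k)) - cis (c * (x \<bullet> \<xi>)) - \<i> * complex_of_real (c * (x \<bullet> k)) * cis (c * (x \<bullet> \<xi>)))"
        by (simp add: inner_add_right algebra_simps)
      have "(c * (x \<bullet> k))\<^sup>2 \<le> c\<^sup>2 * ((norm x)\<^sup>2 * (norm k)\<^sup>2)"
        using Cauchy_Schwarz_ineq[of x k] by (simp add: power_mult_distrib power2_norm_eq_inner mult_left_mono)
      then have "norm (g x) * norm (cis (c * (x \<bullet> \<xi>) + c * (x \<bullet> k)) - cis (c * (x \<bullet> \<xi>)) - \<i> * complex_of_real (c * (x \<bullet> k)) * cis (c * (x \<bullet> \<xi>)))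
          \<le> norm (g x) * (c\<^sup>2 * ((norm x)\<^sup>2 * (norm k)\<^sup>2))"
        by (intro mult_left_mono order_trans[OF norm_cis_second_order]) auto
      then show "norm (g x * cis (c * (x \<bullet> (\<xi> + k))) - g x * cis (c * (x \<bullet> \<xi>))
        - \<i> * complex_of_real (c * (x \<bullet> k)) * g x * cis (c * (x \<bullet> \<xi>))) \<le> c\<^sup>2 * (norm k)\<^sup>2 * ((norm x)\<^sup>2 * norm (g x))"
        unfolding e norm_mult by (simp add: ac_simps)
    qed
    also have "\<dots> = K * (norm k)\<^sup>2" by (simp add: K_def)
    finally show ?thesis .
  qed
  have "bounded_linear L"
    unfolding L_def[abs_def]
    by (intro bounded_linear_sum bounded_linear_compose[OF bounded_linear_mult_left]
        bounded_linear_compose[OF bounded_linear_of_real bounded_linear_vec_nth])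
  moreover have "(\<lambda>k. norm (ft c g (\<xi> + k) - ft c g \<xi> - L k) / norm k) \<midarrow>0\<rightarrow> 0"
  proof (rule Lim_null_comparison)
    show "\<forall>\<^sub>F k in at 0. norm (norm (ft c g (\<xi> + k) - ft c g \<xi> - L k) / norm k) \<le> K * norm k"
      unfolding eventually_at_filter
    proof (intro always_eventually allI impI)
      fix k :: "real ^ 'n" assume "k \<noteq> 0"
      then show "norm (norm (ft c g (\<xi> + k) - ft c g \<xi> - L k) / norm k) \<le> K * norm k"
        using R[of k] by (simp add: divide_simps power2_eq_square mult.assoc)
    qed
    show "((\<lambda>k. K * norm k) \<longlongrightarrow> 0) (at 0)"
      by (intro tendsto_mult_right_zero tendsto_norm_zero tendsto_ident_at)
  qed
  ultimately show ?thesis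
    unfolding has_derivative_at L_def[abs_def, symmetric] by blast
qed

lemma has_derivative_ft_schwartz:
  assumes "\<phi> \<in> schwartz"
  shows "(ft c \<phi> has_derivative (\<lambda>k. \<Sum>i\<in>UNIV. complex_of_real (k $ i) * ft c (\<lambda>x. \<i> * complex_of_real (c * x $ i) * \<phi> x) \<xi>)) (at \<xi>)"
  by (intro has_derivative_ft schwartz_weighted schwartz_multiplier assms)

lemma coordinate_multiplier: "(\<lambda>x. \<i> * complex_of_real (c * x $ i)) \<in> multiplier"
proof -
  have "(\<lambda>x. (\<i> * complex_of_real c) * complex_of_real (x $ i)) \<in> multiplier"
    by (intro multiplier.intros)
  then show ?thesis by (simp add: mult.assoc)
qed

lemma partial_deriv_ft:
  assumes "\<phi> \<in> schwartz"
  shows "partial_deriv i (ft c \<phi>) = ft c (\<lambda>x. \<i> * complex_of_real (c * x $ i) * \<phi> x)"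
proof
  fix \<xi> :: "real ^ 'a"
  have "partial_deriv i (ft c \<phi>) \<xi> = (\<Sum>j\<in>UNIV. complex_of_real (axis i 1 $ j) * ft c (\<lambda>x. \<i> * complex_of_real (c * x $ j) * \<phi> x) \<xi>)"
    by (rule partial_deriv_eqI[OF has_derivative_ft_schwartz[OF assms]])
  also have "\<dots> = (\<Sum>j\<in>{i}. complex_of_real (axis i 1 $ j) * ft c (\<lambda>x. \<i> * complex_of_real (c * x $ j) * \<phi> x) \<xi>)"
    by (rule sum.mono_neutral_right) (auto simp: axis_def)
  finally show "partial_deriv i (ft c \<phi>) \<xi> = ft c (\<lambda>x. \<i> * complex_of_real (c * x $ i) * \<phi> x) \<xi>"
    by (simp add: axis_def)
qed

lemma ft_partial_deriv_schwartz:
  assumes "\<phi> \<in> schwartz"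
  shows "ft c (partial_deriv i \<phi>) \<xi> = - \<i> * complex_of_real (c * \<xi> $ i) * ft c \<phi> \<xi>"
  by (intro ft_partial_deriv schwartz_weighted schwartz_partial_deriv schwartz_differentiable assms)

text \<open>Powers of the frequency are transforms of derivatives.\<close>

lemma coordinate_power_times_ft:
  assumes "c \<noteq> 0" "\<phi> \<in> schwartz"
  shows "\<exists>\<psi>\<in>schwartz. \<forall>\<xi>. complex_of_real (\<xi> $ i) ^ N * ft c \<phi> \<xi> = ft c \<psi> \<xi>"
proof (induction N)
  case 0 then show ?case using assms by auto
next
  case (Suc N)
  then obtain \<psi> where \<psi>: "\<psi> \<in> schwartz" "\<And>\<xi>. complex_of_real (\<xi> $ i) ^ N * ft c \<phi> \<xi> = ft c \<psi> \<xi>" by blast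
  define a where "a = \<i> / complex_of_real c"
  have a: "a * (- \<i> * complex_of_real (c * t)) = complex_of_real t" for t
    using assms(1) by (simp add: a_def)
  have "complex_of_real (\<xi> $ i) ^ Suc N * ft c \<phi> \<xi> = ft c (\<lambda>x. a * partial_deriv i \<psi> x) \<xi>" for \<xi>
  proof -
    have "complex_of_real (\<xi> $ i) ^ Suc N * ft c \<phi> \<xi> = complex_of_real (\<xi> $ i) * (complex_of_real (\<xi> $ i) ^ N * ft c \<phi> \<xi>)"
      by (simp only: power_Suc mult.assoc)
    also have "\<dots> = complex_of_real (\<xi> $ i) * ft c \<psi> \<xi>" unfolding \<psi>(2) ..
    also have "\<dots> = a * ft c (partial_deriv i \<psi>) \<xi>"
      unfolding ft_partial_deriv_schwartz[OF \<psi>(1)] a[of "\<xi> $ i", symmetric] by (simp only: mult.assoc)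
    finally show ?thesis by (simp only: ft_cmult)
  qed
  moreover have "(\<lambda>x. a * partial_deriv i \<psi> x) \<in> schwartz"
    by (intro schwartz_multiplier multiplier.const schwartz_partial_deriv \<psi>(1))
  ultimately show ?case by blast
qed

lemma ft_schwartz:
  assumes "c \<noteq> 0" "\<phi> \<in> schwartz"
  shows "ft c \<phi> \<in> schwartz"
proof (rule schwartz_coinduct[of _ "ft c ` schwartz"])
  fix g :: "real ^ 'a \<Rightarrow> complex" assume "g \<in> ft c ` schwartz"
  then obtain \<phi> where \<phi>: "\<phi> \<in> schwartz" "g = ft c \<phi>" by blast
  show "g differentiable (at x)" for x
    unfolding differentiable_def \<phi>(2) using has_derivative_ft_schwartz[OF \<phi>(1)] by blast
  show "partial_deriv i g \<in> ft c ` schwartz" for i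
    unfolding \<phi>(2) partial_deriv_ft[OF \<phi>(1)]
    by (intro imageI schwartz_multiplier coordinate_multiplier \<phi>(1))
  show "rapid g"
  proof (rule rapidI)
    fix N i
    obtain \<psi> where \<psi>: "\<psi> \<in> schwartz" "\<And>\<xi>. complex_of_real (\<xi> $ i) ^ N * g \<xi> = ft c \<psi> \<xi>"
      using coordinate_power_times_ft[OF assms(1) \<phi>(1)] unfolding \<phi>(2) by blast
    have "\<bar>\<xi> $ i\<bar> ^ N * norm (g \<xi>) \<le> (LINT x|lborel. norm (\<psi> x))" for \<xi>
    proof -
      have "\<bar>\<xi> $ i\<bar> ^ N * norm (g \<xi>) = norm (complex_of_real (\<xi> $ i) ^ N * g \<xi>)"
        by (simp add: norm_mult norm_power)
      also have "\<dots> \<le> (LINT x|lborel. norm (\<psi> x))"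
        unfolding \<psi>(2) by (intro norm_ft_le schwartz_integrable \<psi>(1))
      finally show ?thesis .
    qed
    then show "\<exists>C. \<forall>\<xi>. \<bar>\<xi> $ i\<bar> ^ N * norm (g \<xi>) \<le> C" by blast
  qed
qed (use assms in auto)

text \<open>Multiplication on the Fourier side is convolution with the transform of the multiplier. In this form it is Fubini's
theorem and does not presuppose Fourier inversion.\<close>

lemma ft_mult_ft:
  fixes h \<phi> :: "real ^ 'n::finite \<Rightarrow> complex"
  assumes h: "integrable lborel h" and \<phi>: "integrable lborel \<phi>"
  shows "ft (- c) (\<lambda>\<xi>. h \<xi> * ft c \<phi> \<xi>) x = (LINT y|lborel. ft (- c) h (x - y) * \<phi> y)"
proof -
  have [measurable]: "h \<in> borel_measurable borel" "\<phi> \<in> borel_measurable borel" using h \<phi> by auto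
  have "ft (- c) (\<lambda>\<xi>. h \<xi> * ft c \<phi> \<xi>) x = (LINT \<xi>|lborel. LINT y|lborel. h \<xi> * (\<phi> y * cis (c * (y \<bullet> \<xi>))) * cis (- c * (\<xi> \<bullet> x)))"
    by (simp add: ft_def)
  also have "\<dots> = (LINT y|lborel. LINT \<xi>|lborel. h \<xi> * (\<phi> y * cis (c * (y \<bullet> \<xi>))) * cis (- c * (\<xi> \<bullet> x)))"
    by (rule Fubini_dominated(2)[OF _ h \<phi>, symmetric]) (auto simp: norm_mult)
  also have "\<dots> = (LINT y|lborel. ft (- c) h (x - y) * \<phi> y)"
  proof (intro Bochner_Integration.integral_cong refl)
    fix y
    have e: "h \<xi> * (\<phi> y * cis (c * (y \<bullet> \<xi>))) * cis (- c * (\<xi> \<bullet> x)) = \<phi> y * (h \<xi> * cis (- c * (\<xi> \<bullet> (x - y))))" for \<xi>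
    proof -
      have "cis (- c * (\<xi> \<bullet> (x - y))) = cis (c * (y \<bullet> \<xi>)) * cis (- c * (\<xi> \<bullet> x))"
        unfolding cis_mult by (simp add: inner_diff_right inner_commute algebra_simps)
      then show ?thesis by (simp only: mult_ac)
    qed
    show "(LINT \<xi>|lborel. h \<xi> * (\<phi> y * cis (c * (y \<bullet> \<xi>))) * cis (- c * (\<xi> \<bullet> x))) = ft (- c) h (x - y) * \<phi> y"
      unfolding e ft_def by simp
  qed
  finally show ?thesis .
qed

section \<open>Fourier inversion\<close>

lemma integral_gauss: "(LINT x|lborel. gauss (x :: real ^ 'n::finite)) = 1"
proof -
  have n: "normal_density 0 (1 / sqrt (2 * pi)) t = exp (- (pi * t\<^sup>2))" for t
    by (simp add: normal_density_def power_divide real_sqrt_divide)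
  have "(\<integral>\<^sup>+x. ennreal (exp (- (pi * (norm (x :: real ^ 'n))\<^sup>2))) \<partial>lborel)
      = (\<integral>\<^sup>+x. (\<Prod>i\<in>UNIV. ennreal (exp (- (pi * ((x :: real ^ 'n) $ i)\<^sup>2)))) \<partial>lborel)"
  proof (intro nn_integral_cong)
    fix x :: "real ^ 'n"
    have "(norm x)\<^sup>2 = (\<Sum>i\<in>UNIV. (x $ i)\<^sup>2)"
      unfolding power2_norm_eq_inner inner_vec_def by (simp add: power2_eq_square)
    then show "ennreal (exp (- (pi * (norm x)\<^sup>2))) = (\<Prod>i\<in>UNIV. ennreal (exp (- (pi * (x $ i)\<^sup>2))))"
      by (simp add: prod_ennreal exp_sum[symmetric] sum_distrib_left sum_negf)
  qed
  also have "\<dots> = (\<integral>\<^sup>+t. ennreal (exp (- (pi * t\<^sup>2))) \<partial>lborel) ^ CARD('n)"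
    by (rule nn_integral_coordinate_product) measurable
  also have "(\<integral>\<^sup>+t. ennreal (exp (- (pi * t\<^sup>2))) \<partial>lborel) = ennreal (LINT t|lborel. normal_density 0 (1 / sqrt (2 * pi)) t)"
    unfolding n[symmetric] by (intro nn_integral_eq_integral) (auto simp: normal_density_nonneg)
  finally have "(\<integral>\<^sup>+x. ennreal (exp (- (pi * (norm (x :: real ^ 'n))\<^sup>2))) \<partial>lborel) = 1" by simp
  then have "(LINT x|lborel. exp (- (pi * (norm (x :: real ^ 'n))\<^sup>2))) = 1"
    by (subst integral_eq_nn_integral) auto
  then show ?thesis unfolding gauss_def by (simp del: of_real_exp)
qed

text \<open>The transform of the Gaussian satisfies the differential equation of the Gaussian, hence the quotient of the two is
constant; its value at the origin is the integral of the Gaussian.\<close>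

lemma ft_gauss:
  fixes \<xi> :: "real ^ 'n::finite"
  assumes c: "c\<^sup>2 = (2 * pi)\<^sup>2"
  shows "ft c gauss \<xi> = gauss \<xi>"
proof -
  define q :: "real ^ 'n \<Rightarrow> complex" where "q = (\<lambda>\<xi>. ft c gauss \<xi> * complex_of_real (exp (pi * (\<xi> \<bullet> \<xi>))))"
  have c2: "complex_of_real c * complex_of_real c = 4 * complex_of_real pi * complex_of_real pi"
    using arg_cong[OF c, of complex_of_real] by (simp add: power2_eq_square)
  have d: "ft c (\<lambda>x. \<i> * complex_of_real (c * x $ i) * gauss x) \<xi> = - 2 * complex_of_real pi * complex_of_real (\<xi> $ i) * ft c gauss \<xi>"
    for \<xi> :: "real ^ 'n" and i
  proof -
    have e: "(\<lambda>x :: real ^ 'n. \<i> * complex_of_real (c * x $ i) * gauss x)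
       = (\<lambda>x. (- \<i> * complex_of_real c / (2 * complex_of_real pi)) * partial_deriv i gauss x)"
      by (simp add: partial_deriv_gauss fun_eq_iff)
    have "ft c (\<lambda>x. \<i> * complex_of_real (c * x $ i) * gauss x) \<xi>
       = (- \<i> * complex_of_real c / (2 * complex_of_real pi)) * (- \<i> * complex_of_real (c * \<xi> $ i) * ft c gauss \<xi>)"
      unfolding e ft_cmult ft_partial_deriv_schwartz[OF gauss_schwartz] ..
    also have "\<dots> = - ((complex_of_real c * complex_of_real c) / (2 * complex_of_real pi)) * complex_of_real (\<xi> $ i) * ft c gauss \<xi>"
      by (simp add: field_simps)
    finally show ?thesis unfolding c2 by simp
  qed
  have "(q has_derivative (\<lambda>k. 0)) (at \<xi>)" for \<xi>
  proof -
    have 1: "(\<Sum>i\<in>UNIV. complex_of_real (k $ i) * ft c (\<lambda>x. \<i> * complex_of_real (c * x $ i) * gauss x) \<xi>)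
       = - 2 * complex_of_real pi * complex_of_real (\<xi> \<bullet> k) * ft c gauss \<xi>" for k
      unfolding d by (simp add: inner_vec_def sum_distrib_left sum_distrib_right ac_simps sum_negf)
    have "(ft c gauss has_derivative (\<lambda>k. - 2 * complex_of_real pi * complex_of_real (\<xi> \<bullet> k) * ft c gauss \<xi>)) (at \<xi>)"
      using has_derivative_ft_schwartz[OF gauss_schwartz, of c \<xi>] unfolding 1 .
    moreover have "((\<lambda>\<xi>. complex_of_real (exp (pi * (\<xi> \<bullet> \<xi>)))) has_derivative
       (\<lambda>k. complex_of_real (exp (pi * (\<xi> \<bullet> \<xi>)) * (2 * pi * (\<xi> \<bullet> k))))) (at \<xi>)"
      by (auto intro!: derivative_eq_intros simp: inner_commute algebra_simps)
    ultimately show ?thesis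
      unfolding q_def by (rule has_derivative_eq_rhs[OF has_derivative_mult]) (simp add: fun_eq_iff algebra_simps)
  qed
  then have "q \<xi> = q 0"
    using has_derivative_zero_unique[of UNIV q \<xi> 0] by auto
  also have "q 0 = 1" by (simp add: q_def ft_def integral_gauss)
  finally have "ft c gauss \<xi> * complex_of_real (exp (pi * (\<xi> \<bullet> \<xi>))) = 1" by (simp add: q_def)
  moreover have "gauss \<xi> * complex_of_real (exp (pi * (\<xi> \<bullet> \<xi>))) = 1"
    by (simp add: gauss_def power2_norm_eq_inner of_real_mult[symmetric] exp_add[symmetric] del: of_real_mult of_real_exp)
  moreover have "complex_of_real (exp (pi * (\<xi> \<bullet> \<xi>))) \<noteq> 0" by simp
  ultimately show ?thesis by (metis mult_right_cancel)
qed

lemma norm_gauss_le_1: "norm (gauss x) \<le> 1"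
  by (simp add: gauss_def)

lemma continuous_gauss: "isCont gauss x"
  by (rule differentiable_imp_continuous_within[OF schwartz_differentiable[OF gauss_schwartz]])

text \<open>The transform of the dilated Gaussian is an approximate identity; a dilation normalizes it to a fixed kernel.\<close>

lemma gauss_approximate_identity:
  fixes \<phi> :: "real ^ 'n::finite \<Rightarrow> complex"
  assumes \<epsilon>: "\<epsilon> > 0" and \<phi>: "\<phi> \<in> borel_measurable borel"
  shows "(LINT y|lborel. ft (- (2 * pi)) (\<lambda>\<xi>. gauss (\<epsilon> *\<^sub>R \<xi>)) (x - y) * \<phi> y) = (LINT z|lborel. gauss z * \<phi> (x - \<epsilon> *\<^sub>R z))"
proof -
  have [measurable]: "gauss \<in> borel_measurable borel" by (rule schwartz_measurable[OF gauss_schwartz])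
  note \<phi>[measurable]
  define K where "K = ft (- (2 * pi)) (\<lambda>\<xi>::real^'n. gauss (\<epsilon> *\<^sub>R \<xi>))"
  have [measurable]: "K \<in> borel_measurable borel" unfolding K_def by measurable
  have K: "\<epsilon> ^ CARD('n) *\<^sub>R K (\<epsilon> *\<^sub>R z) = gauss z" for z
  proof -
    have "gauss z = ft (- (2 * pi)) gauss z" by (rule ft_gauss[symmetric]) simp
    also have "\<dots> = \<bar>\<epsilon>\<bar> ^ DIM(real ^ 'n) *\<^sub>R (LINT \<xi>|lborel. gauss (0 + \<epsilon> *\<^sub>R \<xi>) * cis (- (2 * pi) * ((0 + \<epsilon> *\<^sub>R \<xi>) \<bullet> z)))"
      unfolding ft_def by (rule integral_lborel_affine) (use \<epsilon> in auto)
    finally show ?thesis using \<epsilon> by (simp add: K_def ft_def DIM_cart)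
  qed
  have "(LINT y|lborel. K (x - y) * \<phi> y) = \<bar>- \<epsilon>\<bar> ^ DIM(real ^ 'n) *\<^sub>R (LINT z|lborel. K (x - (x + (- \<epsilon>) *\<^sub>R z)) * \<phi> (x + (- \<epsilon>) *\<^sub>R z))"
    by (rule integral_lborel_affine) (use \<epsilon> in auto)
  also have "\<dots> = (LINT z|lborel. (\<epsilon> ^ CARD('n) *\<^sub>R K (\<epsilon> *\<^sub>R z)) * \<phi> (x - \<epsilon> *\<^sub>R z))"
    using \<epsilon> by (simp add: DIM_cart)
  finally show ?thesis unfolding K unfolding K_def .
qed

text \<open>Insert the Gaussian \<open>exp (- \<pi> |\<epsilon> \<xi>|\<^sup>2)\<close> into the outer integral and let \<open>\<epsilon>\<close> tend to 0. On the one side the factor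
disappears by dominated convergence, on the other side it turns into an average of \<open>\<phi>\<close> near the point.\<close>

theorem ft_inversion:
  fixes \<phi> :: "real ^ 'n::finite \<Rightarrow> complex"
  assumes \<phi>: "\<phi> \<in> schwartz"
  shows "ft (- (2 * pi)) (ft (2 * pi) \<phi>) = \<phi>"
proof
  fix x :: "real ^ 'n"
  have gm[measurable]: "gauss \<in> borel_measurable borel" by (rule schwartz_measurable[OF gauss_schwartz])
  have \<phi>m[measurable]: "\<phi> \<in> borel_measurable borel" by (rule schwartz_measurable[OF \<phi>])
  have F: "integrable lborel (ft (2 * pi) \<phi>)" by (intro schwartz_integrable ft_schwartz \<phi>) simp
  have gi: "integrable lborel (gauss :: real ^ 'n \<Rightarrow> complex)" by (rule schwartz_integrable[OF gauss_schwartz])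
  define e :: "nat \<Rightarrow> real" where "e k = 1 / real (Suc k)" for k
  have e: "e k > 0" for k by (simp add: e_def)
  have e0: "e \<longlonglongrightarrow> 0" using LIMSEQ_inverse_real_of_nat by (simp add: e_def[abs_def] inverse_eq_divide)
  have gc: "(\<lambda>k. gauss (e k *\<^sub>R \<xi>)) \<longlonglongrightarrow> 1" for \<xi> :: "real ^ 'n"
  proof -
    have "(\<lambda>k. e k *\<^sub>R \<xi>) \<longlonglongrightarrow> 0 *\<^sub>R \<xi>" by (intro tendsto_intros e0)
    then have "(\<lambda>k. e k *\<^sub>R \<xi>) \<longlonglongrightarrow> 0" by simp
    from isCont_tendsto_compose[OF continuous_gauss this] show ?thesis by (simp add: gauss_def)
  qed
  have eq: "ft (- (2 * pi)) (\<lambda>\<xi>. gauss (e k *\<^sub>R \<xi>) * ft (2 * pi) \<phi> \<xi>) x = (LINT z|lborel. gauss z * \<phi> (x - e k *\<^sub>R z))" for k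
  proof -
    have "integrable lborel (\<lambda>\<xi> :: real ^ 'n. gauss (e k *\<^sub>R \<xi>))"
      using integrable_lborel_affine[OF gi, of "e k" 0] e[of k] by simp
    from ft_mult_ft[OF this schwartz_integrable[OF \<phi>], of "2 * pi" x] show ?thesis
      unfolding gauss_approximate_identity[OF e \<phi>m] by simp
  qed
  have lim1: "(\<lambda>k. ft (- (2 * pi)) (\<lambda>\<xi>. gauss (e k *\<^sub>R \<xi>) * ft (2 * pi) \<phi> \<xi>) x) \<longlonglongrightarrow> ft (- (2 * pi)) (ft (2 * pi) \<phi>) x"
    unfolding ft_def[of "- (2 * pi)"]
  proof (rule integral_dominated_convergence[where w = "\<lambda>\<xi>. norm (ft (2 * pi) \<phi> \<xi>)"])
    show "AE \<xi> in lborel. (\<lambda>k. gauss (e k *\<^sub>R \<xi>) * ft (2 * pi) \<phi> \<xi> * cis (- (2 * pi) * (\<xi> \<bullet> x)))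
        \<longlonglongrightarrow> ft (2 * pi) \<phi> \<xi> * cis (- (2 * pi) * (\<xi> \<bullet> x))"
    proof (rule AE_I2)
      fix \<xi> :: "real ^ 'n"
      have "(\<lambda>k. gauss (e k *\<^sub>R \<xi>) * (ft (2 * pi) \<phi> \<xi> * cis (- (2 * pi) * (\<xi> \<bullet> x))))
          \<longlonglongrightarrow> 1 * (ft (2 * pi) \<phi> \<xi> * cis (- (2 * pi) * (\<xi> \<bullet> x)))"
        by (intro tendsto_mult gc tendsto_const)
      then show "(\<lambda>k. gauss (e k *\<^sub>R \<xi>) * ft (2 * pi) \<phi> \<xi> * cis (- (2 * pi) * (\<xi> \<bullet> x)))
          \<longlonglongrightarrow> ft (2 * pi) \<phi> \<xi> * cis (- (2 * pi) * (\<xi> \<bullet> x))" by (simp only: mult_1_left mult.assoc)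
    qed
    show "AE \<xi> in lborel. norm (gauss (e k *\<^sub>R \<xi>) * ft (2 * pi) \<phi> \<xi> * cis (- (2 * pi) * (\<xi> \<bullet> x))) \<le> norm (ft (2 * pi) \<phi> \<xi>)" for k
      by (intro AE_I2) (simp add: norm_mult mult_left_le_one_le norm_gauss_le_1)
  qed (use F in \<open>auto intro!: integrable_norm\<close>)
  have lim2: "(\<lambda>k. LINT z|lborel. gauss z * \<phi> (x - e k *\<^sub>R z)) \<longlonglongrightarrow> (LINT z|lborel. gauss (z :: real ^ 'n) * \<phi> x)"
  proof -
    obtain C where C: "\<And>x. norm (\<phi> x) \<le> C"
      using rapid_nonneg[OF schwartz_rapid[OF \<phi>], of 0] by (metis mult_1 power_0)
    show ?thesis
    proof (rule integral_dominated_convergence[where w = "\<lambda>z::real^'n. norm (gauss z) * C"])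
      show "AE z in lborel. (\<lambda>k. gauss z * \<phi> (x - e k *\<^sub>R z)) \<longlonglongrightarrow> gauss z * \<phi> x"
      proof (intro AE_I2 tendsto_mult tendsto_const)
        fix z :: "real ^ 'n"
        have "(\<lambda>k. x - e k *\<^sub>R z) \<longlonglongrightarrow> x - 0 *\<^sub>R z" by (intro tendsto_intros e0)
        then have "(\<lambda>k. x - e k *\<^sub>R z) \<longlonglongrightarrow> x" by simp
        then show "(\<lambda>k. \<phi> (x - e k *\<^sub>R z)) \<longlonglongrightarrow> \<phi> x"
          by (rule isCont_tendsto_compose[rotated]) (intro differentiable_imp_continuous_within schwartz_differentiable \<phi>)
      qed
      show "AE z in lborel. norm (gauss z * \<phi> (x - e k *\<^sub>R z)) \<le> norm (gauss z) * C" for k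
        by (intro AE_I2) (auto simp: norm_mult intro!: mult_left_mono C)
    qed (use gi in \<open>auto intro!: integrable_mult_left integrable_norm\<close>)
  qed
  have val: "(LINT z|lborel. gauss (z :: real ^ 'n) * \<phi> x) = \<phi> x"
    using integral_gauss[where 'n='n] by simp
  show "ft (- (2 * pi)) (ft (2 * pi) \<phi>) x = \<phi> x"
    using LIMSEQ_unique[OF lim1[unfolded eq] lim2] unfolding val .
qed

section \<open>Bochner--Riesz kernels\<close>

definition bochner_riesz :: "nat \<Rightarrow> real ^ 'n::finite \<Rightarrow> complex" where
  "bochner_riesz m x = complex_of_real (max 0 (1 - x \<bullet> x) ^ m)"

text \<open>The span of the truncated powers of exponent at least \<open>k\<close> over the polynomials. A partial derivative lowers
\<open>k\<close> by one, so that \<open>k\<close> counts the available derivatives.\<close>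

inductive_set bochner_riesz_class :: "nat \<Rightarrow> (real ^ 'n::finite \<Rightarrow> complex) set" for k where
  base: "k \<le> m \<Longrightarrow> bochner_riesz m \<in> bochner_riesz_class k"
| coordinate: "g \<in> bochner_riesz_class k \<Longrightarrow> (\<lambda>x. complex_of_real (x $ i) * g x) \<in> bochner_riesz_class k"
| cmult: "g \<in> bochner_riesz_class k \<Longrightarrow> (\<lambda>x. a * g x) \<in> bochner_riesz_class k"
| add: "f \<in> bochner_riesz_class k \<Longrightarrow> g \<in> bochner_riesz_class k \<Longrightarrow> (\<lambda>x. f x + g x) \<in> bochner_riesz_class k"

lemma bochner_riesz_class_antimono: "g \<in> bochner_riesz_class l \<Longrightarrow> k \<le> l \<Longrightarrow> g \<in> bochner_riesz_class k"
  by (induction rule: bochner_riesz_class.induct) (auto intro: bochner_riesz_class.intros)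

lemma DERIV_positive_part_power:
  assumes "m \<ge> 2"
  shows "((\<lambda>t::real. max 0 t ^ m) has_real_derivative real m * max 0 t ^ (m - 1)) (at t)"
proof -
  have z: "real m * 0 ^ (m - 1) = 0" using assms by (simp add: power_0_left)
  consider "t < 0" | "t = 0" | "t > 0" by linarith
  then show ?thesis
  proof cases
    case 1
    have "((\<lambda>_. 0) has_real_derivative 0) (at t)" by simp
    then have "((\<lambda>t::real. max 0 t ^ m) has_real_derivative 0) (at t)"
      by (rule has_field_derivative_transform_within_open[of _ _ _ "{..<0}"]) (use 1 assms in \<open>auto simp: max_def\<close>)
    moreover have "max 0 t = 0" using 1 by simp
    ultimately show ?thesis by (simp only: z)
  next
    case 2
    have "((\<lambda>t::real. max 0 t ^ m) has_real_derivative 0) (at 0)"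
    proof (rule DERIV_zero_of_quadratic[where C = 1])
      fix t :: real assume t: "\<bar>t - 0\<bar> < 1"
      have "max 0 t ^ m \<le> max 0 t ^ 2" using assms t by (intro power_decreasing) auto
      also have "\<dots> \<le> t\<^sup>2" by (simp add: max_def)
      finally show "\<bar>max 0 t ^ m\<bar> \<le> 1 * (t - 0)\<^sup>2" by simp
    qed (use assms in simp)
    then show ?thesis by (simp only: 2 z max.idem)
  next
    case 3
    have "((\<lambda>t. t ^ m) has_real_derivative real m * t ^ (m - 1)) (at t)"
      using DERIV_pow[of m t] by simp
    then have "((\<lambda>t::real. max 0 t ^ m) has_real_derivative real m * t ^ (m - 1)) (at t)"
      by (rule has_field_derivative_transform_within_open[of _ _ _ "{0<..}"]) (use 3 in auto)
    then show ?thesis using 3 by simp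
  qed
qed

lemma has_derivative_bochner_riesz:
  assumes "m \<ge> 2"
  shows "(bochner_riesz m has_derivative (\<lambda>h. complex_of_real (- 2 * real m * (x \<bullet> h)) * bochner_riesz (m - 1) x)) (at x)"
proof -
  have "((\<lambda>x. 1 - x \<bullet> x) has_derivative (\<lambda>h. - 2 * (x \<bullet> h))) (at x)"
    by (auto intro!: derivative_eq_intros simp: inner_commute)
  from has_derivative_compose[OF this DERIV_positive_part_power[OF assms, unfolded has_field_derivative_def]]
  have "((\<lambda>x. max 0 (1 - x \<bullet> x) ^ m) has_derivative (\<lambda>h. real m * max 0 (1 - x \<bullet> x) ^ (m - 1) * (- 2 * (x \<bullet> h)))) (at x)" .
  from has_derivative_of_real[OF this, where 'a = complex]
  show ?thesis unfolding bochner_riesz_def[abs_def] by (simp add: ac_simps)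
qed

lemma bochner_riesz_class_differentiable:
  assumes "g \<in> bochner_riesz_class (Suc k)" "k \<ge> 1"
  shows "(\<forall>x. g differentiable (at x)) \<and> (\<forall>i. partial_deriv i g \<in> bochner_riesz_class k)"
  using assms(1)
proof (induction rule: bochner_riesz_class.induct)
  case (base m)
  then have m: "m \<ge> 2" using assms(2) by simp
  have "partial_deriv i (bochner_riesz m) = (\<lambda>x. complex_of_real (- 2 * real m) * (complex_of_real (x $ i) * bochner_riesz (m - 1) x))" for i :: 'a
    by (rule ext, subst partial_deriv_eqI[OF has_derivative_bochner_riesz[OF m]]) (simp add: inner_axis)
  moreover have "(\<lambda>x. complex_of_real (- 2 * real m) * (complex_of_real (x $ i) * bochner_riesz (m - 1) x)) \<in> bochner_riesz_class k" for i :: 'a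
    by (intro bochner_riesz_class.intros) (use base in simp)
  ultimately show ?case using has_derivative_bochner_riesz[OF m] unfolding differentiable_def by auto
next
  case (coordinate g j)
  have d: "(\<lambda>x. complex_of_real (x $ j)) differentiable (at x)" for x :: "real ^ 'a"
    using has_derivative_coordinate unfolding differentiable_def by blast
  have "partial_deriv i (\<lambda>x. complex_of_real (x $ j) * g x) =
      (\<lambda>x. (if i = j then 1 else 0) * g x + complex_of_real (x $ j) * partial_deriv i g x)" for i
    using coordinate.IH d by (intro ext) (simp add: partial_deriv_mult partial_deriv_coordinate)
  moreover have "(\<lambda>x. (if i = j then 1 else 0) * g x + complex_of_real (x $ j) * partial_deriv i g x) \<in> bochner_riesz_class k" for i
    using coordinate bochner_riesz_class_antimono[OF coordinate.hyps, of k] by (intro bochner_riesz_class.intros) auto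
  ultimately show ?case using coordinate.IH d by (auto intro: differentiable_mult)
next
  case (cmult g a)
  have "partial_deriv i (\<lambda>x. a * g x) = (\<lambda>x. a * partial_deriv i g x)" for i
    using cmult.IH by (intro ext) (simp add: partial_deriv_mult partial_deriv_const)
  then show ?case using cmult.IH by (auto intro: bochner_riesz_class.intros differentiable_mult)
next
  case (add f g)
  have "partial_deriv i (\<lambda>x. f x + g x) = (\<lambda>x. partial_deriv i f x + partial_deriv i g x)" for i
    using add.IH by (intro ext partial_deriv_add) auto
  then show ?case using add.IH by (auto intro: bochner_riesz_class.intros)
qed

lemma bochner_riesz_class_bounded_support:
  assumes "g \<in> bochner_riesz_class k" "k \<ge> 1"
  shows "\<exists>C\<ge>0. \<forall>x. norm (g x) \<le> C \<and> (norm x > 1 \<longrightarrow> g x = 0)"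
  using assms(1)
proof (induction rule: bochner_riesz_class.induct)
  case (base m)
  have "norm (bochner_riesz m x) \<le> 1" "norm x > 1 \<longrightarrow> bochner_riesz m x = 0" for x :: "real ^ 'a"
  proof -
    have "max 0 (1 - x \<bullet> x) ^ m \<le> 1" by (intro power_le_one) auto
    then show "norm (bochner_riesz m x) \<le> 1" by (simp add: bochner_riesz_def norm_power)
    show "norm x > 1 \<longrightarrow> bochner_riesz m x = 0"
    proof
      assume "norm x > 1"
      then have "(norm x)\<^sup>2 > 1" by (simp add: one_less_power)
      then have "max 0 (1 - x \<bullet> x) = 0" by (simp add: power2_norm_eq_inner)
      moreover have "m > 0" using base assms(2) by simp
      ultimately show "bochner_riesz m x = 0" by (simp add: bochner_riesz_def)
    qed
  qed
  then show ?case by (intro exI[of _ 1]) auto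
next
  case (coordinate g i)
  then obtain C where C: "C \<ge> 0" "\<And>x. norm (g x) \<le> C" "\<And>x. norm x > 1 \<Longrightarrow> g x = 0" by blast
  have "norm (complex_of_real (x $ i) * g x) \<le> C" for x
  proof (cases "norm x > 1")
    case False
    then have "\<bar>x $ i\<bar> \<le> 1" using component_le_norm_cart[of x i] by linarith
    then have "\<bar>x $ i\<bar> * norm (g x) \<le> 1 * C" using C by (intro mult_mono) auto
    then show ?thesis by (simp add: norm_mult)
  qed (use C in simp)
  then show ?case using C by (intro exI[of _ C]) auto
next
  case (cmult g a)
  then obtain C where C: "C \<ge> 0" "\<And>x. norm (g x) \<le> C" "\<And>x. norm x > 1 \<Longrightarrow> g x = 0" by blast
  then have "norm (a * g x) \<le> norm a * C" for x by (simp add: norm_mult mult_left_mono)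
  then show ?case using C by (intro exI[of _ "norm a * C"]) auto
next
  case (add f g)
  obtain C where C: "C \<ge> 0" "\<And>x. norm (f x) \<le> C" "\<And>x. norm x > 1 \<Longrightarrow> f x = 0" using add.IH by blast
  obtain D where D: "D \<ge> 0" "\<And>x. norm (g x) \<le> D" "\<And>x. norm x > 1 \<Longrightarrow> g x = 0" using add.IH by blast
  have "norm (f x + g x) \<le> C + D" for x using norm_triangle_ineq[of "f x" "g x"] C(2)[of x] D(2)[of x] by linarith
  then show ?case using C D by (intro exI[of _ "C + D"]) auto
qed

lemma bochner_riesz_class_measurable: "g \<in> bochner_riesz_class k \<Longrightarrow> g \<in> borel_measurable borel"
proof (induction rule: bochner_riesz_class.induct)
  case (base m) show ?case unfolding bochner_riesz_def[abs_def] by measurable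
next
  case (coordinate g i)
  note [measurable] = coordinate.IH
  show ?case by measurable
next
  case (cmult g a)
  note [measurable] = cmult.IH
  show ?case by measurable
next
  case (add f g)
  note [measurable] = add.IH
  show ?case by measurable
qed

lemma bochner_riesz_class_weighted:
  fixes g :: "real ^ 'n::finite \<Rightarrow> complex"
  assumes "g \<in> bochner_riesz_class k" "k \<ge> 1"
  shows "weighted g"
proof -
  obtain C where C: "C \<ge> 0" "\<And>x. norm (g x) \<le> C" "\<And>x. norm x > 1 \<Longrightarrow> g x = 0"
    using bochner_riesz_class_bounded_support[OF assms] by blast
  have "norm (g x) \<le> C * 2 ^ (2 * CARD('n)) * weight x" for x
  proof (cases "norm x > 1")
    case True then show ?thesis using C weight_pos[of x] by simp
  next
    case False
    have "1 \<le> (1 + norm x) ^ (2 * CARD('n)) * weight x" by (rule weight_lower)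
    also have "\<dots> \<le> 2 ^ (2 * CARD('n)) * weight x"
      using False weight_pos[of x] by (intro mult_right_mono power_mono) auto
    finally have "C * 1 \<le> C * (2 ^ (2 * CARD('n)) * weight x)" by (intro mult_left_mono C)
    then show ?thesis using C(2)[of x] by simp
  qed
  then show ?thesis unfolding weighted_def using bochner_riesz_class_measurable[OF assms(1)] by blast
qed

text \<open>Each factor \<open>1 + \<xi>\<^sub>i\<^sup>2\<close> is the Fourier image of \<open>1 - \<partial>\<^sub>i\<^sup>2/c\<^sup>2\<close> and costs two derivatives.\<close>

lemma ft_bochner_riesz_class_decay:
  assumes c: "c \<noteq> 0" and g: "g \<in> bochner_riesz_class (2 * length xs + 1)"
  shows "\<exists>g'\<in>bochner_riesz_class 1. \<forall>\<xi>. (\<Prod>i\<leftarrow>xs. 1 + (complex_of_real (\<xi> $ i))\<^sup>2) * ft c g \<xi> = ft c g' \<xi>"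
  using g
proof (induction xs arbitrary: g)
  case Nil then show ?case by auto
next
  case (Cons i xs)
  define k where "k = 2 * length xs + 1"
  have g2: "g \<in> bochner_riesz_class (Suc (Suc k))" using Cons.prems by (simp add: k_def)
  have g1: "partial_deriv i g \<in> bochner_riesz_class (Suc k)" "\<And>x. g differentiable (at x)"
    using bochner_riesz_class_differentiable[OF g2] by auto
  have g0: "partial_deriv i (partial_deriv i g) \<in> bochner_riesz_class k" "\<And>x. partial_deriv i g differentiable (at x)"
    using bochner_riesz_class_differentiable[OF g1(1)] by (auto simp: k_def)
  define a where "a = - (1 / (complex_of_real c * complex_of_real c))"
  define g' where "g' = (\<lambda>x. g x + a * partial_deriv i (partial_deriv i g) x)"
  have g': "g' \<in> bochner_riesz_class k"
    unfolding g'_def by (intro bochner_riesz_class.intros g0 bochner_riesz_class_antimono[OF g2]) simp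
  have w: "weighted g" "weighted (partial_deriv i g)" "weighted (partial_deriv i (partial_deriv i g))"
    using bochner_riesz_class_weighted g2 g1(1) g0(1) by (auto simp: k_def)
  have e: "ft c g' \<xi> = (1 + (complex_of_real (\<xi> $ i))\<^sup>2) * ft c g \<xi>" for \<xi>
  proof -
    have "ft c g' \<xi> = ft c g \<xi> + a * ft c (partial_deriv i (partial_deriv i g)) \<xi>"
      unfolding g'_def
      by (subst ft_add[OF weighted_integrable[OF w(1)] integrable_mult_right[OF weighted_integrable[OF w(3)]]])
        (simp only: ft_cmult)
    also have "ft c (partial_deriv i (partial_deriv i g)) \<xi> =
        - \<i> * complex_of_real (c * \<xi> $ i) * (- \<i> * complex_of_real (c * \<xi> $ i) * ft c g \<xi>)"
      unfolding ft_partial_deriv[OF w(2,3) g0(2)] ft_partial_deriv[OF w(1,2) g1(2)] ..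
    also have "a * \<dots> = (complex_of_real (\<xi> $ i))\<^sup>2 * ft c g \<xi>"
    proof -
      have "a * (- \<i> * complex_of_real (c * \<xi> $ i) * (- \<i> * complex_of_real (c * \<xi> $ i) * ft c g \<xi>))
          = (\<i> * \<i>) * (a * (complex_of_real c * complex_of_real c)) * ((complex_of_real (\<xi> $ i))\<^sup>2 * ft c g \<xi>)"
        by (simp only: of_real_mult power2_eq_square minus_mult_left[symmetric] minus_mult_right[symmetric] minus_minus mult_ac)
      moreover have "a * (complex_of_real c * complex_of_real c) = -1" using c by (simp add: a_def)
      ultimately show ?thesis by simp
    qed
    finally show ?thesis by (simp add: algebra_simps)
  qed
  obtain g'' where g'': "g'' \<in> bochner_riesz_class 1"
    "\<And>\<xi>. (\<Prod>i\<leftarrow>xs. 1 + (complex_of_real (\<xi> $ i))\<^sup>2) * ft c g' \<xi> = ft c g'' \<xi>"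
    using Cons.IH[of g'] g' unfolding k_def by blast
  have "(\<Prod>i\<leftarrow>i # xs. 1 + (complex_of_real (\<xi> $ i))\<^sup>2) * ft c g \<xi> = ft c g'' \<xi>" for \<xi>
    unfolding g''(2)[symmetric] e by (simp add: ac_simps)
  then show ?case using g''(1) by blast
qed

text \<open>The product of the factors \<open>1 + \<xi>\<^sub>i\<^sup>2\<close> over all coordinates times the transform is bounded, being itself the
transform of an integrable function. This is where the exponent \<open>2 n + 1\<close> comes from.\<close>

lemma ft_bochner_riesz_weighted:
  assumes c: "c \<noteq> 0"
  shows "weighted (ft c (bochner_riesz (2 * CARD('n) + 1) :: real ^ 'n::finite \<Rightarrow> complex))"
proof -
  let ?g = "bochner_riesz (2 * CARD('n) + 1) :: real ^ 'n \<Rightarrow> complex"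
  obtain xs :: "'n list" where xs: "set xs = UNIV" "distinct xs" using finite_distinct_list[of "UNIV :: 'n set"] by auto
  then have len: "length xs = CARD('n)" using distinct_card by metis
  have "?g \<in> bochner_riesz_class (2 * length xs + 1)" unfolding len by (rule bochner_riesz_class.base) simp
  from ft_bochner_riesz_class_decay[OF c this]
  obtain g' :: "real ^ 'n \<Rightarrow> complex" where g': "g' \<in> bochner_riesz_class 1" "\<And>\<xi>. (\<Prod>i\<leftarrow>xs. 1 + (complex_of_real (\<xi> $ i))\<^sup>2) * ft c ?g \<xi> = ft c g' \<xi>"
    by blast
  define C where "C = (LINT x|lborel. norm (g' x))"
  have "norm (ft c ?g \<xi>) \<le> C * weight \<xi>" for \<xi>
  proof -
    have "(\<Prod>i\<leftarrow>xs. 1 + (complex_of_real (\<xi> $ i))\<^sup>2) = (\<Prod>i\<in>UNIV. 1 + (complex_of_real (\<xi> $ i))\<^sup>2)"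
      using prod.distinct_set_conv_list[OF xs(2), of "\<lambda>i. 1 + (complex_of_real (\<xi> $ i))\<^sup>2"] xs(1) by simp
    also have "\<dots> = complex_of_real (\<Prod>i\<in>UNIV. 1 + (\<xi> $ i)\<^sup>2)" by simp
    finally have p: "(\<Prod>i\<leftarrow>xs. 1 + (complex_of_real (\<xi> $ i))\<^sup>2) = complex_of_real (1 / weight \<xi>)"
      by (simp add: weight_def prod_dividef)
    have "norm (ft c g' \<xi>) \<le> C"
      unfolding C_def by (intro norm_ft_le weighted_integrable bochner_riesz_class_weighted[OF g'(1)]) simp
    then have "norm (ft c ?g \<xi>) / weight \<xi> \<le> C"
      unfolding g'(2)[symmetric] p norm_mult using weight_pos[of \<xi>] by (simp add: norm_divide)
    then show ?thesis using weight_pos[of \<xi>] by (simp add: field_simps)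
  qed
  moreover have "ft c ?g \<in> borel_measurable borel"
    by (intro measurable_ft bochner_riesz_class_measurable[OF bochner_riesz_class.base[of 0]]) simp
  ultimately show ?thesis unfolding weighted_def by blast
qed

section \<open>Radial symbols of negative order are convolution multipliers\<close>

text \<open>The kernel is the superposition of the dilated Bochner--Riesz kernels with the weight \<open>w\<close>. Since the dilations
preserve the integral of the modulus of the kernel, the superposition converges absolutely in \<open>L\<^sup>1\<close>, and all
exchanges of integrals are justified by domination.\<close>

theorem radial_multiplier_kernel:
  fixes \<alpha> :: "real \<Rightarrow> real"
  assumes \<alpha>: "\<And>k. symb k 0 (-1) \<alpha>"
  obtains \<kappa> :: "real ^ 'n::finite \<Rightarrow> complex" where "integrable lborel \<kappa>"
    "\<And>\<phi> x. \<phi> \<in> schwartz \<Longrightarrow> ft (- (2 * pi)) (\<lambda>\<xi>. complex_of_real (\<alpha> (4 * pi\<^sup>2 * (norm \<xi>)\<^sup>2)) * ft (2 * pi) \<phi> \<xi>) x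
       = (LINT y|lborel. \<kappa> (x - y) * \<phi> y)"
proof -
  define M where "M = 2 * CARD('n) + 1"
  have M: "M \<ge> 1" by (simp add: M_def)
  obtain w where w: "integrable lborel w" "\<And>t. t \<le> 0 \<Longrightarrow> w t = 0"
    "\<And>r. r \<ge> 0 \<Longrightarrow> \<alpha> r = (\<integral>t. w t * max 0 (1 - r / t) ^ M \<partial>lborel)"
    using symb_bochner_riesz_superposition[OF \<alpha> M] by metis
  have [measurable]: "w \<in> borel_measurable borel" using w(1) by auto
  define wc where "wc t = complex_of_real (w t)" for t
  have wc: "integrable lborel wc" unfolding wc_def[abs_def] using w(1) by (rule integrable_of_real)
  have wcm[measurable]: "wc \<in> borel_measurable borel" using wc by auto
  define K where "K = ft (- (2 * pi)) (bochner_riesz M :: real ^ 'n \<Rightarrow> complex)"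
  have K: "integrable lborel K"
    unfolding K_def M_def by (intro weighted_integrable ft_bochner_riesz_weighted) simp
  have [measurable]: "K \<in> borel_measurable borel" using K by auto
  define s where "s t = sqrt t / (2 * pi)" for t
  have s: "s t > 0" if "t > 0" for t using that by (simp add: s_def)
  have [measurable]: "s \<in> borel_measurable borel" unfolding s_def[abs_def] by measurable
  define k where "k t x = (s t) ^ CARD('n) *\<^sub>R K (s t *\<^sub>R x)" for t and x :: "real ^ 'n"
  define H where "H t \<xi> = complex_of_real (max 0 (1 - (4 * pi\<^sup>2 * (norm \<xi>)\<^sup>2) / t) ^ M)" for t and \<xi> :: "real ^ 'n"
  have H_br: "H t \<xi> = bochner_riesz M (0 + (1 / s t) *\<^sub>R \<xi>)" if "t > 0" for t \<xi>
  proof -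
    have 1: "(1 / s t) * (1 / s t) = 4 * pi\<^sup>2 / t" using that by (simp add: s_def power2_eq_square)
    have "(0 + (1 / s t) *\<^sub>R \<xi>) \<bullet> (0 + (1 / s t) *\<^sub>R \<xi>) = ((1 / s t) * (1 / s t)) * (norm \<xi>)\<^sup>2"
      by (simp only: add_0_left inner_scaleR_left inner_scaleR_right power2_norm_eq_inner mult.assoc)
    also have "\<dots> = 4 * pi\<^sup>2 * (norm \<xi>)\<^sup>2 / t" unfolding 1 by simp
    finally have "(0 + (1 / s t) *\<^sub>R \<xi>) \<bullet> (0 + (1 / s t) *\<^sub>R \<xi>) = 4 * pi\<^sup>2 * (norm \<xi>)\<^sup>2 / t" .
    then show ?thesis unfolding H_def bochner_riesz_def by (simp only:)
  qed
  have brm[measurable]: "(bochner_riesz M :: real ^ 'n \<Rightarrow> complex) \<in> borel_measurable borel"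
    by (intro bochner_riesz_class_measurable[OF bochner_riesz_class.base[of 0]]) simp
  have bri: "integrable lborel (bochner_riesz M :: real ^ 'n \<Rightarrow> complex)"
    by (intro weighted_integrable bochner_riesz_class_weighted[OF bochner_riesz_class.base[of 1 M]]) (use M in auto)
  have Hi: "integrable lborel (H t)" if "t > 0" for t
    unfolding H_br[OF that, abs_def] by (rule integrable_lborel_affine[OF bri]) (use s[OF that] in simp)
  have ftH: "ft (- (2 * pi)) (H t) x = k t x" if t: "t > 0" for t x
  proof -
    have "K (s t *\<^sub>R x) = \<bar>1 / s t\<bar> ^ DIM(real ^ 'n) *\<^sub>R (LINT \<xi>|lborel. bochner_riesz M (0 + (1 / s t) *\<^sub>R \<xi>)
        * cis (- (2 * pi) * ((0 + (1 / s t) *\<^sub>R \<xi>) \<bullet> (s t *\<^sub>R x))))"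
      unfolding K_def ft_def by (rule integral_lborel_affine) (use s[OF t] in auto)
    also have "\<dots> = (1 / s t) ^ CARD('n) *\<^sub>R ft (- (2 * pi)) (H t) x"
      unfolding ft_def H_br[OF t] using s[OF t] by (simp add: DIM_cart)
    finally show ?thesis unfolding k_def using s[OF t] by (simp add: power_one_over)
  qed
  have km[measurable]: "case_prod k \<in> borel_measurable (borel \<Otimes>\<^sub>M borel)"
    unfolding k_def by measurable
  have kt: "integrable lborel (\<lambda>y. k t (x + e *\<^sub>R y))" "(LINT y|lborel. norm (k t (x + e *\<^sub>R y))) = (LINT z|lborel. norm (K z))"
    if t: "t > 0" and e: "\<bar>e\<bar> = 1" for t x e
  proof -
    have e0: "e * s t \<noteq> 0" using s[OF t] e by auto
    have r: "k t (x + e *\<^sub>R y) = (s t) ^ CARD('n) *\<^sub>R K (s t *\<^sub>R x + (e * s t) *\<^sub>R y)" for y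
      unfolding k_def by (simp add: scaleR_add_right ac_simps)
    show "integrable lborel (\<lambda>y. k t (x + e *\<^sub>R y))"
      unfolding r by (intro integrable_scaleR_right integrable_lborel_affine K e0)
    have "(LINT z|lborel. norm (K z)) = \<bar>e * s t\<bar> ^ DIM(real ^ 'n) *\<^sub>R (LINT y|lborel. norm (K (s t *\<^sub>R x + (e * s t) *\<^sub>R y)))"
      by (rule integral_lborel_affine) (use e0 in auto)
    also have "\<dots> = (LINT y|lborel. norm (k t (x + e *\<^sub>R y)))"
      unfolding r using s[OF t] e by (simp add: abs_mult DIM_cart)
    finally show "(LINT y|lborel. norm (k t (x + e *\<^sub>R y))) = (LINT z|lborel. norm (K z))" ..
  qed
  have pair: "integrable (lborel \<Otimes>\<^sub>M lborel) (\<lambda>(t, y). wc t * k t (x + e *\<^sub>R y))" if e: "\<bar>e\<bar> = 1" for x e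
  proof (rule lborel_pair.Fubini_integrable)
    show "(\<lambda>(t, y). wc t * k t (x + e *\<^sub>R y)) \<in> borel_measurable (lborel \<Otimes>\<^sub>M lborel)"
      unfolding k_def by measurable
    have "(\<lambda>t. LINT y|lborel. norm (case (t, y) of (t, y) \<Rightarrow> wc t * k t (x + e *\<^sub>R y)))
        = (\<lambda>t. norm (wc t) * (LINT z|lborel. norm (K z)))"
    proof
      fix t show "(LINT y|lborel. norm (case (t, y) of (t, y) \<Rightarrow> wc t * k t (x + e *\<^sub>R y))) = norm (wc t) * (LINT z|lborel. norm (K z))"
        using kt[OF _ e, of t x] w(2)[of t] by (cases "t > 0") (simp_all add: norm_mult wc_def)
    qed
    then show "integrable lborel (\<lambda>t. LINT y|lborel. norm (case (t, y) of (t, y) \<Rightarrow> wc t * k t (x + e *\<^sub>R y)))"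
      using wc by (simp add: integrable_norm)
    show "AE t in lborel. integrable lborel (\<lambda>y. case (t, y) of (t, y) \<Rightarrow> wc t * k t (x + e *\<^sub>R y))"
    proof (rule AE_I2)
      fix t show "integrable lborel (\<lambda>y. case (t, y) of (t, y) \<Rightarrow> wc t * k t (x + e *\<^sub>R y))"
        using kt(1)[OF _ e, of t x] w(2)[of t] by (cases "t > 0") (simp_all add: wc_def)
    qed
  qed
  define \<kappa> where "\<kappa> x = (LINT t|lborel. wc t * k t x)" for x
  show ?thesis
  proof (rule that[of \<kappa>])
    show "integrable lborel \<kappa>"
      using lborel_pair.integrable_snd[OF pair[of 1 0]] unfolding \<kappa>_def[abs_def] by simp
    fix \<phi> :: "real ^ 'n \<Rightarrow> complex" and x :: "real ^ 'n" assume \<phi>: "\<phi> \<in> schwartz"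
    have \<phi>m[measurable]: "\<phi> \<in> borel_measurable borel" by (rule schwartz_measurable[OF \<phi>])
    have \<phi>i: "integrable lborel \<phi>" by (rule schwartz_integrable[OF \<phi>])
    define F where "F = ft (2 * pi) \<phi>"
    have F: "integrable lborel F" unfolding F_def by (intro schwartz_integrable ft_schwartz \<phi>) simp
    have [measurable]: "F \<in> borel_measurable borel" using F by auto
    have Hle: "norm (wc t * H t \<xi>) \<le> norm (wc t)" for t \<xi>
    proof (cases "t > 0")
      case True
      have "max 0 (1 - (4 * pi\<^sup>2 * (norm \<xi>)\<^sup>2) / t) ^ M \<le> 1" using True by (intro power_le_one) auto
      then have "norm (H t \<xi>) \<le> 1" by (simp add: H_def norm_power)
      then show ?thesis by (simp add: norm_mult mult_left_le)
    qed (use w(2) in \<open>simp add: wc_def\<close>)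
    have \<alpha>H: "complex_of_real (\<alpha> (4 * pi\<^sup>2 * (norm \<xi>)\<^sup>2)) = (LINT t|lborel. wc t * H t \<xi>)" for \<xi> :: "real ^ 'n"
      unfolding w(3)[of "4 * pi\<^sup>2 * (norm \<xi>)\<^sup>2", simplified] wc_def H_def
      by (simp only: of_real_mult[symmetric] integral_complex_of_real)
    have "ft (- (2 * pi)) (\<lambda>\<xi>. complex_of_real (\<alpha> (4 * pi\<^sup>2 * (norm \<xi>)\<^sup>2)) * F \<xi>) x
        = (LINT \<xi>|lborel. LINT t|lborel. (wc t * H t \<xi>) * (F \<xi> * cis (- (2 * pi) * (\<xi> \<bullet> x))))"
      unfolding ft_def \<alpha>H by (simp add: mult.assoc[symmetric])
    also have "\<dots> = (LINT t|lborel. LINT \<xi>|lborel. (wc t * H t \<xi>) * (F \<xi> * cis (- (2 * pi) * (\<xi> \<bullet> x))))"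
    proof (rule Fubini_dominated(2)[OF _ wc F])
      show "(\<lambda>(t, \<xi>). wc t * H t \<xi> * (F \<xi> * cis (- (2 * pi) * (\<xi> \<bullet> x)))) \<in> borel_measurable (borel \<Otimes>\<^sub>M borel)"
        unfolding H_def by measurable
      show "norm (wc t * H t \<xi> * (F \<xi> * cis (- (2 * pi) * (\<xi> \<bullet> x)))) \<le> norm (wc t) * norm (F \<xi>)" for t \<xi>
        unfolding norm_mult[of "wc t * H t \<xi>"] using Hle[of t \<xi>] by (simp add: norm_mult mult_right_mono)
    qed
    also have "\<dots> = (LINT t|lborel. LINT y|lborel. wc t * k t (x + (-1) *\<^sub>R y) * \<phi> y)"
    proof (rule Bochner_Integration.integral_cong[OF refl])
      fix t
      show "(LINT \<xi>|lborel. (wc t * H t \<xi>) * (F \<xi> * cis (- (2 * pi) * (\<xi> \<bullet> x)))) = (LINT y|lborel. wc t * k t (x + (-1) *\<^sub>R y) * \<phi> y)"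
      proof (cases "t > 0")
        case True
        have "(LINT \<xi>|lborel. (wc t * H t \<xi>) * (F \<xi> * cis (- (2 * pi) * (\<xi> \<bullet> x)))) = wc t * ft (- (2 * pi)) (\<lambda>\<xi>. H t \<xi> * ft (2 * pi) \<phi> \<xi>) x"
          by (simp add: ft_def[of "- (2 * pi)"] F_def mult.assoc)
        also have "\<dots> = wc t * (LINT y|lborel. k t (x - y) * \<phi> y)"
          unfolding ft_mult_ft[OF Hi[OF True] \<phi>i] ftH[OF True] ..
        finally show ?thesis by (simp add: mult.assoc)
      qed (use w(2) in \<open>simp add: wc_def\<close>)
    qed
    also have "\<dots> = (LINT y|lborel. LINT t|lborel. wc t * k t (x + (-1) *\<^sub>R y) * \<phi> y)"
    proof (rule lborel_pair.Fubini_integral[symmetric])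
      obtain C where C: "C \<ge> 0" "\<And>x. norm (\<phi> x) \<le> C"
        using rapid_nonneg[OF schwartz_rapid[OF \<phi>], of 0] by (metis mult_1 power_0)
      show "integrable (lborel \<Otimes>\<^sub>M lborel) (\<lambda>(t, y). wc t * k t (x + (-1) *\<^sub>R y) * \<phi> y)"
      proof (rule Bochner_Integration.integrable_bound)
        show "integrable (lborel \<Otimes>\<^sub>M lborel) (\<lambda>p. C * norm (case p of (t, y) \<Rightarrow> wc t * k t (x + (-1) *\<^sub>R y)))"
          by (intro integrable_mult_right integrable_norm pair) simp
        show "(\<lambda>(t, y). wc t * k t (x + (-1) *\<^sub>R y) * \<phi> y) \<in> borel_measurable (lborel \<Otimes>\<^sub>M lborel)"
          unfolding k_def by measurable
        show "AE p in lborel \<Otimes>\<^sub>M lborel. norm (case p of (t, y) \<Rightarrow> wc t * k t (x + (-1) *\<^sub>R y) * \<phi> y)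
            \<le> norm (C * norm (case p of (t, y) \<Rightarrow> wc t * k t (x + (-1) *\<^sub>R y)))"
          using C by (intro AE_I2) (auto simp: norm_mult abs_mult mult.commute intro!: mult_right_mono)
      qed
    qed
    also have "\<dots> = (LINT y|lborel. \<kappa> (x - y) * \<phi> y)"
    proof (rule Bochner_Integration.integral_cong[OF refl])
      fix y
      have e: "x + (-1) *\<^sub>R y = x - y" by simp
      show "(LINT t|lborel. wc t * k t (x + (-1) *\<^sub>R y) * \<phi> y) = \<kappa> (x - y) * \<phi> y"
        unfolding \<kappa>_def e by (rule integral_mult_left_zero)
    qed
    finally show "ft (- (2 * pi)) (\<lambda>\<xi>. complex_of_real (\<alpha> (4 * pi\<^sup>2 * (norm \<xi>)\<^sup>2)) * ft (2 * pi) \<phi> \<xi>) x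
       = (LINT y|lborel. \<kappa> (x - y) * \<phi> y)" unfolding F_def .
  qed
qed

section \<open>A weighted Jensen inequality\<close>

lemma powr_above_tangent:
  fixes z c q :: real
  assumes "q \<ge> 1" "z \<ge> 0" "c > 0"
  shows "c powr q + q * c powr (q - 1) * (z - c) \<le> z powr q"
proof (cases "z = 0")
  case True
  have "c powr (q - 1) * c = c powr q" using powr_mult_base[of c "q - 1"] assms by (simp add: mult.commute)
  then have "c powr q + q * c powr (q - 1) * (z - c) = (1 - q) * c powr q"
    using True by (simp add: algebra_simps)
  also have "\<dots> \<le> 0" using assms by (intro mult_nonpos_nonneg) auto
  finally show ?thesis using True by simp
next
  case False
  have "((\<lambda>x. x powr q) has_real_derivative q * c powr (q - 1)) (at c within {0<..})"
    by (rule has_field_derivative_at_within[OF has_real_derivative_powr[OF assms(3)]])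
  from convex_on_imp_above_tangent[OF powr_convex[OF assms(1)] connected_Ioi _ _ this, of z]
  have "q * c powr (q - 1) * (z - c) \<le> z powr q - c powr q"
    using False assms(2,3) interior_open[OF open_greaterThan[of "0::real"]] by simp
  then show ?thesis by simp
qed

text \<open>Jensen's inequality for the measure with density \<open>g\<close>, which is finite but not normalized: integrate the tangent
inequality at the mean value of \<open>f\<close>.\<close>

lemma powr_integral_le:
  fixes g f :: "'a \<Rightarrow> real"
  assumes q: "q \<ge> 1" and g: "integrable M g" "\<And>x. g x \<ge> 0" and f: "\<And>x. f x \<ge> 0"
    and gf: "integrable M (\<lambda>x. g x * f x)" and gfq: "integrable M (\<lambda>x. g x * f x powr q)"
  shows "(LINT x|M. g x * f x) powr q \<le> (LINT x|M. g x) powr (q - 1) * (LINT x|M. g x * f x powr q)"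
proof -
  define I where "I = (LINT x|M. g x * f x)"
  define \<kappa> where "\<kappa> = (LINT x|M. g x)"
  have I0: "I \<ge> 0" and k0: "\<kappa> \<ge> 0" unfolding I_def \<kappa>_def using g f by (auto intro!: Bochner_Integration.integral_nonneg)
  have r0: "(LINT x|M. g x * f x powr q) \<ge> 0" using g by (auto intro!: Bochner_Integration.integral_nonneg)
  show ?thesis
  proof (cases "I = 0")
    case True then show ?thesis using r0 by (simp add: I_def)
  next
    case False
    then have I: "I > 0" using I0 by simp
    have "\<kappa> \<noteq> 0"
    proof
      assume "\<kappa> = 0"
      then have "AE x in M. g x = 0" unfolding \<kappa>_def using integral_nonneg_eq_0_iff_AE[OF g(1)] g(2) by auto
      then have "I = 0" unfolding I_def by (intro integral_eq_zero_AE) auto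
      then show False using False by simp
    qed
    then have k: "\<kappa> > 0" using k0 by simp
    define c where "c = I / \<kappa>"
    have c: "c > 0" using I k by (simp add: c_def)
    have "(LINT x|M. g x * (c powr q + q * c powr (q - 1) * (f x - c))) \<le> (LINT x|M. g x * f x powr q)"
    proof (rule integral_mono[OF _ gfq])
      show "integrable M (\<lambda>x. g x * (c powr q + q * c powr (q - 1) * (f x - c)))"
        using g(1) gf by (simp add: ring_distribs mult.left_commute[of "g _"])
      show "g x * (c powr q + q * c powr (q - 1) * (f x - c)) \<le> g x * f x powr q" for x
        by (intro mult_left_mono powr_above_tangent q f c g)
    qed
    also have "(\<lambda>x. g x * (c powr q + q * c powr (q - 1) * (f x - c)))
        = (\<lambda>x. (c powr q - q * c powr (q - 1) * c) * g x + q * c powr (q - 1) * (g x * f x))"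
      by (simp add: algebra_simps)
    also have "(LINT x|M. (c powr q - q * c powr (q - 1) * c) * g x + q * c powr (q - 1) * (g x * f x))
        = (c powr q - q * c powr (q - 1) * c) * \<kappa> + q * c powr (q - 1) * I"
      using g(1) gf by (simp add: I_def \<kappa>_def)
    also have "\<dots> = c powr q * \<kappa>" using k by (simp add: c_def algebra_simps)
    finally have 1: "c powr q * \<kappa> \<le> (LINT x|M. g x * f x powr q)" .
    have "I powr q = (c * \<kappa>) powr q" using k by (simp add: c_def)
    also have "\<dots> = \<kappa> powr (q - 1) * (c powr q * \<kappa>)"
      using c k powr_mult_base[of \<kappa> "q - 1"] by (simp add: powr_mult ac_simps)
    also have "\<dots> \<le> \<kappa> powr (q - 1) * (LINT x|M. g x * f x powr q)" by (intro mult_left_mono 1) auto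
    finally show ?thesis unfolding I_def \<kappa>_def .
  qed
qed

section \<open>Borel representatives in Lebesgue spaces\<close>

lemma complex_borel_representative:
  fixes u :: "'a::euclidean_space \<Rightarrow> complex"
  assumes [measurable]: "u \<in> borel_measurable lebesgue"
  obtains u' where "u' \<in> borel_measurable borel" "AE x in lborel. u x = u' x"
proof -
  obtain a where a: "a \<in> borel_measurable lborel" "AE x in lborel. Re (u x) = a x"
    using completion_ex_borel_measurable_real[of "\<lambda>x. Re (u x)" lborel] by auto
  obtain b where b: "b \<in> borel_measurable lborel" "AE x in lborel. Im (u x) = b x"
    using completion_ex_borel_measurable_real[of "\<lambda>x. Im (u x)" lborel] by auto
  have [measurable]: "a \<in> borel_measurable borel" "b \<in> borel_measurable borel" using a(1) b(1) by simp_all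
  have "(\<lambda>x. Complex (a x) (b x)) \<in> borel_measurable borel"
    unfolding Complex_eq by measurable
  moreover have "AE x in lborel. u x = Complex (a x) (b x)"
    using a(2) b(2) by eventually_elim (simp add: complex_eq_iff)
  ultimately show ?thesis using that by blast
qed

lemma Lp_AE_cong:
  assumes u: "u \<in> Lp p" and v: "v \<in> borel_measurable lebesgue" and eq: "AE x in lebesgue. u x = v x"
  shows "v \<in> Lp p" "Lp_norm p v = Lp_norm p u"
proof -
  have um: "u \<in> borel_measurable lebesgue" using u by (simp add: Lp_def)
  note [measurable] = um v
  have 1: "esssup lebesgue (\<lambda>x. ereal (norm (v x))) = esssup lebesgue (\<lambda>x. ereal (norm (u x)))"
    using eq by (intro esssup_AE_cong) (auto elim: eventually_mono)
  have 2: "integrable lebesgue (\<lambda>x. norm (v x) powr enn2real p) \<longleftrightarrow> integrable lebesgue (\<lambda>x. norm (u x) powr enn2real p)"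
    using eq by (intro integrable_cong_AE) (auto elim: eventually_mono)
  have 3: "(LINT x|lebesgue. norm (v x) powr enn2real p) = (LINT x|lebesgue. norm (u x) powr enn2real p)"
    using eq by (intro integral_cong_AE) (auto elim: eventually_mono)
  show "v \<in> Lp p" using u v by (auto simp: Lp_def 1 2)
  show "Lp_norm p v = Lp_norm p u" by (simp add: Lp_norm_def 1 3)
qed

lemma borel_imp_lebesgue_measurable: "v \<in> borel_measurable borel \<Longrightarrow> v \<in> borel_measurable lebesgue"
  by (simp add: measurable_completion)

lemma enn2real_ge_1:
  assumes "1 \<le> p" "p \<noteq> \<infinity>"
  shows "1 \<le> enn2real p"
  using assms by (cases p) (auto simp: ennreal_1[symmetric] simp del: ennreal_1)

lemma Lp_infinity_bound:
  fixes u :: "real ^ 'n::finite \<Rightarrow> complex"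
  assumes u: "u \<in> Lp \<infinity>"
  shows "AE x in lebesgue. norm (u x) \<le> Lp_norm \<infinity> u" "Lp_norm \<infinity> u \<ge> 0"
proof -
  define S where "S = esssup lebesgue (\<lambda>x. ereal (norm (u x)))"
  have S1: "S < \<infinity>" using u by (simp add: Lp_def S_def)
  have ae: "AE x in lebesgue. ereal (norm (u x)) \<le> S" unfolding S_def by (rule esssup_AE)
  have S0: "S \<ge> 0"
  proof (rule ccontr)
    assume "\<not> S \<ge> 0"
    have "AE x in (lebesgue :: (real ^ 'n) measure). \<not> True"
    proof (rule eventually_mono[OF ae])
      fix x assume le: "ereal (norm (u x)) \<le> S"
      have "(0::ereal) \<le> ereal (norm (u x))" by simp
      then show "\<not> True" using le \<open>\<not> S \<ge> 0\<close> order_trans by blast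
    qed
    then have "AE x in (lborel :: (real ^ 'n) measure). \<not> True" unfolding AE_completion_iff .
    then have "emeasure (lborel :: (real ^ 'n) measure) {x \<in> space lborel. True} = 0"
      by (rule emeasure_eq_0_AE)
    then show False by simp
  qed
  have S: "S = ereal (Lp_norm \<infinity> u)" using S0 S1 by (cases S) (auto simp: Lp_norm_def S_def)
  show "AE x in lebesgue. norm (u x) \<le> Lp_norm \<infinity> u" using ae unfolding S by simp
  show "Lp_norm \<infinity> u \<ge> 0" using S0 unfolding S by simp
qed

lemma Lp_infinityI:
  assumes v: "v \<in> borel_measurable borel" and ae: "AE x in lborel. norm (v x) \<le> B"
  shows "v \<in> Lp \<infinity>" "B \<ge> 0 \<Longrightarrow> Lp_norm \<infinity> v \<le> B"
proof -
  have [measurable]: "v \<in> borel_measurable lebesgue" by (rule borel_imp_lebesgue_measurable[OF v])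
  have le: "esssup lebesgue (\<lambda>x. ereal (norm (v x))) \<le> ereal B"
    using AE_completion[OF ae] by (intro esssup_I) auto
  then have "esssup lebesgue (\<lambda>x. ereal (norm (v x))) < \<infinity>" by (rule le_less_trans) simp
  then show "v \<in> Lp \<infinity>" by (simp add: Lp_def)
  show "Lp_norm \<infinity> v \<le> B" if "B \<ge> 0"
    using real_of_ereal_positive_mono[of "esssup lebesgue (\<lambda>x. ereal (norm (v x)))" "ereal B"] le that
    by (cases "esssup lebesgue (\<lambda>x. ereal (norm (v x)))") (auto simp: Lp_norm_def)
qed

lemma Lp_finite_iff:
  assumes v: "v \<in> borel_measurable borel" and p: "p \<noteq> \<infinity>"
  shows "v \<in> Lp p \<longleftrightarrow> integrable lborel (\<lambda>x. norm (v x) powr enn2real p)"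
    "Lp_norm p v = (LINT x|lborel. norm (v x) powr enn2real p) powr (1 / enn2real p)"
proof -
  have m: "(\<lambda>x. norm (v x) powr enn2real p) \<in> borel_measurable lborel" using v by simp
  show "v \<in> Lp p \<longleftrightarrow> integrable lborel (\<lambda>x. norm (v x) powr enn2real p)"
    using p borel_imp_lebesgue_measurable[OF v] by (simp add: Lp_def integrable_completion[OF m])
  show "Lp_norm p v = (LINT x|lborel. norm (v x) powr enn2real p) powr (1 / enn2real p)"
    using p by (simp add: Lp_norm_def integral_completion[OF m])
qed

lemma Lp_norm_nonneg: "u \<in> Lp p \<Longrightarrow> Lp_norm p u \<ge> 0"
  using Lp_infinity_bound(2) by (cases "p = \<infinity>") (auto simp: Lp_norm_def)

text \<open>Lebesgue measurable functions are replaced by Borel functions, for which product measures behave well. The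
bound \<open>B + e\<close> by a constant plus an integrable function is the only information on integrability that the pairings
below use, and it is common to all exponents: \<open>|u| \<le> 1 + |u|\<^sup>p\<close> for finite \<open>p\<close>, and \<open>|u| \<le> B\<close> everywhere,
after a change on a null set, for infinite \<open>p\<close>.\<close>

lemma Lp_representative:
  fixes u :: "real ^ 'n::finite \<Rightarrow> complex"
  assumes u: "u \<in> Lp p" and p: "1 \<le> p"
  obtains u' B e where "u' \<in> borel_measurable borel" "AE x in lborel. u x = u' x"
    "u' \<in> Lp p" "Lp_norm p u' = Lp_norm p u"
    "B \<ge> 0" "integrable lborel e" "\<And>x. e x \<ge> 0" "\<And>x. norm (u' x) \<le> B + e x"
    "p = \<infinity> \<Longrightarrow> B = Lp_norm p u \<and> e = (\<lambda>_. 0)"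
proof -
  have um: "u \<in> borel_measurable lebesgue" using u by (simp add: Lp_def)
  obtain v where v: "v \<in> borel_measurable borel" "AE x in lborel. u x = v x"
    using complex_borel_representative[OF um] by blast
  show ?thesis
  proof (cases "p = \<infinity>")
    case True
    define B where "B = Lp_norm p u"
    define u' where "u' x = (if norm (v x) \<le> B then v x else 0)" for x
    have u'm: "u' \<in> borel_measurable borel" unfolding u'_def[abs_def] using v(1) by measurable
    have "AE x in lborel. norm (u x) \<le> B"
      using Lp_infinity_bound(1) u True unfolding B_def AE_completion_iff by blast
    with v(2) have eq: "AE x in lborel. u x = u' x"
      by eventually_elim (simp add: u'_def)
    note c = Lp_AE_cong[OF u borel_imp_lebesgue_measurable[OF u'm] AE_completion[OF eq]]
    have B: "B \<ge> 0" using Lp_norm_nonneg[OF u] by (simp add: B_def)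
    show ?thesis
    proof (rule that[of u' B "\<lambda>_. 0"])
      show "norm (u' x) \<le> B + 0" for x by (simp add: u'_def B)
    qed (use u'm eq c B True in \<open>auto simp: B_def\<close>)
  next
    case False
    note c = Lp_AE_cong[OF u borel_imp_lebesgue_measurable[OF v(1)] AE_completion[OF v(2)]]
    have i: "integrable lborel (\<lambda>x. norm (v x) powr enn2real p)"
      using Lp_finite_iff(1)[OF v(1) False] c(1) by simp
    have le: "norm (v x) \<le> 1 + norm (v x) powr enn2real p" for x
    proof (cases "norm (v x) \<le> 1")
      case False
      then have "norm (v x) powr 1 \<le> norm (v x) powr enn2real p"
        using enn2real_ge_1[OF p \<open>p \<noteq> \<infinity>\<close>] by (intro powr_mono) auto
      then show ?thesis using False by simp
    qed (simp add: add_increasing2)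
    show ?thesis
      by (rule that[of v 1 "\<lambda>x. norm (v x) powr enn2real p"]) (use v c i le False in auto)
  qed
qed

section \<open>Convolution on Lebesgue spaces\<close>

lemma integrable_weighted_product:
  fixes u \<phi> :: "real ^ 'n::finite \<Rightarrow> complex"
  assumes [measurable]: "u \<in> borel_measurable borel" and \<phi>: "weighted \<phi>"
    and B: "B \<ge> 0" "integrable lborel e" "\<And>x. e x \<ge> 0" "\<And>x. norm (u x) \<le> B + e x"
  shows "integrable lborel (\<lambda>x. u x * \<phi> x)"
proof -
  obtain C where C: "C \<ge> 0" "\<And>x. norm (\<phi> x) \<le> C * weight x" using weightedE[OF \<phi>] by blast
  note [measurable] = weighted_measurable[OF \<phi>]
  show ?thesis
  proof (rule Bochner_Integration.integrable_bound)
    show "integrable lborel (\<lambda>x. C * (B * weight x + e x))"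
      by (intro integrable_mult_right Bochner_Integration.integrable_add integrable_weight B)
    show "AE x in lborel. norm (u x * \<phi> x) \<le> norm (C * (B * weight x + e x))"
    proof (rule AE_I2)
      fix x
      have "norm (u x * \<phi> x) \<le> (B + e x) * (C * weight x)"
        unfolding norm_mult using B(1) B(3)[of x] by (intro mult_mono B C) auto
      also have "\<dots> = C * (B * weight x + e x * weight x)" by (simp add: algebra_simps)
      also have "\<dots> \<le> C * (B * weight x + e x)"
        using weight_le_1[of x] B(3)[of x] by (intro mult_left_mono add_left_mono C) (auto intro: mult_left_le)
      also have "\<dots> \<le> norm (C * (B * weight x + e x))" by simp
      finally show "norm (u x * \<phi> x) \<le> norm (C * (B * weight x + e x))" .
    qed
  qed measurable
qed

lemma convolution_pair_integrable:
  fixes \<kappa> :: "real ^ 'n::finite \<Rightarrow> complex"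
  assumes \<kappa>: "integrable lborel \<kappa>" and e: "integrable lborel (e :: real ^ 'n \<Rightarrow> real)"
  shows "integrable (lborel \<Otimes>\<^sub>M lborel) (\<lambda>(x, y). norm (\<kappa> (x - y)) * e x)"
    and "integrable (lborel \<Otimes>\<^sub>M lborel) (\<lambda>(x, y). norm (\<kappa> (x - y)) * e y)"
    and "(LINT y|lborel. LINT x|lborel. norm (\<kappa> (x - y)) * e x) = (LINT z|lborel. norm (\<kappa> z)) * (LINT x|lborel. e x)"
proof -
  have [measurable]: "\<kappa> \<in> borel_measurable borel" "e \<in> borel_measurable borel" using \<kappa> e by auto
  have n: "integrable lborel (\<lambda>z. norm (\<kappa> z))" using \<kappa> by (rule integrable_norm)
  have i1: "integrable lborel (\<lambda>y. norm (\<kappa> (x - y)))" "(LINT y|lborel. norm (\<kappa> (x - y))) = (LINT z|lborel. norm (\<kappa> z))" for x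
    by (rule integrable_lborel_reflect[OF n]) (rule integral_lborel_reflect, measurable)
  have i2: "integrable lborel (\<lambda>x. norm (\<kappa> (x - y)))" "(LINT x|lborel. norm (\<kappa> (x - y))) = (LINT z|lborel. norm (\<kappa> z))" for y
    using integrable_lborel_affine[OF n, of 1 "- y"] integral_lborel_translate[of "\<lambda>z. norm (\<kappa> z)" "- y"] by simp_all
  show 1: "integrable (lborel \<Otimes>\<^sub>M lborel) (\<lambda>(x, y). norm (\<kappa> (x - y)) * e x)"
  proof (rule lborel_pair.Fubini_integrable)
    show "(\<lambda>(x, y). norm (\<kappa> (x - y)) * e x) \<in> borel_measurable (lborel \<Otimes>\<^sub>M lborel)" by measurable
    show "integrable lborel (\<lambda>x. LINT y|lborel. norm (case (x, y) of (x, y) \<Rightarrow> norm (\<kappa> (x - y)) * e x))"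
      using e by (simp add: abs_mult i1)
    show "AE x in lborel. integrable lborel (\<lambda>y. case (x, y) of (x, y) \<Rightarrow> norm (\<kappa> (x - y)) * e x)"
      by (simp add: i1)
  qed
  have "integrable (lborel \<Otimes>\<^sub>M lborel) (\<lambda>(y, x). norm (\<kappa> (x - y)) * e y)"
  proof (rule lborel_pair.Fubini_integrable)
    show "(\<lambda>(y, x). norm (\<kappa> (x - y)) * e y) \<in> borel_measurable (lborel \<Otimes>\<^sub>M lborel)" by measurable
    show "integrable lborel (\<lambda>y. LINT x|lborel. norm (case (y, x) of (y, x) \<Rightarrow> norm (\<kappa> (x - y)) * e y))"
      using e by (simp add: abs_mult i2)
    show "AE y in lborel. integrable lborel (\<lambda>x. case (y, x) of (y, x) \<Rightarrow> norm (\<kappa> (x - y)) * e y)"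
      by (simp add: i2)
  qed
  from lborel_pair.integrable_product_swap[OF this]
  show "integrable (lborel \<Otimes>\<^sub>M lborel) (\<lambda>(x, y). norm (\<kappa> (x - y)) * e y)" by simp
  have "(LINT y|lborel. LINT x|lborel. norm (\<kappa> (x - y)) * e x) = (LINT x|lborel. LINT y|lborel. norm (\<kappa> (x - y)) * e x)"
    by (rule lborel_pair.Fubini_integral[OF 1])
  also have "\<dots> = (LINT z|lborel. norm (\<kappa> z)) * (LINT x|lborel. e x)"
    by (simp add: i1)
  finally show "(LINT y|lborel. LINT x|lborel. norm (\<kappa> (x - y)) * e x) = (LINT z|lborel. norm (\<kappa> z)) * (LINT x|lborel. e x)" .
qed

text \<open>The kernel is reflected, as it arises when a convolution operator is moved to the other side of a pairing.\<close>

definition conv :: "(real ^ 'n::finite \<Rightarrow> complex) \<Rightarrow> (real ^ 'n \<Rightarrow> complex) \<Rightarrow> (real ^ 'n \<Rightarrow> complex)" where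
  "conv \<kappa> u y = (LINT x|lborel. \<kappa> (x - y) * u x)"

lemma measurable_conv:
  assumes [measurable]: "\<kappa> \<in> borel_measurable borel" "u \<in> borel_measurable borel"
  shows "conv \<kappa> u \<in> borel_measurable borel"
  unfolding conv_def[abs_def] by measurable

text \<open>Fubini's theorem; the double integral is dominated by \<open>B |\<kappa>(x - y)| |\<phi>(y)| + C |\<kappa>(x - y)| e(x)\<close> with \<open>C\<close> a
bound of \<open>\<phi>\<close>.\<close>

lemma conv_pairing:
  fixes \<kappa> u \<phi> :: "real ^ 'n::finite \<Rightarrow> complex"
  assumes \<kappa>: "integrable lborel \<kappa>" and um: "u \<in> borel_measurable borel"
    and B: "B \<ge> 0" "integrable lborel e" "\<And>x. e x \<ge> 0" "\<And>x. norm (u x) \<le> B + e x"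
    and \<phi>: "weighted \<phi>"
  shows "(LINT x|lborel. u x * (LINT y|lborel. \<kappa> (x - y) * \<phi> y)) = (LINT y|lborel. conv \<kappa> u y * \<phi> y)"
proof -
  note [measurable] = um weighted_measurable[OF \<phi>]
  have [measurable]: "\<kappa> \<in> borel_measurable borel" using \<kappa> by auto
  obtain C where C: "C \<ge> 0" "\<And>x. norm (\<phi> x) \<le> C * weight x" using weightedE[OF \<phi>] by blast
  have C1: "norm (\<phi> x) \<le> C" for x
    using C(2)[of x] mult_left_mono[OF weight_le_1[of x] C(1)] by simp
  have i: "integrable (lborel \<Otimes>\<^sub>M lborel) (\<lambda>(x, y). u x * (\<kappa> (x - y) * \<phi> y))"
  proof (rule Bochner_Integration.integrable_bound)
    show "integrable (lborel \<Otimes>\<^sub>M lborel) (\<lambda>p. B * (case p of (x, y) \<Rightarrow> norm (\<kappa> (x - y)) * norm (\<phi> y)) + C * (case p of (x, y) \<Rightarrow> norm (\<kappa> (x - y)) * e x))"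
      by (intro Bochner_Integration.integrable_add integrable_mult_right convolution_pair_integrable \<kappa> B integrable_norm weighted_integrable \<phi>)
    show "(\<lambda>(x, y). u x * (\<kappa> (x - y) * \<phi> y)) \<in> borel_measurable (lborel \<Otimes>\<^sub>M lborel)" by measurable
    show "AE p in lborel \<Otimes>\<^sub>M lborel. norm (case p of (x, y) \<Rightarrow> u x * (\<kappa> (x - y) * \<phi> y))
      \<le> norm (B * (case p of (x, y) \<Rightarrow> norm (\<kappa> (x - y)) * norm (\<phi> y)) + C * (case p of (x, y) \<Rightarrow> norm (\<kappa> (x - y)) * e x))"
    proof (rule AE_I2)
      fix p :: "(real ^ 'n) \<times> (real ^ 'n)"
      obtain x y where p: "p = (x, y)" by (cases p)
      have "norm (u x) * (norm (\<kappa> (x - y)) * norm (\<phi> y)) \<le> (B + e x) * (norm (\<kappa> (x - y)) * norm (\<phi> y))"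
        by (intro mult_right_mono B) auto
      also have "\<dots> = B * (norm (\<kappa> (x - y)) * norm (\<phi> y)) + norm (\<phi> y) * (norm (\<kappa> (x - y)) * e x)"
        by (simp add: algebra_simps)
      also have "\<dots> \<le> B * (norm (\<kappa> (x - y)) * norm (\<phi> y)) + C * (norm (\<kappa> (x - y)) * e x)"
        by (intro add_left_mono mult_right_mono C1 mult_nonneg_nonneg B) auto
      finally show "norm (case p of (x, y) \<Rightarrow> u x * (\<kappa> (x - y) * \<phi> y))
        \<le> norm (B * (case p of (x, y) \<Rightarrow> norm (\<kappa> (x - y)) * norm (\<phi> y)) + C * (case p of (x, y) \<Rightarrow> norm (\<kappa> (x - y)) * e x))"
        unfolding p by (simp add: norm_mult)
    qed
  qed
  have "(LINT x|lborel. u x * (LINT y|lborel. \<kappa> (x - y) * \<phi> y)) = (LINT x|lborel. LINT y|lborel. u x * (\<kappa> (x - y) * \<phi> y))"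
    by simp
  also have "\<dots> = (LINT y|lborel. LINT x|lborel. u x * (\<kappa> (x - y) * \<phi> y))"
    by (rule lborel_pair.Fubini_integral[OF i, symmetric])
  also have "\<dots> = (LINT y|lborel. conv \<kappa> u y * \<phi> y)"
  proof (rule Bochner_Integration.integral_cong[OF refl])
    fix y
    have e: "conv \<kappa> u y * \<phi> y = (LINT x|lborel. \<kappa> (x - y) * u x * \<phi> y)"
      unfolding conv_def by (rule integral_mult_left_zero[symmetric])
    show "(LINT x|lborel. u x * (\<kappa> (x - y) * \<phi> y)) = conv \<kappa> u y * \<phi> y"
      unfolding e by (simp only: mult_ac)
  qed
  finally show ?thesis .
qed

lemma norm_conv_le:
  assumes "integrable lborel (\<lambda>x. norm (\<kappa> (x - y)) * norm (u x))"
  shows "norm (conv \<kappa> u y) \<le> (LINT x|lborel. norm (\<kappa> (x - y)) * norm (u x))"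
proof -
  have "norm (conv \<kappa> u y) \<le> (LINT x|lborel. norm (\<kappa> (x - y) * u x))"
    unfolding conv_def by (rule integral_norm_bound)
  then show ?thesis by (simp add: norm_mult)
qed

text \<open>For finite exponents Jensen's inequality with density \<open>|\<kappa>(x - y)|\<close> bounds the power of the convolution by
the convolution of the power, whose integral Fubini's theorem evaluates.\<close>

theorem young_inequality:
  fixes \<kappa> u :: "real ^ 'n::finite \<Rightarrow> complex"
  assumes \<kappa>: "integrable lborel \<kappa>" and p: "1 \<le> p" and um: "u \<in> borel_measurable borel" and u: "u \<in> Lp p"
    and bd: "p = \<infinity> \<longrightarrow> (\<forall>x. norm (u x) \<le> Lp_norm p u)"
  shows "conv \<kappa> u \<in> Lp p" "Lp_norm p (conv \<kappa> u) \<le> (LINT z|lborel. norm (\<kappa> z)) * Lp_norm p u"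
proof -
  note [measurable] = um
  have km[measurable]: "\<kappa> \<in> borel_measurable borel" using \<kappa> by auto
  have cm[measurable]: "conv \<kappa> u \<in> borel_measurable borel" by (rule measurable_conv[OF km um])
  define K where "K = (LINT z|lborel. norm (\<kappa> z))"
  have K0: "K \<ge> 0" by (simp add: K_def)
  have n: "integrable lborel (\<lambda>z. norm (\<kappa> z))" using \<kappa> by (rule integrable_norm)
  have i2: "integrable lborel (\<lambda>x. norm (\<kappa> (x - y)))" "(LINT x|lborel. norm (\<kappa> (x - y))) = K" for y
    using integrable_lborel_affine[OF n, of 1 "- y"] integral_lborel_translate[of "\<lambda>z. norm (\<kappa> z)" "- y"] by (simp_all add: K_def)
  have "conv \<kappa> u \<in> Lp p \<and> Lp_norm p (conv \<kappa> u) \<le> K * Lp_norm p u"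
  proof (cases "p = \<infinity>")
    case True
    define B where "B = Lp_norm p u"
    have B: "B \<ge> 0" "\<And>x. norm (u x) \<le> B" using Lp_norm_nonneg[OF u] bd True by (auto simp: B_def)
    have "norm (conv \<kappa> u y) \<le> K * B" for y
    proof -
      have le: "norm (\<kappa> (x - y)) * norm (u x) \<le> norm (\<kappa> (x - y)) * B" for x by (intro mult_left_mono B) auto
      have i: "integrable lborel (\<lambda>x. norm (\<kappa> (x - y)) * norm (u x))"
      proof (rule Bochner_Integration.integrable_bound)
        show "integrable lborel (\<lambda>x. norm (\<kappa> (x - y)) * B)" by (intro integrable_mult_left i2)
        show "AE x in lborel. norm (norm (\<kappa> (x - y)) * norm (u x)) \<le> norm (norm (\<kappa> (x - y)) * B)"
          using le B by (simp add: abs_mult)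
      qed measurable
      have "norm (conv \<kappa> u y) \<le> (LINT x|lborel. norm (\<kappa> (x - y)) * norm (u x))" by (rule norm_conv_le[OF i])
      also have "\<dots> \<le> (LINT x|lborel. norm (\<kappa> (x - y)) * B)"
        by (intro integral_mono i integrable_mult_left i2 le)
      finally show ?thesis using i2(2)[of y] by simp
    qed
    then have "AE y in lborel. norm (conv \<kappa> u y) \<le> K * B" by simp
    from Lp_infinityI[OF cm this] show ?thesis using True B K0 by (simp add: B_def)
  next
    case False
    define q where "q = enn2real p"
    have q: "q \<ge> 1" unfolding q_def by (rule enn2real_ge_1[OF p False])
    define e where "e x = norm (u x) powr q" for x
    have ei: "integrable lborel e" using Lp_finite_iff(1)[OF um False] u by (simp add: e_def[abs_def] q_def)
    note P = convolution_pair_integrable[OF \<kappa> ei]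
    define G where "G y = (LINT x|lborel. norm (\<kappa> (x - y)) * e x)" for y
    have Gi: "integrable lborel G" unfolding G_def using lborel_pair.integrable_snd[OF P(1)] .
    have ae: "AE y in lborel. norm (conv \<kappa> u y) powr q \<le> K powr (q - 1) * G y"
      using lborel_pair.AE_integrable_snd[OF P(1)]
    proof eventually_elim
      case (elim y)
      have le: "norm (u x) \<le> 1 + e x" for x
      proof (cases "norm (u x) \<le> 1")
        case False
        then have "norm (u x) powr 1 \<le> norm (u x) powr q" using q by (intro powr_mono) auto
        then show ?thesis using False by (simp add: e_def)
      qed (simp add: e_def add_increasing2)
      have i: "integrable lborel (\<lambda>x. norm (\<kappa> (x - y)) * norm (u x))"
      proof (rule Bochner_Integration.integrable_bound)
        show "integrable lborel (\<lambda>x. norm (\<kappa> (x - y)) + norm (\<kappa> (x - y)) * e x)"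
          by (intro Bochner_Integration.integrable_add i2 elim)
        show "AE x in lborel. norm (norm (\<kappa> (x - y)) * norm (u x)) \<le> norm (norm (\<kappa> (x - y)) + norm (\<kappa> (x - y)) * e x)"
        proof (rule AE_I2)
          fix x
          have "norm (\<kappa> (x - y)) * norm (u x) \<le> norm (\<kappa> (x - y)) * (1 + e x)" by (intro mult_left_mono le) auto
          then show "norm (norm (\<kappa> (x - y)) * norm (u x)) \<le> norm (norm (\<kappa> (x - y)) + norm (\<kappa> (x - y)) * e x)"
            by (simp add: abs_mult distrib_left)
        qed
      qed measurable
      have "norm (conv \<kappa> u y) powr q \<le> (LINT x|lborel. norm (\<kappa> (x - y)) * norm (u x)) powr q"
        using q by (intro powr_mono2 norm_conv_le i) auto
      also have "\<dots> \<le> (LINT x|lborel. norm (\<kappa> (x - y))) powr (q - 1) * (LINT x|lborel. norm (\<kappa> (x - y)) * norm (u x) powr q)"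
        by (rule powr_integral_le[OF q i2(1) _ _ i]) (use elim in \<open>auto simp: e_def\<close>)
      finally show ?case unfolding i2 G_def e_def .
    qed
    have G0: "G y \<ge> 0" for y unfolding G_def e_def by (intro Bochner_Integration.integral_nonneg) auto
    have ci: "integrable lborel (\<lambda>y. norm (conv \<kappa> u y) powr q)"
    proof (rule Bochner_Integration.integrable_bound)
      show "integrable lborel (\<lambda>y. K powr (q - 1) * G y)" by (intro integrable_mult_right Gi)
      show "AE y in lborel. norm (norm (conv \<kappa> u y) powr q) \<le> norm (K powr (q - 1) * G y)"
        using ae by eventually_elim (use G0 in simp)
    qed measurable
    have I0: "(LINT x|lborel. e x) \<ge> 0" unfolding e_def by (intro Bochner_Integration.integral_nonneg) auto
    have "(LINT y|lborel. norm (conv \<kappa> u y) powr q) \<le> (LINT y|lborel. K powr (q - 1) * G y)"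
      by (rule integral_mono_AE[OF ci _ ae]) (intro integrable_mult_right Gi)
    also have "\<dots> = K powr (q - 1) * (K * (LINT x|lborel. e x))"
      using P(3) by (simp add: G_def K_def)
    also have "\<dots> = K powr q * (LINT x|lborel. e x)"
      using powr_mult_base[OF K0, of "q - 1"] by (simp add: ac_simps)
    finally have "(LINT y|lborel. norm (conv \<kappa> u y) powr q) powr (1 / q) \<le> (K powr q * (LINT x|lborel. e x)) powr (1 / q)"
      using q by (intro powr_mono2) (auto intro!: Bochner_Integration.integral_nonneg)
    also have "\<dots> = K * (LINT x|lborel. e x) powr (1 / q)"
      using q K0 I0 by (simp add: powr_mult powr_powr)
    finally show ?thesis
      using Lp_finite_iff[OF cm False] Lp_finite_iff[OF um False] ci by (simp add: q_def e_def)
  qed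
  then show "conv \<kappa> u \<in> Lp p" "Lp_norm p (conv \<kappa> u) \<le> (LINT z|lborel. norm (\<kappa> z)) * Lp_norm p u"
    by (auto simp: K_def)
qed

text \<open>Any constant suffices for the estimate, so the sharp triangle inequality is replaced by
\<open>|v + w| \<le> 2 max(|v|, |w|)\<close>.\<close>

lemma Lp_add:
  fixes v w :: "real ^ 'n::finite \<Rightarrow> complex"
  assumes p: "1 \<le> p" and vm: "v \<in> borel_measurable borel" and wm: "w \<in> borel_measurable borel"
    and v: "v \<in> Lp p" and w: "w \<in> Lp p"
  shows "(\<lambda>x. v x + w x) \<in> Lp p" "Lp_norm p (\<lambda>x. v x + w x) \<le> 4 * (Lp_norm p v + Lp_norm p w)"
proof -
  note [measurable] = vm wm
  have m: "(\<lambda>x. v x + w x) \<in> borel_measurable borel" by measurable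
  have "(\<lambda>x. v x + w x) \<in> Lp p \<and> Lp_norm p (\<lambda>x. v x + w x) \<le> 4 * (Lp_norm p v + Lp_norm p w)"
  proof (cases "p = \<infinity>")
    case True
    have "AE x in lborel. norm (v x) \<le> Lp_norm p v" "AE x in lborel. norm (w x) \<le> Lp_norm p w"
      using Lp_infinity_bound(1)[of v] Lp_infinity_bound(1)[of w] v w True unfolding AE_completion_iff by auto
    then have "AE x in lborel. norm (v x + w x) \<le> Lp_norm p v + Lp_norm p w"
      by eventually_elim (rule order_trans[OF norm_triangle_ineq add_mono])
    from Lp_infinityI[OF m this] show ?thesis
      using True Lp_norm_nonneg[OF v] Lp_norm_nonneg[OF w] by simp
  next
    case False
    define q where "q = enn2real p"
    have q: "q \<ge> 1" unfolding q_def by (rule enn2real_ge_1[OF p False])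
    have vi: "integrable lborel (\<lambda>x. norm (v x) powr q)" and wi: "integrable lborel (\<lambda>x. norm (w x) powr q)"
      using Lp_finite_iff(1)[OF vm False] Lp_finite_iff(1)[OF wm False] v w by (auto simp: q_def)
    have le: "norm (v x + w x) powr q \<le> 2 powr q * (norm (v x) powr q + norm (w x) powr q)" for x
    proof -
      have "norm (v x + w x) powr q \<le> (2 * max (norm (v x)) (norm (w x))) powr q"
        using q norm_triangle_ineq[of "v x" "w x"] by (intro powr_mono2) auto
      also have "\<dots> = 2 powr q * max (norm (v x)) (norm (w x)) powr q" by (simp add: powr_mult)
      also have "\<dots> \<le> 2 powr q * (norm (v x) powr q + norm (w x) powr q)"
        by (intro mult_left_mono) (auto simp: max_def)
      finally show ?thesis .
    qed
    have si: "integrable lborel (\<lambda>x. norm (v x + w x) powr q)"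
    proof (rule Bochner_Integration.integrable_bound)
      show "integrable lborel (\<lambda>x. 2 powr q * (norm (v x) powr q + norm (w x) powr q))"
        by (intro integrable_mult_right Bochner_Integration.integrable_add vi wi)
    qed (use le in auto)
    define a where "a = (LINT x|lborel. norm (v x) powr q)"
    define b where "b = (LINT x|lborel. norm (w x) powr q)"
    have ab: "a \<ge> 0" "b \<ge> 0" unfolding a_def b_def by (auto intro!: Bochner_Integration.integral_nonneg)
    have "(LINT x|lborel. norm (v x + w x) powr q) \<le> (LINT x|lborel. 2 powr q * (norm (v x) powr q + norm (w x) powr q))"
      by (intro integral_mono si integrable_mult_right Bochner_Integration.integrable_add vi wi le)
    also have "\<dots> = 2 powr q * (a + b)" using vi wi by (simp add: a_def b_def)
    finally have "(LINT x|lborel. norm (v x + w x) powr q) powr (1 / q) \<le> (2 powr q * (a + b)) powr (1 / q)"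
      using q by (intro powr_mono2) (auto intro!: Bochner_Integration.integral_nonneg)
    also have "\<dots> = 2 * (a + b) powr (1 / q)" using q ab by (simp add: powr_mult powr_powr)
    also have "(a + b) powr (1 / q) \<le> (2 * max a b) powr (1 / q)" using q ab by (intro powr_mono2) auto
    also have "(2 * max a b) powr (1 / q) = 2 powr (1 / q) * max a b powr (1 / q)" using ab by (simp add: powr_mult)
    also have "2 powr (1 / q) * max a b powr (1 / q) \<le> 2 * (a powr (1 / q) + b powr (1 / q))"
    proof (rule mult_mono)
      have "2 powr (1 / q) \<le> (2::real) powr 1" using q by (intro powr_mono) auto
      then show "2 powr (1 / q) \<le> (2::real)" by simp
    qed (auto simp: max_def)
    finally have "(LINT x|lborel. norm (v x + w x) powr q) powr (1 / q) \<le> 4 * (a powr (1 / q) + b powr (1 / q))"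
      by simp
    then show ?thesis
      using si unfolding Lp_finite_iff[OF m False] Lp_finite_iff[OF vm False] Lp_finite_iff[OF wm False]
      by (simp add: q_def a_def b_def)
  qed
  then show "(\<lambda>x. v x + w x) \<in> Lp p" "Lp_norm p (\<lambda>x. v x + w x) \<le> 4 * (Lp_norm p v + Lp_norm p w)" by auto
qed

section \<open>Functions as tempered distributions\<close>

lemma pairing_representative:
  fixes u u' \<phi> :: "real ^ 'n::finite \<Rightarrow> complex"
  assumes um: "u \<in> borel_measurable lebesgue" and u': "u' \<in> borel_measurable borel" "AE x in lborel. u x = u' x"
    and \<phi>: "\<phi> \<in> borel_measurable borel"
  shows "(LINT x|lebesgue. u x * \<phi> x) = (LINT x|lborel. u' x * \<phi> x)"
proof -
  note [measurable] = um borel_imp_lebesgue_measurable[OF u'(1)] borel_imp_lebesgue_measurable[OF \<phi>]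
  have m: "(\<lambda>x. u' x * \<phi> x) \<in> borel_measurable lborel" using u'(1) \<phi> by simp
  have ae: "AE x in lebesgue. u x = u' x" using AE_completion[OF u'(2)] .
  have "(LINT x|lebesgue. u x * \<phi> x) = (LINT x|lebesgue. u' x * \<phi> x)"
    using ae by (intro integral_cong_AE) (auto elim: eventually_mono)
  also have "\<dots> = (LINT x|lborel. u' x * \<phi> x)" by (rule integral_completion[OF m])
  finally show "(LINT x|lebesgue. u x * \<phi> x) = (LINT x|lborel. u' x * \<phi> x)" .
qed

lemma schwartz_seminorm_upper:
  assumes "\<phi> \<in> schwartz"
  shows "norm (monomial \<alpha> x * partial_derivs \<beta> \<phi> x) \<le> schwartz_seminorm \<alpha> \<beta> \<phi>"
proof -
  have "bounded (range (\<lambda>x. monomial \<alpha> x * partial_derivs \<beta> \<phi> x))" by (rule schwartzD(2)[OF assms])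
  then obtain C where C: "\<forall>y\<in>range (\<lambda>x. monomial \<alpha> x * partial_derivs \<beta> \<phi> x). norm y \<le> C"
    unfolding bounded_iff by blast
  have "bdd_above (range (\<lambda>x. norm (monomial \<alpha> x * partial_derivs \<beta> \<phi> x)))"
    by (rule bdd_aboveI[of _ C]) (use C in auto)
  then show ?thesis unfolding schwartz_seminorm_def by (intro cSUP_upper) auto
qed

text \<open>Multi-index with entries 2 on \<open>A\<close> and 0 elsewhere: the expansion of \<open>\<Prod> (1 + x\<^sub>i\<^sup>2)\<close> consists of these monomials.\<close>

definition square_index :: "'n set \<Rightarrow> 'n \<Rightarrow> nat" where
  "square_index A i = (if i \<in> A then 2 else 0)"

lemma norm_le_seminorms_weight:
  fixes \<phi> :: "real ^ 'n::finite \<Rightarrow> complex"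
  assumes "\<phi> \<in> schwartz"
  shows "norm (\<phi> x) \<le> (\<Sum>A\<in>UNIV. schwartz_seminorm (square_index A) [] \<phi>) * weight x"
proof -
  have "1 / weight x = (\<Prod>i\<in>UNIV. (x $ i)\<^sup>2 + 1)"
    by (simp add: weight_def prod_dividef add.commute)
  also have "\<dots> = (\<Sum>A\<in>Pow UNIV. (\<Prod>i\<in>A. (x $ i)\<^sup>2) * (\<Prod>i\<in>UNIV - A. 1))"
    by (rule prod_add) simp
  also have "\<dots> = (\<Sum>A\<in>UNIV. norm (monomial (square_index A) x))"
  proof (rule sum.cong)
    fix A :: "'n set"
    have "(\<Prod>i\<in>UNIV. (x $ i) ^ square_index A i) = (\<Prod>i\<in>A. (x $ i) ^ square_index A i)"
      by (rule prod.mono_neutral_right) (auto simp: square_index_def)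
    also have "\<dots> = (\<Prod>i\<in>A. (x $ i)\<^sup>2)" by (rule prod.cong) (auto simp: square_index_def)
    finally show "(\<Prod>i\<in>A. (x $ i)\<^sup>2) * (\<Prod>i\<in>UNIV - A. 1) = norm (monomial (square_index A) x)"
      unfolding monomial_def norm_of_real by (simp add: prod_nonneg)
  qed simp
  finally have w: "1 / weight x = (\<Sum>A\<in>UNIV. norm (monomial (square_index A) x))" .
  have "norm (\<phi> x) / weight x = (\<Sum>A\<in>UNIV. norm (monomial (square_index A) x * partial_derivs [] \<phi> x))"
    using arg_cong[OF w, of "\<lambda>t. t * norm (\<phi> x)"] by (simp add: sum_distrib_right norm_mult)
  also have "\<dots> \<le> (\<Sum>A\<in>UNIV. schwartz_seminorm (square_index A) [] \<phi>)"
    by (intro sum_mono schwartz_seminorm_upper assms)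
  finally show ?thesis using weight_pos[of x] by (simp add: field_simps)
qed

text \<open>By the weighted bound of a Schwartz function by finitely many of its seminorms, the functional is dominated by a
multiple of their sum; so a finite intersection of seminorm balls around \<open>\<phi>\<close> is mapped into a given ball.\<close>

lemma functional_of_tempered:
  fixes u :: "real ^ 'n::finite \<Rightarrow> complex"
  assumes u: "u \<in> Lp p" and p: "1 \<le> p"
  shows "functional_of schwartz u \<in> tempered_distributions"
proof -
  have um: "u \<in> borel_measurable lebesgue" using u by (simp add: Lp_def)
  obtain u' B e where u': "u' \<in> borel_measurable borel" "AE x in lborel. u x = u' x"
    and B: "B \<ge> 0" "integrable lborel e" "\<And>x. e x \<ge> 0" "\<And>x. norm (u' x) \<le> B + e x"
    by (rule Lp_representative[OF u p]) blast
  define T where "T = functional_of schwartz u"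
  have T: "T \<phi> = (LINT x|lborel. u' x * \<phi> x)" if "\<phi> \<in> schwartz" for \<phi>
    unfolding T_def functional_of_def using that
    by (simp add: pairing_representative[OF um u' schwartz_measurable[OF that]])
  have i: "integrable lborel (\<lambda>x. u' x * \<phi> x)" if "\<phi> \<in> schwartz" for \<phi>
    by (rule integrable_weighted_product[OF u'(1) schwartz_weighted[OF that] B])
  have add: "T (\<lambda>x. \<phi> x + \<psi> x) = T \<phi> + T \<psi>" if "\<phi> \<in> schwartz" "\<psi> \<in> schwartz" for \<phi> \<psi>
    using that i by (simp add: T schwartz_add distrib_left)
  have cm: "(\<lambda>x. c * \<phi> x) \<in> schwartz" if "\<phi> \<in> schwartz" for c and \<phi> :: "real ^ 'n \<Rightarrow> complex"
    by (intro schwartz_multiplier multiplier.const that)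
  have cmult: "T (\<lambda>x. c * \<phi> x) = c * T \<phi>" if "\<phi> \<in> schwartz" for c \<phi>
    using that by (simp add: T cm mult.left_commute)
  define K where "K = (LINT x|lborel. norm (u' x) * weight x)"
  have uw: "integrable lborel (\<lambda>x. norm (u' x) * weight x)"
  proof -
    have "weighted (\<lambda>x::real^'n. complex_of_real (weight x))"
      unfolding weighted_def using weight_pos less_imp_le by (intro conjI exI[of _ 1]) (auto simp: abs_of_pos)
    from integrable_norm[OF integrable_weighted_product[OF u'(1) this B]] show ?thesis
      by (simp add: norm_mult abs_of_pos[OF weight_pos])
  qed
  have K0: "K \<ge> 0" unfolding K_def
    by (intro Bochner_Integration.integral_nonneg mult_nonneg_nonneg norm_ge_zero less_imp_le[OF weight_pos])
  have bound: "norm (T \<phi>) \<le> K * (\<Sum>A\<in>UNIV. schwartz_seminorm (square_index A) [] \<phi>)" if \<phi>: "\<phi> \<in> schwartz" for \<phi>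
  proof -
    define S where "S = (\<Sum>A\<in>UNIV. schwartz_seminorm (square_index A) [] \<phi>)"
    have "norm (T \<phi>) \<le> (LINT x|lborel. norm (u' x * \<phi> x))" unfolding T[OF \<phi>] by (rule integral_norm_bound)
    also have "\<dots> \<le> (LINT x|lborel. S * (norm (u' x) * weight x))"
    proof (intro integral_mono integrable_norm i \<phi> integrable_mult_right uw)
      fix x
      have "norm (u' x) * norm (\<phi> x) \<le> norm (u' x) * (S * weight x)"
        unfolding S_def by (intro mult_left_mono norm_le_seminorms_weight \<phi>) auto
      then show "norm (u' x * \<phi> x) \<le> S * (norm (u' x) * weight x)" by (simp add: norm_mult ac_simps)
    qed
    also have "\<dots> = K * S" by (simp add: K_def)
    finally show ?thesis unfolding S_def .
  qed
  have "continuous_map (subtopology schwartz_topology schwartz) euclidean T"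
    unfolding continuous_map_def
  proof (intro conjI allI impI)
    let ?X = "subtopology schwartz_topology schwartz"
    show "T \<in> topspace ?X \<rightarrow> topspace euclidean" by simp
    fix U :: "complex set" assume "openin euclidean U"
    then have U: "open U" by simp
    show "openin ?X {\<phi> \<in> topspace ?X. T \<phi> \<in> U}"
    proof (subst openin_subopen, intro ballI)
      fix \<phi> assume "\<phi> \<in> {\<phi> \<in> topspace ?X. T \<phi> \<in> U}"
      then have \<phi>: "\<phi> \<in> schwartz" "T \<phi> \<in> U" by (auto simp: topspace_subtopology)
      obtain \<epsilon> where \<epsilon>: "\<epsilon> > 0" "ball (T \<phi>) \<epsilon> \<subseteq> U" using U \<phi>(2) open_contains_ball by blast
      define n where "n = real (card (UNIV :: 'n set set))"
      have n: "n > 0" unfolding n_def by (simp add: card_gt_0_iff)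
      define \<delta> where "\<delta> = \<epsilon> / ((K + 1) * n)"
      have \<delta>: "\<delta> > 0" using \<epsilon>(1) K0 n by (simp add: \<delta>_def)
      define N where "N A = {\<psi> \<in> schwartz. schwartz_seminorm (square_index A) [] (\<lambda>x. \<psi> x - \<phi> x) < \<delta>}" for A :: "'n set"
      define W where "W = (\<Inter>A\<in>UNIV. N A)"
      have "openin schwartz_topology (N A)" for A
        unfolding schwartz_topology_def N_def
        by (rule topology_generated_by_Basis) (use \<phi>(1) \<delta> in blast)
      then have "openin schwartz_topology W"
        unfolding W_def by (intro openin_INT2) auto
      moreover have WS: "W \<subseteq> schwartz" unfolding W_def N_def by blast
      ultimately have "openin ?X W"
        unfolding openin_subtopology by (intro exI[of _ W]) auto
      moreover have "\<phi> \<in> W"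
      proof -
        have "partial_derivs [] (\<lambda>x::real^'n. 0::complex) = (\<lambda>x. 0)" by simp
        then show ?thesis using \<phi>(1) \<delta> by (simp add: W_def N_def schwartz_seminorm_def)
      qed
      moreover have "W \<subseteq> {\<phi> \<in> topspace ?X. T \<phi> \<in> U}"
      proof
        fix \<psi> assume \<psi>W: "\<psi> \<in> W"
        then have \<psi>: "\<psi> \<in> schwartz" using WS by blast
        have d: "(\<lambda>x. \<psi> x - \<phi> x) \<in> schwartz"
          using schwartz_add[OF \<psi> cm[OF \<phi>(1), of "-1"]] by simp
        have "T \<psi> = T (\<lambda>x. \<phi> x + (\<psi> x - \<phi> x))" by simp
        also have "\<dots> = T \<phi> + T (\<lambda>x. \<psi> x - \<phi> x)" by (rule add[OF \<phi>(1) d])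
        finally have "norm (T \<psi> - T \<phi>) \<le> K * (\<Sum>A\<in>UNIV. schwartz_seminorm (square_index A) [] (\<lambda>x. \<psi> x - \<phi> x))"
          using bound[OF d] by simp
        also have "\<dots> \<le> K * (\<Sum>A\<in>(UNIV :: 'n set set). \<delta>)"
          using \<psi>W K0 by (intro mult_left_mono sum_mono) (auto simp: W_def N_def less_imp_le)
        also have "\<dots> = K * (n * \<delta>)" by (simp add: n_def)
        also have "\<dots> < (K + 1) * (n * \<delta>)" using n \<delta> by simp
        also have "\<dots> = \<epsilon>" using n K0 by (simp add: \<delta>_def)
        finally have "T \<psi> \<in> ball (T \<phi>) \<epsilon>" by (simp add: dist_norm norm_minus_commute)
        then have "T \<psi> \<in> U" using \<epsilon>(2) by blast
        moreover have "\<psi> \<in> topspace ?X" using openin_subset[OF \<open>openin ?X W\<close>] \<psi>W by blast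
        ultimately show "\<psi> \<in> {\<phi> \<in> topspace ?X. T \<phi> \<in> U}" by blast
      qed
      ultimately show "\<exists>W. openin ?X W \<and> \<phi> \<in> W \<and> W \<subseteq> {\<phi> \<in> topspace ?X. T \<phi> \<in> U}" by blast
    qed
  qed
  moreover have "T \<in> extensional schwartz" by (simp add: T_def functional_of_def)
  ultimately show ?thesis
    unfolding dual_of_def T_def[symmetric] using add cmult by blast
qed

section \<open>Uniqueness of the representing function\<close>

lemma cutoff_bounds: "0 \<le> cutoff T t" "cutoff T t \<le> 1"
  by (auto simp: cutoff_def flat_def)

lemma multiplier_cutoff_coordinate:
  assumes "k \<ge> 0" "T \<ge> 0"
  shows "(\<lambda>x::real^'n::finite. complex_of_real (cutoff T (k * (x $ i - c)\<^sup>2))) \<in> multiplier"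
proof (rule multiplier.symbol[where d = "-1" and \<sigma> = "\<lambda>x. k * (x $ i - c)\<^sup>2"])
  have "(\<lambda>x::real^'n. complex_of_real k * ((complex_of_real (x $ i) + complex_of_real (- c)) * (complex_of_real (x $ i) + complex_of_real (- c)))) \<in> multiplier"
    by (intro multiplier.intros)
  then show "(\<lambda>x::real^'n. complex_of_real (k * (x $ i - c)\<^sup>2)) \<in> multiplier"
    by (simp add: power2_eq_square)
qed (use assms symb_cutoff in auto)

text \<open>Dilations of the cut-off converge pointwise to the indicator of an interval.\<close>

lemma cutoff_tendsto_indicator:
  assumes "R \<ge> 0"
  shows "(\<lambda>k::nat. cutoff (real (Suc k) * R\<^sup>2) (real (Suc k) * d\<^sup>2)) \<longlonglongrightarrow> (if \<bar>d\<bar> \<le> R then 1 else 0)"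
proof (cases "\<bar>d\<bar> \<le> R")
  case True
  then have "d\<^sup>2 \<le> R\<^sup>2" using abs_le_square_iff[of d R] assms by simp
  then have "cutoff (real (Suc k) * R\<^sup>2) (real (Suc k) * d\<^sup>2) = 1" for k
    by (simp add: cutoff_def flat_def mult_left_mono)
  then show ?thesis using True by simp
next
  case False
  then have "R < \<bar>d\<bar>" by simp
  then have "R\<^sup>2 < \<bar>d\<bar>\<^sup>2" using assms by (intro power_strict_mono) auto
  then have D: "d\<^sup>2 - R\<^sup>2 > 0" by simp
  have e: "cutoff (real (Suc k) * R\<^sup>2) (real (Suc k) * d\<^sup>2) = 1 - exp (- (1 / (d\<^sup>2 - R\<^sup>2)) * (1 / real (Suc k)))" for k
  proof -
    have "real (Suc k) * R\<^sup>2 < real (Suc k) * d\<^sup>2" using D by (intro mult_strict_left_mono) auto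
    then have "cutoff (real (Suc k) * R\<^sup>2) (real (Suc k) * d\<^sup>2) = 1 - exp (- (1 / (real (Suc k) * d\<^sup>2 - real (Suc k) * R\<^sup>2)))"
      by (simp add: cutoff_def flat_def del: of_nat_Suc)
    also have "real (Suc k) * d\<^sup>2 - real (Suc k) * R\<^sup>2 = (d\<^sup>2 - R\<^sup>2) * real (Suc k)"
      by (simp only: right_diff_distrib mult.commute[of _ "real (Suc k)"])
    finally show ?thesis by (simp del: of_nat_Suc)
  qed
  have "(\<lambda>k. 1 / real (Suc k)) \<longlonglongrightarrow> 0" using LIMSEQ_inverse_real_of_nat by (simp add: inverse_eq_divide)
  then have "(\<lambda>k. 1 - exp (- (1 / (d\<^sup>2 - R\<^sup>2)) * (1 / real (Suc k)))) \<longlonglongrightarrow> 1 - exp (- (1 / (d\<^sup>2 - R\<^sup>2)) * 0)"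
    by (intro tendsto_intros)
  then show ?thesis unfolding e using False by simp
qed

text \<open>The boxes are stable under intersection and generate the Borel sets, so the integral vanishes over every Borel set.\<close>

lemma integral_over_boxes_zero_imp_AE:
  fixes V :: "real ^ 'n::finite \<Rightarrow> complex"
  assumes V: "integrable lborel V" and box: "\<And>a b. (LINT x:{a..b}|lborel. V x) = 0"
  shows "AE x in lborel. V x = 0"
proof -
  have si: "set_integrable lborel A V" if "A \<in> sets borel" for A
    unfolding set_integrable_def using that by (intro integrable_mult_indicator V) auto
  have tot: "(LINT x|lborel. V x) = 0"
  proof -
    define A where "A k = {(\<chi> i. - real k) .. (\<chi> i. real k) :: real ^ 'n}" for k
    have "(\<lambda>k. LINT x|lborel. indicator (A k) x *\<^sub>R V x) \<longlonglongrightarrow> (LINT x|lborel. V x)"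
    proof (rule integral_dominated_convergence[where w = "\<lambda>x. norm (V x)"])
      show "AE x in lborel. (\<lambda>k. indicator (A k) x *\<^sub>R V x) \<longlonglongrightarrow> V x"
      proof (rule AE_I2)
        fix x :: "real ^ 'n"
        obtain m where m: "norm x \<le> real m" using real_arch_simple by blast
        have "x \<in> A k" if "k \<ge> m" for k
        proof -
          have "\<bar>x $ i\<bar> \<le> real k" for i
            using component_le_norm_cart[of x i] m of_nat_mono[OF that, where 'a = real] by linarith
          then show ?thesis by (simp add: A_def less_eq_vec_def abs_le_iff minus_le_iff)
        qed
        then show "(\<lambda>k. indicator (A k) x *\<^sub>R V x) \<longlonglongrightarrow> V x"
          by (intro tendsto_eventually eventually_sequentiallyI[of m]) simp
      qed
    qed (use V in \<open>auto simp: A_def indicator_def intro!: integrable_norm\<close>)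
    moreover have "(LINT x|lborel. indicator (A k) x *\<^sub>R V x) = 0" for k
      using box unfolding A_def set_lebesgue_integral_def .
    ultimately show ?thesis by (simp add: LIMSEQ_const_iff)
  qed
  have "(LINT x:A|lborel. V x) = 0" if "A \<in> sets borel" for A
  proof -
    let ?G = "range (\<lambda>(a, b). {a..b} :: (real ^ 'n) set)"
    have I: "Int_stable ?G"
      by (auto simp: Int_stable_def cbox_interval[symmetric] Int_interval)
    have P: "?G \<subseteq> Pow UNIV" by simp
    have A: "A \<in> sigma_sets UNIV ?G" using that by (simp add: borel_eq_atLeastAtMost)
    have sb: "B \<in> sets borel" if "B \<in> sigma_sets UNIV ?G" for B using that by (simp add: borel_eq_atLeastAtMost)
    show ?thesis
      using I P A
    proof (induction rule: sigma_sets_induct_disjoint)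
      case (basic A) then show ?case using box by auto
    next
      case empty show ?case by (simp add: set_lebesgue_integral_def)
    next
      case (compl A)
      have "(LINT x:UNIV|lborel. V x) = (LINT x:A \<union> (UNIV - A)|lborel. V x)" by simp
      also have "\<dots> = (LINT x:A|lborel. V x) + (LINT x:UNIV - A|lborel. V x)"
        by (rule set_integral_Un) (auto intro!: si sb compl sigma_sets.Compl)
      finally show ?case using compl tot by (simp add: set_lebesgue_integral_def)
    next
      case (union A)
      have As: "A i \<in> sets borel" for i using union(2) by (intro sb) blast
      have "(LINT x:(\<Union>i. A i)|lborel. V x) = (\<Sum>i. LINT x:A i|lborel. V x)"
      proof (rule lebesgue_integral_countable_add)
        show "A i \<inter> A j = {}" if "i \<noteq> j" for i j using union(1) that by (auto simp: disjoint_family_on_def)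
        show "set_integrable lborel (\<Union>i. A i) V" using As by (intro si sets.countable_UN) auto
      qed (use As in simp)
      then show ?case using union by simp
    qed
  qed
  then show ?thesis
    using sigma_finite_measure.density_zero[OF lborel.sigma_finite_measure_axioms V] by simp
qed

text \<open>The products of dilated cut-offs in the coordinates, times the Gaussian, are Schwartz functions; they are bounded by
the Gaussian and converge to the Gaussian times the indicator of a box.\<close>

lemma schwartz_pairing_zero_imp_AE:
  fixes v :: "real ^ 'n::finite \<Rightarrow> complex"
  assumes vm: "v \<in> borel_measurable borel"
    and i: "\<And>\<phi>. \<phi> \<in> schwartz \<Longrightarrow> integrable lborel (\<lambda>x. v x * \<phi> x)"
    and z: "\<And>\<phi>. \<phi> \<in> schwartz \<Longrightarrow> (LINT x|lborel. v x * \<phi> x) = 0"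
  shows "AE x in lborel. v x = 0"
proof -
  have [measurable]: "gauss \<in> borel_measurable borel" by (rule schwartz_measurable[OF gauss_schwartz])
  note [measurable] = vm
  define V where "V x = v x * gauss x" for x
  have V: "integrable lborel V" unfolding V_def[abs_def] by (rule i[OF gauss_schwartz])
  have [measurable]: "V \<in> borel_measurable borel" using V by auto
  have "(LINT x:{a..b}|lborel. V x) = 0" for a b
  proof (cases "a \<le> b")
    case False then have "{a..b} = {}" by simp
    then show ?thesis by (simp add: set_lebesgue_integral_def)
  next
    case True
    define c where "c i = (a $ i + b $ i) / 2" for i
    define R where "R i = (b $ i - a $ i) / 2" for i
    have R: "R i \<ge> 0" for i using True by (simp add: R_def less_eq_vec_def)
    define E where "E k x = (\<Prod>i\<in>UNIV. cutoff (real (Suc k) * (R i)\<^sup>2) (real (Suc k) * (x $ i - c i)\<^sup>2))" for k and x :: "real ^ 'n"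
    have Em: "(\<lambda>x. complex_of_real (E k x)) \<in> multiplier" for k
      unfolding E_def of_real_prod by (intro multiplier_prod multiplier_cutoff_coordinate) auto
    have ES: "(\<lambda>x. complex_of_real (E k x) * gauss x) \<in> schwartz" for k
      by (rule schwartz_multiplier[OF Em gauss_schwartz])
    have E1: "0 \<le> E k x" "E k x \<le> 1" for k x
      unfolding E_def by (auto intro!: prod_nonneg prod_le_1 simp: cutoff_bounds)
    have lim: "(\<lambda>k. E k x) \<longlonglongrightarrow> indicator {a..b} x" for x
    proof -
      have ab: "\<bar>x $ i - c i\<bar> \<le> R i \<longleftrightarrow> a $ i \<le> x $ i \<and> x $ i \<le> b $ i" for i
        by (auto simp: c_def R_def abs_le_iff field_simps)
      have "(\<lambda>k. E k x) \<longlonglongrightarrow> (\<Prod>i\<in>UNIV. if \<bar>x $ i - c i\<bar> \<le> R i then 1 else 0)"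
        unfolding E_def by (intro tendsto_prod cutoff_tendsto_indicator R)
      also have "(\<Prod>i\<in>UNIV. if \<bar>x $ i - c i\<bar> \<le> R i then 1 else 0) = (indicator {a..b} x :: real)"
      proof (cases "x \<in> {a..b}")
        case True then show ?thesis unfolding ab by (simp add: less_eq_vec_def)
      next
        case False
        then obtain i where "\<not> (a $ i \<le> x $ i \<and> x $ i \<le> b $ i)" by (auto simp: less_eq_vec_def)
        then show ?thesis using False unfolding ab by (subst prod_zero) (auto intro: exI[of _ i])
      qed
      finally show ?thesis .
    qed
    have "(\<lambda>k. LINT x|lborel. v x * (complex_of_real (E k x) * gauss x)) \<longlonglongrightarrow> (LINT x|lborel. indicator {a..b} x *\<^sub>R V x)"
    proof (rule integral_dominated_convergence[where w = "\<lambda>x. norm (V x)"])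
      show "AE x in lborel. (\<lambda>k. v x * (complex_of_real (E k x) * gauss x)) \<longlonglongrightarrow> indicator {a..b} x *\<^sub>R V x"
      proof (rule AE_I2)
        fix x
        have "(\<lambda>k. E k x *\<^sub>R V x) \<longlonglongrightarrow> indicator {a..b} x *\<^sub>R V x" by (intro tendsto_scaleR lim tendsto_const)
        then show "(\<lambda>k. v x * (complex_of_real (E k x) * gauss x)) \<longlonglongrightarrow> indicator {a..b} x *\<^sub>R V x"
          by (simp add: V_def scaleR_conv_of_real ac_simps)
      qed
      show "AE x in lborel. norm (v x * (complex_of_real (E k x) * gauss x)) \<le> norm (V x)" for k
      proof (rule AE_I2)
        fix x
        have "E k x * norm (V x) \<le> 1 * norm (V x)" by (intro mult_right_mono E1) auto
        then show "norm (v x * (complex_of_real (E k x) * gauss x)) \<le> norm (V x)"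
          using E1[of k x] by (simp add: V_def norm_mult ac_simps)
      qed
      show "(\<lambda>x. v x * (complex_of_real (E k x) * gauss x)) \<in> borel_measurable lborel" for k
        using i[OF ES[of k]] by auto
    qed (use V in \<open>auto intro!: integrable_norm\<close>)
    then show ?thesis unfolding z[OF ES] set_lebesgue_integral_def by (simp add: LIMSEQ_const_iff)
  qed
  from integral_over_boxes_zero_imp_AE[OF V this] show ?thesis
  proof eventually_elim
    case (elim x)
    then show ?case by (simp add: V_def gauss_def)
  qed
qed

lemma functional_of_eq_imp_Lp_norm_eq:
  fixes g h :: "real ^ 'n::finite \<Rightarrow> complex"
  assumes p: "1 \<le> p" and g: "g \<in> Lp p" and h: "h \<in> Lp p"
    and eq: "functional_of schwartz g = functional_of schwartz h"
  shows "Lp_norm p g = Lp_norm p h"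
proof -
  have gm: "g \<in> borel_measurable lebesgue" and hm: "h \<in> borel_measurable lebesgue" using g h by (auto simp: Lp_def)
  obtain g' B e where g': "g' \<in> borel_measurable borel" "AE x in lborel. g x = g' x" "Lp_norm p g' = Lp_norm p g"
    and B: "B \<ge> 0" "integrable lborel e" "\<And>x. e x \<ge> 0" "\<And>x. norm (g' x) \<le> B + e x" and g'p: "g' \<in> Lp p"
    by (rule Lp_representative[OF g p]) blast
  obtain h' D d where h': "h' \<in> borel_measurable borel" "AE x in lborel. h x = h' x" "Lp_norm p h' = Lp_norm p h"
    and D: "D \<ge> 0" "integrable lborel d" "\<And>x. d x \<ge> 0" "\<And>x. norm (h' x) \<le> D + d x"
    by (rule Lp_representative[OF h p]) blast
  have gi: "integrable lborel (\<lambda>x. g' x * \<phi> x)" if "\<phi> \<in> schwartz" for \<phi>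
    by (rule integrable_weighted_product[OF g'(1) schwartz_weighted[OF that] B])
  have hi: "integrable lborel (\<lambda>x. h' x * \<phi> x)" if "\<phi> \<in> schwartz" for \<phi>
    by (rule integrable_weighted_product[OF h'(1) schwartz_weighted[OF that] D])
  have "AE x in lborel. g' x - h' x = 0"
  proof (rule schwartz_pairing_zero_imp_AE)
    show "(\<lambda>x. g' x - h' x) \<in> borel_measurable borel" using g'(1) h'(1) by simp
    fix \<phi> :: "real ^ 'n \<Rightarrow> complex" assume \<phi>: "\<phi> \<in> schwartz"
    show "integrable lborel (\<lambda>x. (g' x - h' x) * \<phi> x)"
      unfolding left_diff_distrib by (intro Bochner_Integration.integrable_diff gi hi \<phi>)
    have "(LINT x|lborel. g' x * \<phi> x) = (LINT x|lborel. h' x * \<phi> x)"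
      using fun_cong[OF eq, of \<phi>] \<phi>
      by (simp add: functional_of_def pairing_representative[OF gm g'(1,2) schwartz_measurable[OF \<phi>]]
          pairing_representative[OF hm h'(1,2) schwartz_measurable[OF \<phi>]])
    then show "(LINT x|lborel. (g' x - h' x) * \<phi> x) = 0"
      using gi[OF \<phi>] hi[OF \<phi>] by (simp add: left_diff_distrib)
  qed
  then have "AE x in lebesgue. g' x = h' x" by (intro AE_completion) auto
  from Lp_AE_cong(2)[OF g'p borel_imp_lebesgue_measurable[OF h'(1)] this] show ?thesis
    using g'(3) h'(3) by simp
qed

section \<open>Vanishing moments\<close>

text \<open>Iterated derivatives are indexed by words of coordinates, moments by multi-indices.\<close>

lemma monomial_word:
  fixes \<gamma> :: "'n::finite \<Rightarrow> nat"
  obtains \<beta> :: "'n list" where "\<And>x. monomial \<gamma> x = (\<Prod>i\<leftarrow>\<beta>. complex_of_real (x $ i))"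
proof -
  have "\<exists>\<beta> :: 'n list. \<forall>x :: real ^ 'n. (\<Prod>i\<in>I. complex_of_real (x $ i) ^ \<gamma> i) = (\<Prod>i\<leftarrow>\<beta>. complex_of_real (x $ i))"
    if "finite I" for I
    using that
  proof induction
    case empty show ?case by (intro exI[of _ "[]"]) simp
  next
    case (insert j I)
    then obtain \<beta> :: "'n list" where \<beta>: "\<And>x :: real ^ 'n. (\<Prod>i\<in>I. complex_of_real (x $ i) ^ \<gamma> i) = (\<Prod>i\<leftarrow>\<beta>. complex_of_real (x $ i))" by blast
    have "(\<Prod>i\<leftarrow>replicate m j @ \<beta>. complex_of_real (x $ i)) = complex_of_real (x $ j) ^ m * (\<Prod>i\<leftarrow>\<beta>. complex_of_real (x $ i))" for m and x :: "real ^ 'n"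
      by (induction m) (auto simp: mult.assoc)
    then show ?case using insert \<beta> by (intro exI[of _ "replicate (\<gamma> j) j @ \<beta>"]) simp
  qed
  from this[of UNIV] show ?thesis using that by (auto simp: monomial_def)
qed

lemma word_times_ft:
  assumes "c \<noteq> 0" "\<psi> \<in> schwartz"
  shows "\<exists>a. \<forall>x. (\<Prod>i\<leftarrow>\<beta>. complex_of_real (x $ i)) * ft c \<psi> x = a * ft c (partial_derivs \<beta> \<psi>) x"
proof (induction \<beta>)
  case Nil show ?case by (intro exI[of _ 1]) simp
next
  case (Cons i \<beta>)
  then obtain a where a: "\<And>x. (\<Prod>i\<leftarrow>\<beta>. complex_of_real (x $ i)) * ft c \<psi> x = a * ft c (partial_derivs \<beta> \<psi>) x" by blast
  have "(\<Prod>i\<leftarrow>i # \<beta>. complex_of_real (x $ i)) * ft c \<psi> x = (a * (\<i> / complex_of_real c)) * ft c (partial_derivs (i # \<beta>) \<psi>) x" for x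
  proof -
    have b: "(\<i> / complex_of_real c) * (- \<i> * complex_of_real (c * t)) = complex_of_real t" for t
      using assms(1) by simp
    have "(\<Prod>i\<leftarrow>i # \<beta>. complex_of_real (x $ i)) * ft c \<psi> x = complex_of_real (x $ i) * (a * ft c (partial_derivs \<beta> \<psi>) x)"
      by (simp add: a[symmetric] mult.assoc)
    also have "\<dots> = a * (\<i> / complex_of_real c) * (- \<i> * complex_of_real (c * x $ i) * ft c (partial_derivs \<beta> \<psi>) x)"
      unfolding b[of "x $ i", symmetric] by (simp only: mult_ac)
    finally show ?thesis
      by (simp add: ft_partial_deriv_schwartz[OF schwartz_partial_derivs[OF assms(2)]])
  qed
  then show ?case by blast
qed

text \<open>The moments of the inverse transform are, up to constants, the derivatives of \<open>\<psi>\<close> at the origin: a monomial times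
the transform is the transform of a derivative, and integration is evaluation of the Fourier transform at 0.\<close>

lemma inv_fourier_schwartz_zero:
  assumes "\<psi> \<in> schwartz_zero"
  shows "inv_fourier \<psi> \<in> schwartz_inf" "inv_fourier \<psi> = ft (2 * pi) \<psi>"
proof -
  have \<psi>: "\<psi> \<in> schwartz" "\<And>\<beta>. partial_derivs \<beta> \<psi> 0 = 0" using assms by (auto simp: schwartz_zero_def)
  show e: "inv_fourier \<psi> = ft (2 * pi) \<psi>" by (rule fourier_eq_ft(2)[OF schwartz_measurable[OF \<psi>(1)]])
  have F: "ft (2 * pi) \<psi> \<in> schwartz" by (intro ft_schwartz \<psi>) simp
  have "(LINT x|lebesgue. monomial \<gamma> x * ft (2 * pi) \<psi> x) = 0" for \<gamma>
  proof -
    obtain \<beta> where \<beta>: "\<And>x. monomial \<gamma> x = (\<Prod>i\<leftarrow>\<beta>. complex_of_real (x $ i))" using monomial_word[of \<gamma>] by blast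
    obtain a where a: "\<And>x. (\<Prod>i\<leftarrow>\<beta>. complex_of_real (x $ i)) * ft (2 * pi) \<psi> x = a * ft (2 * pi) (partial_derivs \<beta> \<psi>) x"
      using word_times_ft[OF _ \<psi>(1), of "2 * pi" \<beta>] by auto
    have d: "partial_derivs \<beta> \<psi> \<in> schwartz" by (rule schwartz_partial_derivs[OF \<psi>(1)])
    have [measurable]: "partial_derivs \<beta> \<psi> \<in> borel_measurable borel" by (rule schwartz_measurable[OF d])
    have "(LINT x|lebesgue. monomial \<gamma> x * ft (2 * pi) \<psi> x) = (LINT x|lebesgue. a * ft (2 * pi) (partial_derivs \<beta> \<psi>) x)"
      unfolding \<beta> a ..
    also have "\<dots> = (LINT x|lborel. a * ft (2 * pi) (partial_derivs \<beta> \<psi>) x)"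
      by (rule integral_completion) measurable
    also have "\<dots> = a * ft (- (2 * pi)) (ft (2 * pi) (partial_derivs \<beta> \<psi>)) 0"
      by (simp add: ft_def[of "- (2 * pi)"])
    also have "\<dots> = 0" unfolding ft_inversion[OF d] by (simp add: \<psi>(2))
    finally show ?thesis .
  qed
  then show "inv_fourier \<psi> \<in> schwartz_inf" unfolding e schwartz_inf_def using F by simp
qed

lemma ft_reflect: "ft c \<phi> (- \<xi>) = ft (- c) \<phi> \<xi>"
  by (simp add: ft_def)

text \<open>The duality that defines the operator on the distributions modulo polynomials involves the inverse transform, the
one for tempered distributions the transform; for even multipliers the two agree.\<close>

lemma ft_even_multiplier_reflect:
  assumes [measurable]: "\<phi> \<in> borel_measurable borel" "h \<in> borel_measurable borel" and even: "\<And>\<xi>. h (- \<xi>) = h \<xi>"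
  shows "ft c (\<lambda>\<xi>. h \<xi> * ft (- c) \<phi> \<xi>) x = ft (- c) (\<lambda>\<xi>. h \<xi> * ft c \<phi> \<xi>) x"
proof -
  have "ft c (\<lambda>\<xi>. h \<xi> * ft (- c) \<phi> \<xi>) x = (LINT \<xi>|lborel. h (0 - \<xi>) * ft (- c) \<phi> (0 - \<xi>) * cis (c * ((0 - \<xi>) \<bullet> x)))"
    unfolding ft_def[of c] by (rule integral_lborel_reflect[symmetric]) measurable
  also have "\<dots> = ft (- c) (\<lambda>\<xi>. h \<xi> * ft c \<phi> \<xi>) x"
    unfolding ft_def[of "- c" "\<lambda>\<xi>. h \<xi> * ft c \<phi> \<xi>"] by (simp add: even ft_reflect)
  finally show ?thesis .
qed

section \<open>The a priori estimate\<close>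

definition radial :: "(real \<Rightarrow> real) \<Rightarrow> real ^ 'n::finite \<Rightarrow> complex" where
  "radial F \<xi> = complex_of_real (F (4 * pi\<^sup>2 * (norm \<xi>)\<^sup>2))"

lemma radial_multiplier: "(\<And>k. symb k 0 d F) \<Longrightarrow> radial F \<in> multiplier"
  unfolding radial_def[abs_def] by (rule multiplier_radial) auto

lemma multiplier_measurable: "\<sigma> \<in> multiplier \<Longrightarrow> \<sigma> \<in> borel_measurable borel"
  using multiplier_properties[of \<sigma>]
  by (intro borel_measurable_continuous_onI continuous_at_imp_continuous_on ballI differentiable_imp_continuous_within) auto

text \<open>The representing function is \<open>g = f + k\<^sub>A * f + k\<^sub>B * u\<close>, where the kernels belong to the symbols \<open>A - 1\<close> and
\<open>B\<close> of the decomposition.\<close>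

theorem frac_log_estimate:
  fixes s lam :: real and p :: ennreal
  assumes s: "s > 0" and lam: "lam > 1" and p: "1 \<le> p"
  obtains C where "C > 0"
    "\<And>u f :: real ^ 'n::finite \<Rightarrow> complex. u \<in> Lp p \<Longrightarrow> f \<in> Lp p \<Longrightarrow>
      has_frac_log_laplacian s (functional_of schwartz_inf u) (functional_of schwartz_inf f) \<Longrightarrow>
      \<exists>g\<in>Lp p. inhom_op s lam (functional_of schwartz u) = functional_of schwartz g \<and>
        Lp_norm p g \<le> C * (Lp_norm p f + Lp_norm p u)"
proof -
  obtain A B :: "real \<Rightarrow> real" and T where T: "T > 0" "\<And>t. t \<le> T \<Longrightarrow> A t = 0"
    and AB: "\<And>t. t \<ge> 0 \<Longrightarrow> (lam + t) powr s * ln (lam + t) = A t * (t powr s * ln t) + B t"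
    and A1: "\<And>k. symb k 0 (-1) (\<lambda>t. A t - 1)" and B1: "\<And>k. symb k 0 (-1) B"
    by (rule symbol_decomposition[OF s lam]) blast
  obtain \<kappa>A :: "real ^ 'n \<Rightarrow> complex" where \<kappa>A: "integrable lborel \<kappa>A"
    "\<And>\<phi> x. \<phi> \<in> schwartz \<Longrightarrow> ft (- (2 * pi)) (\<lambda>\<xi>. radial (\<lambda>t. A t - 1) \<xi> * ft (2 * pi) \<phi> \<xi>) x = (LINT y|lborel. \<kappa>A (x - y) * \<phi> y)"
    unfolding radial_def by (rule radial_multiplier_kernel[OF A1]) blast
  obtain \<kappa>B :: "real ^ 'n \<Rightarrow> complex" where \<kappa>B: "integrable lborel \<kappa>B"
    "\<And>\<phi> x. \<phi> \<in> schwartz \<Longrightarrow> ft (- (2 * pi)) (\<lambda>\<xi>. radial B \<xi> * ft (2 * pi) \<phi> \<xi>) x = (LINT y|lborel. \<kappa>B (x - y) * \<phi> y)"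
    unfolding radial_def by (rule radial_multiplier_kernel[OF B1]) blast
  define a where "a = (LINT z|lborel. norm (\<kappa>A z))"
  define b where "b = (LINT z|lborel. norm (\<kappa>B z))"
  have ab: "a \<ge> 0" "b \<ge> 0" by (simp_all add: a_def b_def)
  have mA1: "radial (\<lambda>t. A t - 1) \<in> multiplier" by (rule radial_multiplier[OF A1])
  have mB: "radial B \<in> multiplier" by (rule radial_multiplier[OF B1])
  have mA: "radial A \<in> multiplier"
    using multiplier.add[OF mA1 multiplier.const[of 1]] by (simp add: radial_def[abs_def])
  have mL: "inhom_symbol s lam \<in> multiplier"
  proof -
    have "symb k 0 (s + 1) (\<lambda>t. (lam + t) powr s * ln (lam + t))" for k
      using lam by (intro symb_mult symb_shifted_powr symb_shifted_ln) auto
    from radial_multiplier[OF this] show ?thesis unfolding radial_def[abs_def] inhom_symbol_def[abs_def] .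
  qed
  \<comment> \<open>also at the origin, where \<open>A\<close> vanishes\<close>
  have mAm: "inhom_symbol s lam \<xi> = frac_log_symbol s \<xi> * radial A \<xi> + radial B \<xi>" for \<xi> :: "real ^ 'n"
  proof (cases "\<xi> = 0")
    case True then show ?thesis using AB[of 0] T(1) T(2)[of 0] by (simp add: inhom_symbol_def frac_log_symbol_def radial_def)
  next
    case False
    have r0: "0 \<le> 4 * pi\<^sup>2 * (norm \<xi>)\<^sup>2" by simp
    show ?thesis unfolding inhom_symbol_def AB[OF r0]
      using False by (simp add: frac_log_symbol_def radial_def)
  qed
  define C where "C = 4 + 16 * a + 16 * b"
  show ?thesis
  proof (rule that[of C])
    show "C > 0" using ab by (simp add: C_def)
    fix u f :: "real ^ 'n \<Rightarrow> complex"
    assume u: "u \<in> Lp p" and f: "f \<in> Lp p"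
      and uf: "has_frac_log_laplacian s (functional_of schwartz_inf u) (functional_of schwartz_inf f)"
    have um: "u \<in> borel_measurable lebesgue" and fm: "f \<in> borel_measurable lebesgue" using u f by (auto simp: Lp_def)
    obtain u' Bu eu where u': "u' \<in> borel_measurable borel" "AE x in lborel. u x = u' x" "u' \<in> Lp p" "Lp_norm p u' = Lp_norm p u"
      and ub: "Bu \<ge> 0" "integrable lborel eu" "\<And>x. eu x \<ge> 0" "\<And>x. norm (u' x) \<le> Bu + eu x"
      and ui: "p = \<infinity> \<Longrightarrow> Bu = Lp_norm p u \<and> eu = (\<lambda>_. 0)"
      by (rule Lp_representative[OF u p]) blast
    obtain f' Bf ef where f': "f' \<in> borel_measurable borel" "AE x in lborel. f x = f' x" "f' \<in> Lp p" "Lp_norm p f' = Lp_norm p f"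
      and fb: "Bf \<ge> 0" "integrable lborel ef" "\<And>x. ef x \<ge> 0" "\<And>x. norm (f' x) \<le> Bf + ef x"
      and fi: "p = \<infinity> \<Longrightarrow> Bf = Lp_norm p f \<and> ef = (\<lambda>_. 0)"
      by (rule Lp_representative[OF f p]) blast
    have ubd: "p = \<infinity> \<longrightarrow> (\<forall>x. norm (u' x) \<le> Lp_norm p u')"
    proof (intro impI allI)
      fix x assume "p = \<infinity>"
      from ui[OF this] ub(4)[of x] show "norm (u' x) \<le> Lp_norm p u'" unfolding u'(4) by simp
    qed
    have fbd: "p = \<infinity> \<longrightarrow> (\<forall>x. norm (f' x) \<le> Lp_norm p f')"
    proof (intro impI allI)
      fix x assume "p = \<infinity>"
      from fi[OF this] fb(4)[of x] show "norm (f' x) \<le> Lp_norm p f'" unfolding f'(4) by simp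
    qed
    note Yu = young_inequality[OF \<kappa>B(1) p u'(1) u'(3) ubd, folded b_def]
    note Yf = young_inequality[OF \<kappa>A(1) p f'(1) f'(3) fbd, folded a_def]
    have cum: "conv \<kappa>B u' \<in> borel_measurable borel" using \<kappa>B(1) u'(1) by (intro measurable_conv) auto
    have cfm: "conv \<kappa>A f' \<in> borel_measurable borel" using \<kappa>A(1) f'(1) by (intro measurable_conv) auto
    define h where "h x = conv \<kappa>A f' x + conv \<kappa>B u' x" for x
    have hm: "h \<in> borel_measurable borel" unfolding h_def[abs_def] using cum cfm by simp
    have h: "h \<in> Lp p" "Lp_norm p h \<le> 4 * (Lp_norm p (conv \<kappa>A f') + Lp_norm p (conv \<kappa>B u'))"
      unfolding h_def[abs_def] by (rule Lp_add[OF p cfm cum Yf(1) Yu(1)])+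
    define g where "g x = f' x + h x" for x
    have gm: "g \<in> borel_measurable borel" unfolding g_def[abs_def] using f'(1) hm by simp
    have g: "g \<in> Lp p" "Lp_norm p g \<le> 4 * (Lp_norm p f' + Lp_norm p h)"
      unfolding g_def[abs_def] by (rule Lp_add[OF p f'(1) hm f'(3) h(1)])+
    have nu: "Lp_norm p u \<ge> 0" and nf: "Lp_norm p f \<ge> 0" using Lp_norm_nonneg u f by auto
    have "Lp_norm p g \<le> 4 * (Lp_norm p f + 4 * (a * Lp_norm p f + b * Lp_norm p u))"
      using g(2) h(2) Yu(2) Yf(2) unfolding u'(4) f'(4) by (simp only: distrib_left)
    also have "\<dots> \<le> C * (Lp_norm p f + Lp_norm p u)"
      using ab mult_nonneg_nonneg[OF ab(1) nu] mult_nonneg_nonneg[OF ab(2) nf] nu by (simp add: C_def algebra_simps)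
    finally have bound: "Lp_norm p g \<le> C * (Lp_norm p f + Lp_norm p u)" .
    have main: "inhom_op s lam (functional_of schwartz u) \<phi> = functional_of schwartz g \<phi>" if \<phi>: "\<phi> \<in> schwartz" for \<phi>
    proof -
      have \<phi>m[measurable]: "\<phi> \<in> borel_measurable borel" by (rule schwartz_measurable[OF \<phi>])
      define \<psi> where "\<psi> = ft (2 * pi) \<phi>"
      have \<psi>: "\<psi> \<in> schwartz" unfolding \<psi>_def by (intro ft_schwartz \<phi>) simp
      have i\<psi>: "inv_fourier \<phi> = \<psi>" unfolding \<psi>_def by (rule fourier_eq_ft(2)[OF \<phi>m])
      have L\<psi>: "(\<lambda>\<xi>. inhom_symbol s lam \<xi> * \<psi> \<xi>) \<in> schwartz" by (rule schwartz_multiplier[OF mL \<psi>])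
      have B\<psi>: "(\<lambda>\<xi>. radial B \<xi> * \<psi> \<xi>) \<in> schwartz" by (rule schwartz_multiplier[OF mB \<psi>])
      have A1\<psi>: "(\<lambda>\<xi>. radial (\<lambda>t. A t - 1) \<xi> * \<psi> \<xi>) \<in> schwartz" by (rule schwartz_multiplier[OF mA1 \<psi>])
      define mA\<psi> where "mA\<psi> = (\<lambda>\<xi>. frac_log_symbol s \<xi> * (radial A \<xi> * \<psi> \<xi>))"
      have split: "(\<lambda>\<xi>. inhom_symbol s lam \<xi> * \<psi> \<xi>) = (\<lambda>\<xi>. mA\<psi> \<xi> + radial B \<xi> * \<psi> \<xi>)"
        by (rule ext) (simp add: mAm mA\<psi>_def algebra_simps)
      define FL where "FL = ft (- (2 * pi)) (\<lambda>\<xi>. inhom_symbol s lam \<xi> * \<psi> \<xi>)"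
      have FL: "FL \<in> schwartz" unfolding FL_def by (intro ft_schwartz L\<psi>) simp
      have "inhom_op s lam (functional_of schwartz u) \<phi> = functional_of schwartz u FL"
        using \<phi> \<psi> L\<psi> fourier_eq_ft(1)[OF schwartz_measurable[OF L\<psi>]]
        by (simp add: inhom_op_def inv_fourier_dist_def mult_dist_def fourier_dist_def i\<psi> FL_def)
      also have "\<dots> = (LINT x|lborel. u' x * FL x)"
        using FL by (simp add: functional_of_def pairing_representative[OF um u'(1,2) schwartz_measurable[OF FL]])
      also have "\<dots> = (LINT x|lborel. u' x * ft (- (2 * pi)) mA\<psi> x) + (LINT x|lborel. conv \<kappa>B u' x * \<phi> x)"
      proof -
        \<comment> \<open>the homogeneous symbol is not a smooth multiplier, but \<open>A m = m\<^sub>\<lambda> - B\<close> is\<close>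
        have mA\<psi>: "mA\<psi> \<in> schwartz"
        proof -
          have "(\<lambda>\<xi>. inhom_symbol s lam \<xi> * \<psi> \<xi> + (-1) * (radial B \<xi> * \<psi> \<xi>)) \<in> schwartz"
            by (intro schwartz_add L\<psi> schwartz_multiplier[OF multiplier.const[of "-1"] B\<psi>])
          also have "(\<lambda>\<xi>. inhom_symbol s lam \<xi> * \<psi> \<xi> + (-1) * (radial B \<xi> * \<psi> \<xi>)) = mA\<psi>"
            by (rule ext) (simp add: fun_cong[OF split])
          finally show ?thesis .
        qed
        have 1: "ft (- (2 * pi)) mA\<psi> \<in> schwartz" "ft (- (2 * pi)) (\<lambda>\<xi>. radial B \<xi> * \<psi> \<xi>) \<in> schwartz"
          by (intro ft_schwartz mA\<psi> B\<psi>; simp)+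
        have "FL x = ft (- (2 * pi)) mA\<psi> x + ft (- (2 * pi)) (\<lambda>\<xi>. radial B \<xi> * \<psi> \<xi>) x" for x
          unfolding FL_def split by (intro ft_add schwartz_integrable mA\<psi> B\<psi>)
        then have "(LINT x|lborel. u' x * FL x) = (LINT x|lborel. u' x * ft (- (2 * pi)) mA\<psi> x) + (LINT x|lborel. u' x * ft (- (2 * pi)) (\<lambda>\<xi>. radial B \<xi> * \<psi> \<xi>) x)"
          using integrable_weighted_product[OF u'(1) schwartz_weighted[OF 1(1)] ub] integrable_weighted_product[OF u'(1) schwartz_weighted[OF 1(2)] ub]
          by (simp add: distrib_left)
        also have "(LINT x|lborel. u' x * ft (- (2 * pi)) (\<lambda>\<xi>. radial B \<xi> * \<psi> \<xi>) x) = (LINT x|lborel. conv \<kappa>B u' x * \<phi> x)"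
          unfolding \<psi>_def \<kappa>B(2)[OF \<phi>] by (rule conv_pairing[OF \<kappa>B(1) u'(1) ub schwartz_weighted[OF \<phi>]])
        finally show ?thesis .
      qed
      also have "(LINT x|lborel. u' x * ft (- (2 * pi)) mA\<psi> x) = (LINT x|lborel. f' x * ft (- (2 * pi)) (\<lambda>\<xi>. radial A \<xi> * \<psi> \<xi>) x)"
      proof -
        \<comment> \<open>The test function for the equation: it vanishes near the origin together with \<open>A\<close>, and it contains the
  transform of \<open>\<phi>\<close> in place of the inverse transform because of the reflection in the two dualities.\<close>
        define \<psi>0 where "\<psi>0 = (\<lambda>\<xi>. radial A \<xi> * ft (- (2 * pi)) \<phi> \<xi>)"
        define \<psi>1 where "\<psi>1 = (\<lambda>\<xi>. frac_log_symbol s \<xi> * \<psi>0 \<xi>)"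
        have F\<phi>: "ft (- (2 * pi)) \<phi> \<in> schwartz" by (intro ft_schwartz \<phi>) simp
        define U where "U = {\<xi> :: real ^ 'n. 4 * pi\<^sup>2 * (norm \<xi>)\<^sup>2 < T}"
        have U: "open U" unfolding U_def by (intro open_Collect_less continuous_intros)
        have U0: "0 \<in> U" using T(1) by (simp add: U_def)
        have van: "radial A \<xi> = 0" if "\<xi> \<in> U" for \<xi> using that T(2) by (simp add: U_def radial_def)
        have \<psi>0S: "\<psi>0 \<in> schwartz" unfolding \<psi>0_def by (rule schwartz_multiplier[OF mA F\<phi>])
        have \<psi>0: "\<psi>0 \<in> schwartz_zero"
          unfolding schwartz_zero_def using \<psi>0S
          by (auto intro!: partial_derivs_vanish_on_open[OF U _ U0] simp: \<psi>0_def van)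
        have \<psi>1S: "\<psi>1 \<in> schwartz"
        proof -
          have "(\<lambda>\<xi>. inhom_symbol s lam \<xi> * ft (- (2 * pi)) \<phi> \<xi> + (-1) * (radial B \<xi> * ft (- (2 * pi)) \<phi> \<xi>)) \<in> schwartz"
            by (intro schwartz_add schwartz_multiplier[OF mL F\<phi>] schwartz_multiplier[OF multiplier.const[of "-1"]] schwartz_multiplier[OF mB F\<phi>])
          also have "(\<lambda>\<xi>. inhom_symbol s lam \<xi> * ft (- (2 * pi)) \<phi> \<xi> + (-1) * (radial B \<xi> * ft (- (2 * pi)) \<phi> \<xi>)) = \<psi>1"
            by (rule ext) (simp add: \<psi>1_def \<psi>0_def mAm algebra_simps)
          finally show ?thesis .
        qed
        have \<psi>1: "\<psi>1 \<in> schwartz_zero"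
          unfolding schwartz_zero_def using \<psi>1S
          by (auto intro!: partial_derivs_vanish_on_open[OF U _ U0] simp: \<psi>1_def \<psi>0_def van)
        note z0 = inv_fourier_schwartz_zero[OF \<psi>0] and z1 = inv_fourier_schwartz_zero[OF \<psi>1]
        have "fourier_inf (functional_of schwartz_inf f) \<psi>0 = fourier_inf (functional_of schwartz_inf u) \<psi>1"
          using uf \<psi>0 unfolding has_frac_log_laplacian_def \<psi>1_def by blast
        then have eq: "(LINT x|lebesgue. f x * ft (2 * pi) \<psi>0 x) = (LINT x|lebesgue. u x * ft (2 * pi) \<psi>1 x)"
          using \<psi>0 \<psi>1 z0(1) z1(1) by (simp add: fourier_inf_def functional_of_def z0(2) z1(2))
        have m0: "ft (2 * pi) \<psi>0 \<in> borel_measurable borel" "ft (2 * pi) \<psi>1 \<in> borel_measurable borel"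
          by (intro measurable_ft schwartz_measurable \<psi>0S \<psi>1S)+
        have [measurable]: "radial A \<in> borel_measurable borel" by (rule multiplier_measurable[OF mA])
        have e0: "ft (2 * pi) \<psi>0 x = ft (- (2 * pi)) (\<lambda>\<xi>. radial A \<xi> * \<psi> \<xi>) x" for x
          unfolding \<psi>0_def \<psi>_def
          by (rule ft_even_multiplier_reflect[OF \<phi>m multiplier_measurable[OF mA]]) (simp add: radial_def)
        have e1: "ft (2 * pi) \<psi>1 x = ft (- (2 * pi)) mA\<psi> x" for x
        proof -
          define H where "H \<xi> = inhom_symbol s lam \<xi> - radial B \<xi>" for \<xi> :: "real ^ 'n"
          have Hm: "H \<in> borel_measurable borel"
            unfolding H_def[abs_def] by (intro borel_measurable_diff multiplier_measurable mL mB)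
          have He: "frac_log_symbol s \<xi> * radial A \<xi> = H \<xi>" for \<xi> by (simp add: H_def mAm)
          have "ft (2 * pi) (\<lambda>\<xi>. H \<xi> * ft (- (2 * pi)) \<phi> \<xi>) x = ft (- (2 * pi)) (\<lambda>\<xi>. H \<xi> * ft (2 * pi) \<phi> \<xi>) x"
            by (rule ft_even_multiplier_reflect[OF \<phi>m Hm]) (simp add: H_def radial_def inhom_symbol_def)
          then show ?thesis unfolding \<psi>1_def \<psi>0_def mA\<psi>_def \<psi>_def mult.assoc[symmetric] He .
        qed
        show ?thesis
          using eq[unfolded pairing_representative[OF fm f'(1,2) m0(1)] pairing_representative[OF um u'(1,2) m0(2)]]
          unfolding e0 e1 by (rule sym)
      qed
      also have "(LINT x|lborel. f' x * ft (- (2 * pi)) (\<lambda>\<xi>. radial A \<xi> * \<psi> \<xi>) x) = (LINT x|lborel. f' x * \<phi> x) + (LINT x|lborel. conv \<kappa>A f' x * \<phi> x)"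
      proof -
        have F1: "ft (- (2 * pi)) (\<lambda>\<xi>. radial (\<lambda>t. A t - 1) \<xi> * \<psi> \<xi>) \<in> schwartz" by (intro ft_schwartz A1\<psi>) simp
        have "ft (- (2 * pi)) (\<lambda>\<xi>. radial A \<xi> * \<psi> \<xi>) x = \<phi> x + ft (- (2 * pi)) (\<lambda>\<xi>. radial (\<lambda>t. A t - 1) \<xi> * \<psi> \<xi>) x" for x
        proof -
          have "(\<lambda>\<xi>. radial A \<xi> * \<psi> \<xi>) = (\<lambda>\<xi>. \<psi> \<xi> + radial (\<lambda>t. A t - 1) \<xi> * \<psi> \<xi>)"
            by (rule ext) (simp add: radial_def algebra_simps)
          then have "ft (- (2 * pi)) (\<lambda>\<xi>. radial A \<xi> * \<psi> \<xi>) x = ft (- (2 * pi)) \<psi> x + ft (- (2 * pi)) (\<lambda>\<xi>. radial (\<lambda>t. A t - 1) \<xi> * \<psi> \<xi>) x"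
            by (simp add: ft_add schwartz_integrable \<psi> A1\<psi>)
          then show ?thesis unfolding \<psi>_def ft_inversion[OF \<phi>] .
        qed
        then have "(LINT x|lborel. f' x * ft (- (2 * pi)) (\<lambda>\<xi>. radial A \<xi> * \<psi> \<xi>) x)
           = (LINT x|lborel. f' x * \<phi> x) + (LINT x|lborel. f' x * ft (- (2 * pi)) (\<lambda>\<xi>. radial (\<lambda>t. A t - 1) \<xi> * \<psi> \<xi>) x)"
          using integrable_weighted_product[OF f'(1) schwartz_weighted[OF \<phi>] fb] integrable_weighted_product[OF f'(1) schwartz_weighted[OF F1] fb]
          by (simp add: distrib_left)
        also have "(LINT x|lborel. f' x * ft (- (2 * pi)) (\<lambda>\<xi>. radial (\<lambda>t. A t - 1) \<xi> * \<psi> \<xi>) x) = (LINT x|lborel. conv \<kappa>A f' x * \<phi> x)"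
          unfolding \<psi>_def \<kappa>A(2)[OF \<phi>] by (rule conv_pairing[OF \<kappa>A(1) f'(1) fb schwartz_weighted[OF \<phi>]])
        finally show ?thesis .
      qed
      also have "(LINT x|lborel. f' x * \<phi> x) + (LINT x|lborel. conv \<kappa>A f' x * \<phi> x) + (LINT x|lborel. conv \<kappa>B u' x * \<phi> x) = (LINT x|lborel. g x * \<phi> x)"
      proof -
        have i: "integrable lborel (\<lambda>x. w x * \<phi> x)" if w: "w \<in> Lp p" "w \<in> borel_measurable borel" for w
        proof -
          obtain w' B e where w': "w' \<in> borel_measurable borel" "AE x in lborel. w x = w' x"
            and B: "B \<ge> 0" "integrable lborel e" "\<And>x. e x \<ge> 0" "\<And>x. norm (w' x) \<le> B + e x"
            by (rule Lp_representative[OF w(1) p]) blast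
          have "integrable lborel (\<lambda>x. w' x * \<phi> x)" by (rule integrable_weighted_product[OF w'(1) schwartz_weighted[OF \<phi>] B])
          moreover have "integrable lborel (\<lambda>x. w x * \<phi> x) \<longleftrightarrow> integrable lborel (\<lambda>x. w' x * \<phi> x)"
            using w'(2) by (intro integrable_cong_AE) (use w(2) w'(1) in \<open>auto elim: eventually_mono\<close>)
          ultimately show ?thesis by simp
        qed
        show ?thesis
          using i[OF f'(3,1)] i[OF Yf(1) cfm] i[OF Yu(1) cum] by (simp add: g_def h_def distrib_right add.assoc)
      qed
      also have "\<dots> = functional_of schwartz g \<phi>"
        using \<phi> pairing_representative[OF borel_imp_lebesgue_measurable[OF gm] gm _ \<phi>m] by (simp add: functional_of_def)
      finally show ?thesis .
    qed
    have "inhom_op s lam (functional_of schwartz u) = functional_of schwartz g"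
    proof
      fix \<phi> show "inhom_op s lam (functional_of schwartz u) \<phi> = functional_of schwartz g \<phi>"
        using main by (cases "\<phi> \<in> schwartz") (auto simp: inhom_op_def inv_fourier_dist_def functional_of_def)
    qed
    with g(1) bound show "\<exists>g\<in>Lp p. inhom_op s lam (functional_of schwartz u) = functional_of schwartz g \<and>
        Lp_norm p g \<le> C * (Lp_norm p f + Lp_norm p u)" by blast
  qed
qed

text \<open>The potential norm is computed from an unspecified representing function, which has the same norm as the one
constructed above because the two define the same functional.\<close>

theorem theorem1p9:
  fixes s lam :: real and p :: ennreal
  assumes "s > 0" and "lam > 1" and "1 \<le> p" and "p \<le> \<infinity>"
  shows "\<exists>C>0. \<forall>u f :: real ^ 'n::finite \<Rightarrow> complex.
    u \<in> Lp p \<longrightarrow> f \<in> Lp p \<longrightarrow>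
    has_frac_log_laplacian s (functional_of schwartz_inf u) (functional_of schwartz_inf f) \<longrightarrow>
    functional_of schwartz u \<in> potential_space s lam p \<and>
    potential_norm s lam p (functional_of schwartz u) \<le> C * (Lp_norm p f + Lp_norm p u)"
proof -
  obtain C where C: "C > 0"
    "\<And>u f :: real ^ 'n \<Rightarrow> complex. u \<in> Lp p \<Longrightarrow> f \<in> Lp p \<Longrightarrow>
      has_frac_log_laplacian s (functional_of schwartz_inf u) (functional_of schwartz_inf f) \<Longrightarrow>
      \<exists>g\<in>Lp p. inhom_op s lam (functional_of schwartz u) = functional_of schwartz g \<and>
        Lp_norm p g \<le> C * (Lp_norm p f + Lp_norm p u)"
    by (rule frac_log_estimate[OF assms(1-3)]) blast
  show ?thesis
  proof (intro exI[of _ C] conjI allI impI)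
    show "C > 0" by (rule C)
    fix u f :: "real ^ 'n \<Rightarrow> complex"
    assume u: "u \<in> Lp p" and f: "f \<in> Lp p"
      and uf: "has_frac_log_laplacian s (functional_of schwartz_inf u) (functional_of schwartz_inf f)"
    obtain g where g: "g \<in> Lp p" "inhom_op s lam (functional_of schwartz u) = functional_of schwartz g"
      "Lp_norm p g \<le> C * (Lp_norm p f + Lp_norm p u)" using C(2)[OF u f uf] by blast
    show "functional_of schwartz u \<in> potential_space s lam p"
      unfolding potential_space_def using functional_of_tempered[OF u assms(3)] g by blast
    define h where "h = (SOME h. h \<in> Lp p \<and> inhom_op s lam (functional_of schwartz u) = functional_of schwartz h)"
    have "h \<in> Lp p \<and> inhom_op s lam (functional_of schwartz u) = functional_of schwartz h"
      unfolding h_def by (rule someI[of _ g]) (use g in blast)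
    then have "Lp_norm p h = Lp_norm p g"
      using g(2) by (intro functional_of_eq_imp_Lp_norm_eq[OF assms(3) _ g(1)]) auto
    then show "potential_norm s lam p (functional_of schwartz u) \<le> C * (Lp_norm p f + Lp_norm p u)"
      unfolding potential_norm_def h_def[symmetric] using g(3) by simp
  qed
qed

end
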